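(* Suppose that, for each $n$, with $p=p(n)$ such that $p/n\to y\in(0,\infty)$, we have a matrix $\mathbf{X}=(X_{ij})_{1\le i\le p,\,1\le j\le n}$ of centered, square integrable real-valued random variables with the same variance equal to $1$. Assume that for all $(i,j)$ such that $1\le i\le p$ and $1\le j\le n$, $$\mathbb{E}\big(X_{ij}\mid\sigma(X_{\mathbf{u}};\ \mathbf{u}<_{\mathrm{lex}}(i,j))\big)=0\quad\text{a.s.}$$ Assume in addition that $$\lim_{a\to\infty}\limsup_{n\to\infty}\frac{1}{n^{2}}\sum_{i=1}^{p}\sum_{j=1}^{n}\big\Vert\mathbb{E}\big(X_{ij}^{2}-1\mid\sigma(X_{\mathbf{u}};\ \mathbf{u}\in B_{ij}^{a})\big)\big\Vert_{1}=0,$$ and that for any $\varepsilon>0$, $$\lim_{n\to\infty}\frac{1}{n^{2}}\sum_{i=1}^{p}\sum_{j=1}^{n}\mathbb{E}\big(X_{ij}^{2}I(|X_{ij}|>\varepsilon n^{1/2})\big)=0.$$ Then $$\mathbf{F}^{\mathbf{X}\mathbf{X}^{T}/n}\Rightarrow\tilde{G}_{y}\quad\text{in probability},$$ where $\tilde{G}_{y}$ is the standard Marchenko–Pastur distribution function.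
   Context: Lexicographic order on $\mathbb{Z}^{2}$: $(u,v)<_{\mathrm{lex}}(i,j)$ means $u<i$, or $u=i$ and $v<j$; $\le_{\mathrm{lex}}$ is the corresponding non-strict order. For a non-negative integer $a$, $B_{ij}^{a}=\{(u,v)\in\mathbb{Z}^{2}:\max(|u-i|,|v-j|)\ge a,\ (u,v)\le_{\mathrm{lex}}(i,j)\}$. In the $\sigma$-algebras, $\mathbf{u}$ ranges over those indices in the given set that index entries of the matrix $\mathbf{X}$, i.e. $\mathbf{u}\in\{1,\dots,p\}\times\{1,\dots,n\}$. For a symmetric $p\times p$ matrix $A$ with eigenvalues $\lambda_1\le\dots\le\lambda_p$, $\mathbf{F}^{A}(t)=\frac1p\sum_{k=1}^{p}I(\lambda_{k}\le t)$. The Lévy distance is $d(F,G)=\inf\{\varepsilon>0: F(x-\varepsilon)-\varepsilon\le G(x)\le F(x+\varepsilon)+\varepsilon\ \text{for all }x\}$, and "$\mathbf{F}_n\Rightarrow\mathbf{F}$ in probability" means $\lim_{n\to\infty}\mathbb{P}(d(\mathbf{F}_n,\mathbf{F})>\epsilon)=0$ for all $\epsilon>0$. $\Vert X\Vert_{1}=\mathbb{E}|X|$; $\mathbf{X}^T$ is the transpose. The standard Marchenko–Pastur law with parameter $y$ has density $\tilde{g}_{y}(x)=\frac{1}{2\pi xy}\sqrt{(c-x)(x-b)}\,I(b\le x\le c)$ and a point mass $1-1/y$ at the origin if $y>1$, where $b=(1-\sqrt{y})^{2}$ and $c=(1+\sqrt{y})^{2}$; $\tilde G_y$ is its distribution function.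 *)

theory Defs
  imports "HOL-Probability.Probability" "Jordan_Normal_Form.Char_Poly"
begin

definition lex_less :: "int \<times> int \<Rightarrow> int \<times> int \<Rightarrow> bool" where
  "lex_less u k \<longleftrightarrow> fst u < fst k \<or> (fst u = fst k \<and> snd u < snd k)"

definition lex_le :: "int \<times> int \<Rightarrow> int \<times> int \<Rightarrow> bool" where
  "lex_le u k \<longleftrightarrow> lex_less u k \<or> u = k"

definition far_past :: "nat \<Rightarrow> int \<times> int \<Rightarrow> (int \<times> int) set" where
  "far_past a k =
     {u. max \<bar>fst u - fst k\<bar> \<bar>snd u - snd k\<bar> \<ge> int a \<and> lex_le u k}"

definition entries :: "nat \<Rightarrow> nat \<Rightarrow> (int \<times> int) set" where
  "entries p n = {1..int p} \<times> {1..int n}"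

text \<open>The \<open>\<sigma>\<close>-algebra on \<open>space M\<close> generated by the real random variables
  \<open>X u\<close>, \<open>u \<in> S\<close>; it is the trivial one if \<open>S\<close> is empty.\<close>

definition sigma_rv :: "'a measure \<Rightarrow> ('i \<Rightarrow> 'a \<Rightarrow> real) \<Rightarrow> 'i set \<Rightarrow> 'a measure" where
  "sigma_rv M X S =
     sigma (space M) {X u -` A \<inter> space M | u A. u \<in> S \<and> A \<in> sets borel}"

text \<open>Library matrices are indexed from 0, the random field from 1.\<close>

definition data_matrix ::
  "nat \<Rightarrow> nat \<Rightarrow> (int \<times> int \<Rightarrow> 'a \<Rightarrow> real) \<Rightarrow> 'a \<Rightarrow> real Matrix.mat" where
  "data_matrix p n X \<omega> = Matrix.mat p n (\<lambda>(i, j). X (int i + 1, int j + 1) \<omega>)"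

text \<open>The multiset \<open>proots (char_poly A)\<close> lists the real eigenvalues with their algebraic
  multiplicities; for a symmetric \<open>p \<times> p\<close> matrix these are all \<open>p\<close> eigenvalues.\<close>

definition esd :: "real Matrix.mat \<Rightarrow> real \<Rightarrow> real" where
  "esd A t = (\<Sum>l\<in>#proots (char_poly A). indicat_real {..t} l) / real (dim_row A)"

definition levy_dist :: "(real \<Rightarrow> real) \<Rightarrow> (real \<Rightarrow> real) \<Rightarrow> real" where
  "levy_dist F G =
     Inf {\<epsilon>. \<epsilon> > 0 \<and> (\<forall>x. F (x - \<epsilon>) - \<epsilon> \<le> G x \<and> G x \<le> F (x + \<epsilon>) + \<epsilon>)}"

definition converges_in_prob ::
  "(nat \<Rightarrow> 'a measure) \<Rightarrow> (nat \<Rightarrow> 'a \<Rightarrow> real \<Rightarrow> real) \<Rightarrow> (real \<Rightarrow> real) \<Rightarrow> bool" where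
  "converges_in_prob M F G \<longleftrightarrow>
     (\<forall>\<epsilon>>0. (\<lambda>n. measure (M n) {\<omega> \<in> space (M n). levy_dist (F n \<omega>) G > \<epsilon>})
        \<longlonglongrightarrow> 0)"

definition mp_density :: "real \<Rightarrow> real \<Rightarrow> real" where
  "mp_density y x =
     (let b = (1 - sqrt y)\<^sup>2; c = (1 + sqrt y)\<^sup>2
      in 1 / (2 * pi * x * y) * sqrt ((c - x) * (x - b)) * indicat_real {b..c} x)"

definition mp_cdf :: "real \<Rightarrow> real \<Rightarrow> real" where
  "mp_cdf y t =
     (LINT x:{..t}|lborel. mp_density y x) + (if y > 1 \<and> 0 \<le> t then 1 - 1 / y else 0)"

end

theory Submission imports Defs "Jordan_Normal_Form.Schur_Decomposition" begin

text \<open>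
  Write \<open>S = X X\<^sup>T / n\<close>. All eigenvalues of \<open>S\<close> are nonnegative, so its spectral distribution
  can be tested against the functions \<open>x \<mapsto> 1 / (x + t)\<close> with \<open>t > 0\<close> only: difference quotients in
  \<open>t\<close> produce the powers of \<open>1 / (x + t)\<close>, polynomials in \<open>1 / (x + 1)\<close> approximate every continuous
  function of that variable, and continuous cut-offs control distribution functions in the Levy
  distance. Lemma \<open>stieltjes_levy_continuity\<close> makes this quantitative: closeness at finitely many
  \<open>t\<close> bounds the Levy distance. Hence it suffices to show that \<open>tr (S + t)\<^sup>-\<^sup>1 / p\<close> converges in mean
  square to the corresponding integral of the Marchenko--Pastur law, for each \<open>t > 0\<close>.

  The resolvent of \<open>S\<close> is quadratic in \<open>X\<close>. It is replaced by \<open>G = (r + K)\<^sup>-\<^sup>1\<close> with \<open>r\<^sup>2 = t\<close>, where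
  \<open>K\<close> is the skew-symmetric block matrix with off-diagonal blocks \<open>X / \<surd>n\<close> and \<open>- X\<^sup>T / \<surd>n\<close>. The
  upper left block of \<open>G\<close> is \<open>r (S + t)\<^sup>-\<^sup>1\<close>, the matrix \<open>K\<close> is linear in \<open>X\<close>, and skew symmetry alone
  bounds the rows and columns of \<open>G\<close> by \<open>1 / r\<close>, uniformly in \<open>X\<close>. Changing one
  entry of \<open>X\<close> is a perturbation of rank two, so the resolvent identity yields exact expansions:
  the \<open>m\<close>-th derivative of \<open>tr G / n\<close> in one entry has size \<open>n\<close> to the power \<open>- 1 - m / 2\<close>
  (\<open>norm_trace_smooth\<close>).

  These bounds feed Lindeberg's replacement argument (\<open>lindeberg_replacement\<close>). The entries are
  averaged out in reverse lexicographic order, each over the two values \<open>\<plusminus> 1\<close>. When entry \<open>k\<close> is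
  replaced, the function depends on the entries up to \<open>k\<close> only. The first-order term vanishes
  because the entries are martingale differences. The second-order coefficient hardly changes if
  the boundedly many entries close to \<open>k\<close> are set to zero; afterwards it is measurable with
  respect to the far past, and conditioning leaves the conditional variance term of the
  hypotheses. The remainder is controlled by the Lindeberg condition. The argument is applied to
  the square of the deviation from the limit, which yields concentration at the same time.

  It remains to treat a matrix of independent signs. Averaging \<open>x h(x)\<close> over \<open>x = \<plusminus> 1\<close> is half the
  difference of the two values of \<open>h\<close>, which acts as an integration by parts. It shows that the
  normalised traces \<open>g\<^sub>1\<close> and \<open>g\<^sub>2\<close> of the two diagonal blocks satisfy a quadratic equation up to an
  error of mean square \<open>O(1 / \<surd>n)\<close> (\<open>mean_signs_self_consistency\<close>). The positive root of that
  equation is stable under perturbation (\<open>mp_root_distance\<close>), and it is the transform of the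
  Marchenko--Pastur law, computed from an explicit primitive (\<open>mp_mean_resolvent\<close>).
\<close>

section \<open>Inverses of shifted skew-symmetric matrices\<close>

text \<open>The inverse of \<open>r + K\<close> on the indices below \<open>N\<close>, given by Cramer's rule. The explicit formula makes
  measurability in the entries of \<open>K\<close> immediate.\<close>

definition shift_inverse :: "real \<Rightarrow> nat \<Rightarrow> (nat \<Rightarrow> nat \<Rightarrow> real) \<Rightarrow> nat \<Rightarrow> nat \<Rightarrow> real" where
  "shift_inverse r N K a b =
     (let A = Matrix.mat N N (\<lambda>(i, j). (if i = j then r else 0) + K i j)
      in cofactor A b a / Determinant.det A)"

definition skew_on :: "nat \<Rightarrow> (nat \<Rightarrow> nat \<Rightarrow> real) \<Rightarrow> bool" where
  "skew_on N K \<longleftrightarrow> (\<forall>a<N. \<forall>b<N. K b a = - K a b)"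

lemma skew_form_zero:
  fixes K :: "nat \<Rightarrow> nat \<Rightarrow> real" and w :: "nat \<Rightarrow> real"
  assumes "skew_on N K"
  shows "(\<Sum>a<N. \<Sum>b<N. w a * K a b * w b) = 0"
proof -
  have "(\<Sum>a<N. \<Sum>b<N. w a * K a b * w b) = (\<Sum>a<N. \<Sum>b<N. w b * K b a * w a)"
    by (rule sum.swap)
  also have "\<dots> = (\<Sum>a<N. \<Sum>b<N. - (w a * K a b * w b))"
  proof (intro sum.cong refl)
    fix a b assume "b \<in> {..<N}" "a \<in> {..<N}"
    hence "K a b = - K b a" using assms unfolding skew_on_def by (metis lessThan_iff minus_minus)
    thus "w b * K b a * w a = - (w a * K a b * w b)" by (simp only: ) simp
  qed
  also have "\<dots> = - (\<Sum>a<N. \<Sum>b<N. w a * K a b * w b)"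
    by (simp add: sum_negf)
  finally show ?thesis by linarith
qed

lemma shifted_skew_form:
  fixes K :: "nat \<Rightarrow> nat \<Rightarrow> real" and w :: "nat \<Rightarrow> real"
  assumes "skew_on N K"
  shows "(\<Sum>a<N. \<Sum>b<N. w a * ((if a = b then r else 0) + K a b) * w b) = r * (\<Sum>a<N. (w a)\<^sup>2)"
proof -
  have "(\<Sum>a<N. \<Sum>b<N. w a * ((if a = b then r else 0) + K a b) * w b)
      = (\<Sum>a<N. \<Sum>b<N. (if a = b then r * (w a * w b) else 0)) + (\<Sum>a<N. \<Sum>b<N. w a * K a b * w b)"
    unfolding sum.distrib[symmetric] by (intro sum.cong refl) (simp add: algebra_simps)
  also have "(\<Sum>a<N. \<Sum>b<N. (if a = b then r * (w a * w b) else 0)) = r * (\<Sum>a<N. (w a)\<^sup>2)"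
    by (simp add: sum_distrib_left power2_eq_square)
  finally show ?thesis using skew_form_zero[OF assms, of w] by simp
qed

context
  fixes N :: nat and K :: "nat \<Rightarrow> nat \<Rightarrow> real" and r :: real
  assumes skew: "skew_on N K"
    and r_pos: "0 < r"
begin

text \<open>A kernel vector \<open>v\<close> would satisfy \<open>0 = v\<^sup>T (r + K) v = r v\<^sup>T v\<close>, since a skew form vanishes on the diagonal.\<close>

lemma shifted_skew_det_nonzero:
  "Determinant.det (Matrix.mat N N (\<lambda>(i, j). (if i = j then r else 0) + K i j)) \<noteq> 0"
proof
  let ?A = "Matrix.mat N N (\<lambda>(i, j). (if i = j then r else 0) + K i j)"
  assume "Determinant.det ?A = 0"
  then obtain v where v: "v \<in> carrier_vec N" "v \<noteq> 0\<^sub>v N" "?A *\<^sub>v v = 0\<^sub>v N"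
    using det_0_iff_vec_prod_zero[of ?A N] by auto
  have row: "(\<Sum>b<N. ((if a = b then r else 0) + K a b) * vec_index v b) = 0" if "a < N" for a
  proof -
    have "vec_index (?A *\<^sub>v v) a = 0" using v that by simp
    thus ?thesis using v(1) that by (simp add: scalar_prod_def atLeast0LessThan)
  qed
  have "r * (\<Sum>a<N. (vec_index v a)\<^sup>2)
      = (\<Sum>a<N. vec_index v a * (\<Sum>b<N. ((if a = b then r else 0) + K a b) * vec_index v b))"
    unfolding shifted_skew_form[OF skew, symmetric] by (simp add: sum_distrib_left mult.assoc)
  also have "\<dots> = 0" by (simp add: row)
  finally have "(\<Sum>a<N. (vec_index v a)\<^sup>2) = 0" using r_pos by simp
  hence "\<forall>a<N. vec_index v a = 0" by (subst (asm) sum_nonneg_eq_0_iff) auto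
  hence "v = 0\<^sub>v N" using v(1) by (intro eq_vecI) auto
  with v(2) show False by simp
qed

lemma shift_inverse_right:
  assumes "a < N" "b < N"
  shows "(\<Sum>c<N. ((if a = c then r else 0) + K a c) * shift_inverse r N K c b) = (if a = b then 1 else 0)"
proof -
  define A where "A = Matrix.mat N N (\<lambda>(i, j). (if i = j then r else 0) + K i j)"
  have A: "A \<in> carrier_mat N N" by (simp add: A_def)
  have "(A * adj_mat A) $$ (a, b) = (if a = b then Determinant.det A else 0)"
    using assms by (simp add: adj_mat(2)[OF A])
  hence "(\<Sum>c<N. A $$ (a,c) * cofactor A b c) = (if a = b then Determinant.det A else 0)"
    using assms A adj_mat(1)[OF A] by (simp add: scalar_prod_def atLeast0LessThan adj_mat_def)
  hence res: "(\<Sum>c<N. A $$ (a,c) * cofactor A b c) / Determinant.det A = (if a = b then 1 else 0)"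
    using shifted_skew_det_nonzero by (simp add: A_def)
  show ?thesis
    unfolding res[symmetric] sum_divide_distrib shift_inverse_def Let_def A_def[symmetric]
    by (intro sum.cong refl) (use assms in \<open>simp add: A_def\<close>)
qed

lemma shift_inverse_left:
  assumes "a < N" "b < N"
  shows "(\<Sum>c<N. shift_inverse r N K a c * ((if c = b then r else 0) + K c b)) = (if a = b then 1 else 0)"
proof -
  define A where "A = Matrix.mat N N (\<lambda>(i, j). (if i = j then r else 0) + K i j)"
  have A: "A \<in> carrier_mat N N" by (simp add: A_def)
  have "(adj_mat A * A) $$ (a, b) = (if a = b then Determinant.det A else 0)"
    using assms by (simp add: adj_mat(3)[OF A])
  hence "(\<Sum>c<N. cofactor A c a * A $$ (c,b)) = (if a = b then Determinant.det A else 0)"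
    using assms A adj_mat(1)[OF A] by (simp add: scalar_prod_def atLeast0LessThan adj_mat_def)
  hence res: "(\<Sum>c<N. cofactor A c a * A $$ (c,b)) / Determinant.det A = (if a = b then 1 else 0)"
    using shifted_skew_det_nonzero by (simp add: A_def)
  show ?thesis
    unfolding res[symmetric] sum_divide_distrib shift_inverse_def Let_def A_def[symmetric]
    by (intro sum.cong refl) (use assms in \<open>simp add: A_def\<close>)
qed

text \<open>Apply the quadratic form of \<open>r + K\<close> to a column of the inverse. The identity gives both the
  nonnegativity of the diagonal and, as the diagonal entry is itself at most the norm of its column,
  the norm bound below.\<close>

lemma shift_inverse_diag:
  assumes "a < N"
  shows "r * (\<Sum>c<N. (shift_inverse r N K c a)\<^sup>2) = shift_inverse r N K a a"
proof -
  let ?G = "shift_inverse r N K"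
  have "r * (\<Sum>c<N. (?G c a)\<^sup>2) = (\<Sum>c<N. ?G c a * (\<Sum>d<N. ((if c = d then r else 0) + K c d) * ?G d a))"
    unfolding shifted_skew_form[OF skew, symmetric] by (simp add: sum_distrib_left mult.assoc)
  also have "\<dots> = (\<Sum>c<N. if c = a then ?G c a else 0)"
    using assms by (intro sum.cong refl) (simp add: shift_inverse_right)
  also have "\<dots> = ?G a a" using assms by simp
  finally show ?thesis .
qed

lemma shift_inverse_column_norm:
  assumes "a < N"
  shows "(\<Sum>c<N. (shift_inverse r N K c a)\<^sup>2) \<le> 1 / r\<^sup>2"
proof -
  let ?G = "shift_inverse r N K" let ?S = "\<Sum>c<N. (?G c a)\<^sup>2"
  have "(?G a a)\<^sup>2 \<le> ?S" using assms by (intro member_le_sum) auto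
  hence "(r * ?S)\<^sup>2 \<le> ?S" unfolding shift_inverse_diag[OF assms] .
  moreover have "0 \<le> ?S" by (simp add: sum_nonneg)
  ultimately have "r\<^sup>2 * ?S \<le> 1"
    by (cases "?S = 0") (auto simp: power2_eq_square mult_ac mult_le_cancel_left1)
  thus ?thesis using r_pos by (simp add: field_simps)
qed

lemma shift_inverse_row_norm:
  assumes "a < N"
  shows "(\<Sum>c<N. (shift_inverse r N K a c)\<^sup>2) \<le> 1 / r\<^sup>2"
proof -
  let ?G = "shift_inverse r N K" let ?S = "\<Sum>c<N. (?G a c)\<^sup>2"
  have "r * ?S = (\<Sum>d<N. \<Sum>c<N. ?G a c * ((if c = d then r else 0) + K c d) * ?G a d)"
    unfolding shifted_skew_form[OF skew, symmetric] by (rule sum.swap)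
  also have "\<dots> = (\<Sum>d<N. (\<Sum>c<N. ?G a c * ((if c = d then r else 0) + K c d)) * ?G a d)"
    by (simp add: sum_distrib_right)
  also have "\<dots> = (\<Sum>c<N. if a = c then ?G a c else 0)"
    using assms by (intro sum.cong refl) (simp add: shift_inverse_left)
  also have "\<dots> = ?G a a" using assms by simp
  finally have eq: "r * ?S = ?G a a" .
  have "(?G a a)\<^sup>2 \<le> ?S" using assms by (intro member_le_sum) auto
  hence "(r * ?S)\<^sup>2 \<le> ?S" by (simp add: eq)
  moreover have "0 \<le> ?S" by (simp add: sum_nonneg)
  ultimately have "r\<^sup>2 * ?S \<le> 1"
    by (cases "?S = 0") (auto simp: power2_eq_square mult_ac mult_le_cancel_left1)
  thus ?thesis using r_pos by (simp add: field_simps)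
qed

lemma shift_inverse_entry_bound:
  assumes "a < N" "b < N"
  shows "\<bar>shift_inverse r N K a b\<bar> \<le> 1 / r"
proof -
  have "(shift_inverse r N K a b)\<^sup>2 \<le> (\<Sum>c<N. (shift_inverse r N K a c)\<^sup>2)"
    using assms by (intro member_le_sum) auto
  also have "\<dots> \<le> (1 / r)\<^sup>2" using shift_inverse_row_norm[OF assms(1)] by (simp add: power_divide)
  finally show ?thesis using r_pos by (simp add: abs_le_square_iff[symmetric])
qed

end

lemma shift_inverse_product_bound:
  fixes K K' :: "nat \<Rightarrow> nat \<Rightarrow> real"
  assumes "skew_on N K"
    and "skew_on N K'"
    and "0 < r" "a < N" "b < N"
  shows "\<bar>\<Sum>c<N. shift_inverse r N K a c * shift_inverse r N K' c b\<bar> \<le> 1 / r\<^sup>2"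
proof -
  have "(\<Sum>c<N. shift_inverse r N K a c * shift_inverse r N K' c b)\<^sup>2
     \<le> (\<Sum>c<N. (shift_inverse r N K a c)\<^sup>2) * (\<Sum>c<N. (shift_inverse r N K' c b)\<^sup>2)"
    by (rule Cauchy_Schwarz_ineq_sum)
  also have "\<dots> \<le> (1 / r\<^sup>2) * (1 / r\<^sup>2)"
    using assms by (intro mult_mono shift_inverse_row_norm shift_inverse_column_norm sum_nonneg) auto
  also have "\<dots> = (1 / r\<^sup>2)\<^sup>2" by (simp add: power2_eq_square)
  finally show ?thesis by (simp add: abs_le_square_iff[symmetric])
qed

text \<open>The identity \<open>H - G = - G (K' - K) H\<close> for the two inverses.\<close>

lemma shift_inverse_resolvent_identity:
  fixes K K' :: "nat \<Rightarrow> nat \<Rightarrow> real"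
  assumes "skew_on N K"
    and "skew_on N K'"
    and "0 < r" "a < N" "b < N"
  shows "shift_inverse r N K' a b - shift_inverse r N K a b
    = - (\<Sum>c<N. \<Sum>d<N. shift_inverse r N K a c * (K' c d - K c d) * shift_inverse r N K' d b)"
proof -
  let ?G = "shift_inverse r N K" let ?H = "shift_inverse r N K'"
  let ?\<delta> = "\<lambda>c d. if c = d then r else (0::real)"
  have "?H a b = (\<Sum>d<N. (if a = d then 1 else 0) * ?H d b)"
    using assms by (simp add: if_distrib[of "\<lambda>x. x * _"] cong: if_cong)
  also have "\<dots> = (\<Sum>d<N. (\<Sum>c<N. ?G a c * (?\<delta> c d + K c d)) * ?H d b)"
    by (intro sum.cong refl arg_cong2[where f = "(*)"])
       (use assms in \<open>simp add: shift_inverse_left\<close>)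
  also have "\<dots> = (\<Sum>c<N. \<Sum>d<N. ?G a c * (?\<delta> c d + K c d) * ?H d b)"
    by (subst sum.swap) (simp add: sum_distrib_right)
  finally have H: "?H a b = (\<Sum>c<N. \<Sum>d<N. ?G a c * (?\<delta> c d + K c d) * ?H d b)" .
  have "?G a b = (\<Sum>c<N. ?G a c * (if c = b then 1 else 0))"
    using assms by (simp add: if_distrib[of "\<lambda>x. _ * x"] cong: if_cong)
  also have "\<dots> = (\<Sum>c<N. ?G a c * (\<Sum>d<N. (?\<delta> c d + K' c d) * ?H d b))"
    by (intro sum.cong refl arg_cong2[where f = "(*)"])
       (use assms in \<open>simp add: shift_inverse_right\<close>)
  also have "\<dots> = (\<Sum>c<N. \<Sum>d<N. ?G a c * (?\<delta> c d + K' c d) * ?H d b)"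
    by (simp add: sum_distrib_left mult.assoc)
  finally have G: "?G a b = (\<Sum>c<N. \<Sum>d<N. ?G a c * (?\<delta> c d + K' c d) * ?H d b)" .
  have "(\<Sum>c<N. \<Sum>d<N. ?G a c * (?\<delta> c d + K c d) * ?H d b)
      - (\<Sum>c<N. \<Sum>d<N. ?G a c * (?\<delta> c d + K' c d) * ?H d b)
      = - (\<Sum>c<N. \<Sum>d<N. ?G a c * (K' c d - K c d) * ?H d b)"
    unfolding sum_subtractf[symmetric] sum_negf[symmetric]
    by (intro sum.cong refl) (simp add: algebra_simps)
  thus ?thesis using H G by linarith
qed

text \<open>If only one pair of skew-symmetric entries changes, then the double sum of the resolvent identity
  collapses to two terms.\<close>

lemma shift_inverse_rank_two:
  fixes K K' :: "nat \<Rightarrow> nat \<Rightarrow> real"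
  assumes "skew_on N K"
    and "skew_on N K'"
    and "0 < r" "c < N" "d < N" "a < N" "b < N" "a \<noteq> b"
    and diff: "\<And>c d. c < N \<Longrightarrow> d < N \<Longrightarrow> K' c d - K c d
       = v * ((if c = a \<and> d = b then 1 else 0) - (if c = b \<and> d = a then 1 else 0))"
  shows "shift_inverse r N K' c d = shift_inverse r N K c d
     - v * (shift_inverse r N K c a * shift_inverse r N K' b d
          - shift_inverse r N K c b * shift_inverse r N K' a d)"
proof -
  let ?G = "shift_inverse r N K" let ?H = "shift_inverse r N K'"
  have "(\<Sum>e<N. \<Sum>f<N. ?G c e * (K' e f - K e f) * ?H f d)
     = (\<Sum>e<N. \<Sum>f<N. (if e = a then if f = b then v * ?G c a * ?H b d else 0 else 0)
         - (if e = b then if f = a then v * ?G c b * ?H a d else 0 else 0))"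
    by (intro sum.cong refl) (auto simp: diff)
  also have "\<dots> = v * (?G c a * ?H b d - ?G c b * ?H a d)"
  proof -
    have del: "(\<Sum>e<N. \<Sum>f<N. (if e = i then if f = j then z else 0 else 0)) = z"
      if "i < N" "j < N" for i j and z :: real
    proof -
      have "(\<Sum>e<N. \<Sum>f<N. (if e = i then if f = j then z else 0 else 0))
         = (\<Sum>e<N. if e = i then z else 0)"
        by (intro sum.cong refl) (use that in auto)
      thus ?thesis using that by simp
    qed
    show ?thesis
      by (simp only: sum_subtractf del assms(6,7)) (simp add: algebra_simps)
  qed
  finally show ?thesis
    using shift_inverse_resolvent_identity[OF assms(1,2,3,4,5)] by simp
qed

section \<open>Perturbation of a single entry\<close>

definition mprod :: "nat \<Rightarrow> (nat \<Rightarrow> nat \<Rightarrow> real) \<Rightarrow> (nat \<Rightarrow> nat \<Rightarrow> real) \<Rightarrow> nat \<Rightarrow> nat \<Rightarrow> real" where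
  "mprod N G H a b = (\<Sum>c<N. G a c * H c b)"

text \<open>With \<open>E\<close> the elementary skew matrix at \<open>(a, b)\<close>, this is \<open>tr (E G E V)\<close>; for \<open>V = G\<^sup>2\<close> it is the
  second-order coefficient of the trace of the inverse.\<close>

definition second_form :: "nat \<Rightarrow> nat \<Rightarrow> (nat \<Rightarrow> nat \<Rightarrow> real) \<Rightarrow> (nat \<Rightarrow> nat \<Rightarrow> real) \<Rightarrow> real" where
  "second_form a b G V = G b a * V b a - G b b * V a a - G a a * V b b + G a b * V a b"

lemma abs_diff_two_products:
  fixes z1 z2 z3 z4 B C :: real
  assumes "\<bar>z1\<bar> \<le> B" "\<bar>z2\<bar> \<le> C" "\<bar>z3\<bar> \<le> B" "\<bar>z4\<bar> \<le> C"
  shows "\<bar>w * (z1 * z2 - z3 * z4)\<bar> \<le> \<bar>w\<bar> * (2 * (B * C))"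
proof -
  have "\<bar>z1 * z2\<bar> \<le> B * C" "\<bar>z3 * z4\<bar> \<le> B * C"
    using assms by (simp_all add: abs_mult mult_mono')
  hence "\<bar>z1 * z2 - z3 * z4\<bar> \<le> 2 * (B * C)" by linarith
  thus ?thesis by (simp add: abs_mult mult_left_mono)
qed

text \<open>The algebra of one perturbation step, where \<open>G\<close> and \<open>H\<close> are the inverses before and after. All
  matrix products that occur are bounded by \<open>\<beta>\<^sup>2\<close> entrywise, because they pair a row of norm \<open>\<beta>\<close> with a
  column of norm \<open>\<beta>\<close>; no bound here depends on \<open>N\<close>.\<close>

locale rank_two_perturbation =
  fixes N a b :: nat and G H :: "nat \<Rightarrow> nat \<Rightarrow> real" and v \<beta> :: real
  assumes ab: "a < N" "b < N"
    and perturb: "\<And>c d. c < N \<Longrightarrow> d < N \<Longrightarrow> H c d = G c d - v * (G c a * H b d - G c b * H a d)"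
    and beta: "0 \<le> \<beta>"
    and G_bd: "\<And>c d. c < N \<Longrightarrow> d < N \<Longrightarrow> \<bar>G c d\<bar> \<le> \<beta>"
    and H_bd: "\<And>c d. c < N \<Longrightarrow> d < N \<Longrightarrow> \<bar>H c d\<bar> \<le> \<beta>"
    and GG_bd: "\<And>c d. c < N \<Longrightarrow> d < N \<Longrightarrow> \<bar>mprod N G G c d\<bar> \<le> \<beta>\<^sup>2"
    and HG_bd: "\<And>c d. c < N \<Longrightarrow> d < N \<Longrightarrow> \<bar>mprod N H G c d\<bar> \<le> \<beta>\<^sup>2"
    and HH_bd: "\<And>c d. c < N \<Longrightarrow> d < N \<Longrightarrow> \<bar>mprod N H H c d\<bar> \<le> \<beta>\<^sup>2"
begin

lemma entry_change: "c < N \<Longrightarrow> d < N \<Longrightarrow> \<bar>H c d - G c d\<bar> \<le> 2 * \<beta>\<^sup>2 * \<bar>v\<bar>"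
  using abs_diff_two_products[of "G c a" \<beta> "H b d" \<beta> "G c b" "H a d" v] perturb[of c d] G_bd H_bd ab
  by (simp add: power2_eq_square mult_ac abs_minus_commute)

lemma mixed_product_left:
  assumes "e < N" "f < N"
  shows "mprod N H G e f = mprod N G G e f - v * (G e a * mprod N H G b f - G e b * mprod N H G a f)"
proof -
  have "mprod N H G e f = (\<Sum>c<N. G e c * G c f - v * (G e a * (H b c * G c f) - G e b * (H a c * G c f)))"
    unfolding mprod_def
  proof (intro sum.cong refl)
    fix c assume "c \<in> {..<N}"
    thus "H e c * G c f = G e c * G c f - v * (G e a * (H b c * G c f) - G e b * (H a c * G c f))"
      using perturb[of e c] assms by (auto simp: left_diff_distrib right_diff_distrib mult_ac)
  qed
  also have "\<dots> = mprod N G G e f - v * (G e a * mprod N H G b f - G e b * mprod N H G a f)"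
    by (simp add: mprod_def sum_subtractf flip: sum_distrib_left)
  finally show ?thesis .
qed

lemma square_right:
  assumes "e < N" "f < N"
  shows "mprod N H H e f = mprod N H G e f - v * (mprod N H G e a * H b f - mprod N H G e b * H a f)"
proof -
  have "mprod N H H e f = (\<Sum>c<N. H e c * G c f - v * (H e c * G c a * H b f - H e c * G c b * H a f))"
    unfolding mprod_def
  proof (intro sum.cong refl)
    fix c assume "c \<in> {..<N}"
    thus "H e c * H c f = H e c * G c f - v * (H e c * G c a * H b f - H e c * G c b * H a f)"
      using perturb[of c f] assms by (auto simp: left_diff_distrib right_diff_distrib mult_ac)
  qed
  also have "\<dots> = mprod N H G e f - v * (mprod N H G e a * H b f - mprod N H G e b * H a f)"
    by (simp add: mprod_def sum_subtractf flip: sum_distrib_left sum_distrib_right)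
  finally show ?thesis .
qed

lemma mixed_product_change:
  assumes "e < N" "f < N" shows "\<bar>mprod N H G e f - mprod N G G e f\<bar> \<le> 2 * \<beta> ^ 3 * \<bar>v\<bar>"
  using abs_diff_two_products[of "G e a" \<beta> "mprod N H G b f" "\<beta>\<^sup>2" "G e b" "mprod N H G a f" v]
    mixed_product_left[OF assms] G_bd HG_bd ab assms
  by (simp add: power2_eq_square power3_eq_cube mult_ac abs_minus_commute)

lemma square_change:
  assumes "e < N" "f < N" shows "\<bar>mprod N H H e f - mprod N G G e f\<bar> \<le> 4 * \<beta> ^ 3 * \<bar>v\<bar>"
proof -
  have "\<bar>mprod N H H e f - mprod N H G e f\<bar> \<le> 2 * \<beta> ^ 3 * \<bar>v\<bar>"
    using abs_diff_two_products[of "mprod N H G e a" "\<beta>\<^sup>2" "H b f" \<beta> "mprod N H G e b" "H a f" v]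
      square_right[OF assms] H_bd HG_bd ab assms
    by (simp add: power2_eq_square power3_eq_cube mult_ac abs_minus_commute)
  from order.trans[OF abs_triangle_ineq add_mono[OF this mixed_product_change[OF assms]]]
  show ?thesis by (simp add: mult_ac)
qed

lemma trace_expansion_1:
  "(\<Sum>c<N. H c c) - (\<Sum>c<N. G c c) = - v * (mprod N H G b a - mprod N H G a b)"
proof -
  have "(\<Sum>c<N. H c c) = (\<Sum>c<N. G c c - v * (H b c * G c a - H a c * G c b))"
    by (intro sum.cong refl) (use perturb in \<open>fastforce simp: mult_ac\<close>)
  thus ?thesis by (simp add: mprod_def sum_subtractf flip: sum_distrib_left)
qed

text \<open>Iterating the resolvent identity inside the trace. The mixed product \<open>H G\<close> on the right makes this an
  identity; replacing it by \<open>G\<^sup>2\<close> costs one more order in \<open>v\<close>.\<close>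

lemma trace_expansion_2:
  "(\<Sum>c<N. H c c) - (\<Sum>c<N. G c c) + v * (mprod N G G b a - mprod N G G a b)
     = v\<^sup>2 * second_form a b G (mprod N H G)"
proof -
  let ?W = "mprod N H G" and ?U = "mprod N G G"
  have ba: "?W b a - ?U b a = - v * (G b a * ?W b a - G b b * ?W a a)"
    using mixed_product_left[of b a] ab by linarith
  have ab': "?W a b - ?U a b = - v * (G a a * ?W b b - G a b * ?W a b)"
    using mixed_product_left[of a b] ab by linarith
  have "(\<Sum>c<N. H c c) - (\<Sum>c<N. G c c) + v * (?U b a - ?U a b) = - v * (?W b a - ?U b a) + v * (?W a b - ?U a b)"
    unfolding trace_expansion_1 by (simp add: algebra_simps)
  also have "\<dots> = v\<^sup>2 * second_form a b G ?W"
    unfolding ba ab' second_form_def by (simp add: algebra_simps power2_eq_square)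
  finally show ?thesis .
qed

lemma trace_change_1: "\<bar>(\<Sum>c<N. H c c) - (\<Sum>c<N. G c c)\<bar> \<le> 2 * \<beta>\<^sup>2 * \<bar>v\<bar>"
proof -
  have "\<bar>mprod N H G b a - mprod N H G a b\<bar> \<le> 2 * \<beta>\<^sup>2"
    using HG_bd[of b a] HG_bd[of a b] ab by linarith
  from mult_left_mono[OF this, of "\<bar>v\<bar>"] show ?thesis
    unfolding trace_expansion_1 by (simp add: abs_mult mult_ac)
qed

lemma first_coefficient_bound: "\<bar>mprod N G G b a - mprod N G G a b\<bar> \<le> 2 * \<beta>\<^sup>2"
  using GG_bd[of b a] GG_bd[of a b] ab by linarith

lemma second_form_bound:
  assumes "\<And>c d. c < N \<Longrightarrow> d < N \<Longrightarrow> \<bar>V c d\<bar> \<le> C" "\<And>c d. c < N \<Longrightarrow> d < N \<Longrightarrow> \<bar>A c d\<bar> \<le> B"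
    and "i < N" "j < N"
  shows "\<bar>second_form i j A V\<bar> \<le> 4 * (B * C)"
proof -
  have "\<bar>A c d * V e f\<bar> \<le> B * C" if "c < N" "d < N" "e < N" "f < N" for c d e f
    using assms that by (simp add: abs_mult mult_mono')
  from this[of j i j i] this[of j j i i] this[of i i j j] this[of i j i j] assms(3,4)
  show ?thesis unfolding second_form_def by linarith
qed

lemma trace_change_2:
  "\<bar>(\<Sum>c<N. H c c) - (\<Sum>c<N. G c c) + v * (mprod N G G b a - mprod N G G a b)\<bar> \<le> 4 * \<beta> ^ 3 * v\<^sup>2"
proof -
  have "\<bar>second_form a b G (mprod N H G)\<bar> \<le> 4 * (\<beta> * \<beta>\<^sup>2)"
    by (rule second_form_bound) (use HG_bd G_bd ab in auto)
  from mult_left_mono[OF this, of "v\<^sup>2"] show ?thesis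
    unfolding trace_expansion_2 by (simp add: abs_mult power2_eq_square power3_eq_cube mult_ac)
qed

lemma trace_change_3:
  "\<bar>(\<Sum>c<N. H c c) - (\<Sum>c<N. G c c) + v * (mprod N G G b a - mprod N G G a b)
      - v\<^sup>2 * second_form a b G (mprod N G G)\<bar> \<le> 8 * \<beta> ^ 4 * \<bar>v\<bar> ^ 3"
proof -
  let ?D = "\<lambda>e f. mprod N H G e f - mprod N G G e f"
  have "second_form a b G (mprod N H G) - second_form a b G (mprod N G G) = second_form a b G ?D"
    unfolding second_form_def by (simp add: algebra_simps)
  moreover have "\<bar>second_form a b G ?D\<bar> \<le> 4 * (\<beta> * (2 * \<beta> ^ 3 * \<bar>v\<bar>))"
    by (rule second_form_bound) (use mixed_product_change G_bd ab in auto)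
  ultimately have "\<bar>v\<^sup>2 * second_form a b G (mprod N H G) - v\<^sup>2 * second_form a b G (mprod N G G)\<bar>
     \<le> v\<^sup>2 * (4 * (\<beta> * (2 * \<beta> ^ 3 * \<bar>v\<bar>)))"
    by (simp add: abs_mult mult_left_mono flip: right_diff_distrib)
  also have "\<dots> = 8 * \<beta> ^ 4 * \<bar>v\<bar> ^ 3"
    unfolding power2_abs[of v, symmetric]
    by (simp only: power2_eq_square power3_eq_cube power4_eq_xxxx mult_ac)
  finally show ?thesis unfolding trace_expansion_2 .
qed

lemma second_coefficient_change:
  assumes "i < N" "j < N"
  shows "\<bar>second_form i j H (mprod N H H) - second_form i j G (mprod N G G)\<bar> \<le> 24 * \<beta> ^ 4 * \<bar>v\<bar>"
proof -
  let ?D = "\<lambda>e f. mprod N H H e f - mprod N G G e f" and ?E = "\<lambda>e f. H e f - G e f"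
  have eq: "second_form i j H (mprod N H H) - second_form i j G (mprod N G G)
     = second_form i j ?E (mprod N H H) + second_form i j G ?D"
    unfolding second_form_def by (simp add: algebra_simps)
  have D: "\<bar>second_form i j G ?D\<bar> \<le> 4 * (\<beta> * (4 * \<beta> ^ 3 * \<bar>v\<bar>))"
    by (rule second_form_bound) (use square_change G_bd assms in auto)
  have E: "\<bar>second_form i j ?E (mprod N H H)\<bar> \<le> 4 * ((2 * \<beta>\<^sup>2 * \<bar>v\<bar>) * \<beta>\<^sup>2)"
    by (rule second_form_bound) (use HH_bd entry_change assms in auto)
  have "4 * ((2 * \<beta>\<^sup>2 * \<bar>v\<bar>) * \<beta>\<^sup>2) + 4 * (\<beta> * (4 * \<beta> ^ 3 * \<bar>v\<bar>)) = 24 * \<beta> ^ 4 * \<bar>v\<bar>"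
    by (simp add: eval_nat_numeral)
  thus ?thesis unfolding eq using order.trans[OF abs_triangle_ineq add_mono[OF E D]] by (simp only:)
qed

lemma first_coefficient_change:
  assumes "i < N" "j < N"
  shows "\<bar>(mprod N H H j i - mprod N H H i j) - (mprod N G G j i - mprod N G G i j)\<bar> \<le> 8 * \<beta> ^ 3 * \<bar>v\<bar>"
proof -
  have eq: "(mprod N H H j i - mprod N H H i j) - (mprod N G G j i - mprod N G G i j)
    = (mprod N H H j i - mprod N G G j i) - (mprod N H H i j - mprod N G G i j)" by simp
  show ?thesis unfolding eq
    using order.trans[OF abs_triangle_ineq4 add_mono[OF square_change[of j i] square_change[of i j]]] assms
    by (simp add: mult_ac)
qed

end

text \<open>The blocks \<open>X / \<surd>n\<close> (rows below \<open>p\<close>, columns from \<open>p\<close> on) and \<open>- X\<^sup>T / \<surd>n\<close>; the shift by one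
  translates between matrix indices and the indices of the random field.\<close>

definition skew_block :: "nat \<Rightarrow> nat \<Rightarrow> (int \<times> int \<Rightarrow> real) \<Rightarrow> nat \<Rightarrow> nat \<Rightarrow> real" where
  "skew_block p n x a b =
     (if a < p \<and> p \<le> b then x (int a + 1, int (b - p) + 1) / sqrt (real n)
      else if b < p \<and> p \<le> a then - x (int b + 1, int (a - p) + 1) / sqrt (real n) else 0)"

definition row_index :: "int \<times> int \<Rightarrow> nat" where
  "row_index k = nat (fst k - 1)"

definition col_index :: "nat \<Rightarrow> int \<times> int \<Rightarrow> nat" where
  "col_index p k = p + nat (snd k - 1)"

lemma index_bounds:
  assumes "k \<in> entries p n"
  shows "row_index k < p" "p \<le> col_index p k" "col_index p k < p + n" "row_index k < p + n"
    "row_index k \<noteq> col_index p k"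
  using assms by (auto simp: entries_def row_index_def col_index_def)

lemma entry_index_iff:
  assumes "k \<in> entries p n" "p \<le> d"
  shows "(int c + 1, int (d - p) + 1) = k \<longleftrightarrow> c = row_index k \<and> d = col_index p k"
proof -
  obtain i j where k: "k = (i, j)" by force
  have "1 \<le> i" "1 \<le> j" using assms(1) by (auto simp: k entries_def)
  thus ?thesis using assms(2) unfolding k row_index_def col_index_def by auto
qed

lemma skew_on_block: "skew_on N (skew_block p n x)"
  by (auto simp: skew_on_def skew_block_def)

lemma skew_block_update:
  assumes "k \<in> entries p n" "c < p + n" "d < p + n"
  shows "skew_block p n (x(k := v)) c d - skew_block p n x c d =
     (v - x k) / sqrt (real n) *
     ((if c = row_index k \<and> d = col_index p k then 1 else 0) - (if c = col_index p k \<and> d = row_index k then 1 else 0))"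
proof -
  note ib = index_bounds[OF assms(1)]
  consider (11) "c < p" "d < p" | (12) "c < p" "p \<le> d" | (21) "p \<le> c" "d < p" | (22) "p \<le> c" "p \<le> d"
    by linarith
  thus ?thesis
  proof cases
    case 11
    hence "d \<noteq> col_index p k" "c \<noteq> col_index p k" using ib by linarith+
    thus ?thesis using 11 by (simp add: skew_block_def)
  next
    case 12
    hence "c \<noteq> col_index p k" using ib by linarith
    moreover have "(x(k := v)) (int c + 1, int (d - p) + 1) - x (int c + 1, int (d - p) + 1)
        = (if c = row_index k \<and> d = col_index p k then v - x k else 0)"
      using entry_index_iff[OF assms(1) 12(2), of c] by (simp only: fun_upd_apply split: if_split) auto
    ultimately show ?thesis using 12 by (simp add: skew_block_def diff_divide_distrib[symmetric] del: fun_upd_apply)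
  next
    case 21
    hence "d \<noteq> col_index p k" using ib by linarith
    have "(x(k := v)) (int d + 1, int (c - p) + 1) - x (int d + 1, int (c - p) + 1)
        = (if c = col_index p k \<and> d = row_index k then v - x k else 0)"
      using entry_index_iff[OF assms(1) 21(1), of d] by (simp only: fun_upd_apply split: if_split) auto
    hence upd: "(x(k := v)) (int d + 1, int (c - p) + 1) = x (int d + 1, int (c - p) + 1)
        + (if c = col_index p k \<and> d = row_index k then v - x k else 0)" by linarith
    show ?thesis using 21 \<open>d \<noteq> col_index p k\<close> unfolding skew_block_def
      by (simp add: upd diff_divide_distrib add_divide_distrib del: fun_upd_apply of_nat_diff)
  next
    case 22
    hence "d \<noteq> row_index k" "c \<noteq> row_index k" using ib by linarith+
    thus ?thesis using 22 by (simp add: skew_block_def)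
  qed
qed

definition block_resolvent :: "real \<Rightarrow> nat \<Rightarrow> nat \<Rightarrow> (int \<times> int \<Rightarrow> real) \<Rightarrow> nat \<Rightarrow> nat \<Rightarrow> real" where
  "block_resolvent r p n x = shift_inverse r (p + n) (skew_block p n x)"

lemma block_resolvent_update:
  assumes "0 < r" "k \<in> entries p n" "c < p + n" "d < p + n"
  shows "block_resolvent r p n (x(k := v)) c d = block_resolvent r p n x c d
     - (v - x k) / sqrt (real n) *
       (block_resolvent r p n x c (row_index k) * block_resolvent r p n (x(k := v)) (col_index p k) d
      - block_resolvent r p n x c (col_index p k) * block_resolvent r p n (x(k := v)) (row_index k) d)"
  unfolding block_resolvent_def
  by (rule shift_inverse_rank_two)
     (use assms index_bounds[OF assms(2)] in \<open>simp_all add: skew_on_block skew_block_update\<close>)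

lemma block_resolvent_entry_bound:
  assumes "0 < r" "c < p + n" "d < p + n"
  shows "\<bar>block_resolvent r p n x c d\<bar> \<le> 1 / r"
  unfolding block_resolvent_def
  using shift_inverse_entry_bound[OF skew_on_block assms(1) assms(2,3)] .

lemma block_resolvent_product_bound:
  assumes "0 < r" "c < p + n" "d < p + n"
  shows "\<bar>mprod (p + n) (block_resolvent r p n x) (block_resolvent r p n z) c d\<bar> \<le> (1 / r)\<^sup>2"
  unfolding block_resolvent_def mprod_def power_divide power_one
  using shift_inverse_product_bound[OF skew_on_block skew_on_block assms] .

section \<open>Functions that are smooth in each entry, and averaging over a sign\<close>

abbreviation vectors :: "('k \<Rightarrow> real) measure" where
  "vectors \<equiv> PiM UNIV (\<lambda>_. borel)"

text \<open>The scale \<open>s\<close> stands for \<open>\<surd>n\<close>: each derivative in an entry gains a factor \<open>1 / s\<close>, and the first one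
  an additional \<open>1 / s\<^sup>2\<close> from the normalisation of the trace. Expansions with explicit coefficients are
  used in place of derivatives, which makes the class closed under averaging over an entry. The
  Lipschitz bounds on the coefficients play the part of mixed derivatives.\<close>

definition entrywise_smooth :: "real \<Rightarrow> 'k set \<Rightarrow> real \<Rightarrow> (('k \<Rightarrow> real) \<Rightarrow> real) \<Rightarrow> bool" where
  "entrywise_smooth s I c F \<longleftrightarrow> F \<in> borel_measurable vectors \<and> (\<forall>x. \<bar>F x\<bar> \<le> c) \<and>
     (\<exists>F1 F2. \<forall>k\<in>I. F1 k \<in> borel_measurable vectors \<and> F2 k \<in> borel_measurable vectors \<and>
        (\<forall>x v. \<bar>F1 k x\<bar> \<le> c / s ^ 3 \<and> \<bar>F2 k x\<bar> \<le> c / s ^ 4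
          \<and> \<bar>F (x(k := v)) - F x\<bar> \<le> c / s ^ 3 * \<bar>v - x k\<bar>
          \<and> \<bar>F (x(k := v)) - F x - (v - x k) * F1 k x\<bar> \<le> c / s ^ 4 * (v - x k)\<^sup>2
          \<and> \<bar>F (x(k := v)) - F x - (v - x k) * F1 k x - (v - x k)\<^sup>2 * F2 k x\<bar> \<le> c / s ^ 5 * \<bar>v - x k\<bar> ^ 3
          \<and> (\<forall>u\<in>I. \<bar>F1 k (x(u := v)) - F1 k x\<bar> \<le> c / s ^ 4 * \<bar>v - x u\<bar>
                \<and> \<bar>F2 k (x(u := v)) - F2 k x\<bar> \<le> c / s ^ 5 * \<bar>v - x u\<bar>)))"

lemma entrywise_smoothI:
  assumes "F \<in> borel_measurable vectors" "\<And>x. \<bar>F x\<bar> \<le> c"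
    and "\<And>k. k \<in> I \<Longrightarrow> D k \<in> borel_measurable vectors"
    and "\<And>k. k \<in> I \<Longrightarrow> E k \<in> borel_measurable vectors"
    and "\<And>k x. k \<in> I \<Longrightarrow> \<bar>D k x\<bar> \<le> c / s ^ 3"
    and "\<And>k x. k \<in> I \<Longrightarrow> \<bar>E k x\<bar> \<le> c / s ^ 4"
    and "\<And>k x v. k \<in> I \<Longrightarrow> \<bar>F (x(k := v)) - F x\<bar> \<le> c / s ^ 3 * \<bar>v - x k\<bar>"
    and "\<And>k x v. k \<in> I \<Longrightarrow> \<bar>F (x(k := v)) - F x - (v - x k) * D k x\<bar> \<le> c / s ^ 4 * (v - x k)\<^sup>2"
    and "\<And>k x v. k \<in> I \<Longrightarrow>
      \<bar>F (x(k := v)) - F x - (v - x k) * D k x - (v - x k)\<^sup>2 * E k x\<bar> \<le> c / s ^ 5 * \<bar>v - x k\<bar> ^ 3"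
    and "\<And>k u x v. k \<in> I \<Longrightarrow> u \<in> I \<Longrightarrow> \<bar>D k (x(u := v)) - D k x\<bar> \<le> c / s ^ 4 * \<bar>v - x u\<bar>"
    and "\<And>k u x v. k \<in> I \<Longrightarrow> u \<in> I \<Longrightarrow> \<bar>E k (x(u := v)) - E k x\<bar> \<le> c / s ^ 5 * \<bar>v - x u\<bar>"
  shows "entrywise_smooth s I c F"
  unfolding entrywise_smooth_def
proof (intro conjI allI)
  show "F \<in> borel_measurable vectors" "\<bar>F x\<bar> \<le> c" for x by (rule assms)+
qed (rule exI[of _ D], rule exI[of _ E], intro ballI conjI allI assms)

text \<open>The conditional expectation that integrates entry \<open>k\<close> out against a fair sign. Iterating this operator
  avoids a product space for the comparison matrix.\<close>

definition sign_avg :: "'k \<Rightarrow> (('k \<Rightarrow> real) \<Rightarrow> real) \<Rightarrow> ('k \<Rightarrow> real) \<Rightarrow> real" where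
  "sign_avg k F x = (F (x(k := 1)) + F (x(k := -1))) / 2"

definition zero_outside :: "'k set \<Rightarrow> ('k \<Rightarrow> real) \<Rightarrow> 'k \<Rightarrow> real" where
  "zero_outside S x = (\<lambda>u. if u \<in> S then x u else 0)"

definition depends_on :: "'k set \<Rightarrow> (('k \<Rightarrow> real) \<Rightarrow> real) \<Rightarrow> bool" where
  "depends_on S F \<longleftrightarrow> (\<forall>x. F x = F (zero_outside S x))"

lemma measurable_into_vectors:
  assumes "\<And>u. (\<lambda>\<omega>. X \<omega> u) \<in> borel_measurable N"
  shows "X \<in> measurable N vectors"
  by (rule measurable_PiM_single') (use assms in auto)

lemma measurable_coordinate: "(\<lambda>x. x k) \<in> borel_measurable vectors"
  by (rule measurable_component_singleton) simp

lemma measurable_update_const: "(\<lambda>x. x(k := v)) \<in> measurable vectors vectors"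
proof (rule measurable_into_vectors)
  show "(\<lambda>x. (x(k := v)) u) \<in> borel_measurable vectors" for u
    by (cases "u = k") (simp_all add: measurable_coordinate)
qed

lemma measurable_zero_outside:
  assumes "\<And>u. u \<in> S \<Longrightarrow> X u \<in> borel_measurable N"
  shows "(\<lambda>\<omega>. zero_outside S (\<lambda>u. X u \<omega>)) \<in> measurable N vectors"
proof (rule measurable_into_vectors)
  show "(\<lambda>\<omega>. zero_outside S (\<lambda>u. X u \<omega>) u) \<in> borel_measurable N" for u
    using assms by (cases "u \<in> S") (simp_all add: zero_outside_def)
qed

lemma sign_avg_measurable:
  assumes "F \<in> borel_measurable vectors" shows "sign_avg k F \<in> borel_measurable vectors"
proof -
  note [measurable] = assms measurable_update_const
  have "(\<lambda>x. (F (x(k := 1)) + F (x(k := -1))) / 2) \<in> borel_measurable vectors" by measurable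
  thus ?thesis by (simp add: sign_avg_def[abs_def])
qed

lemma abs_average: "\<bar>A\<bar> \<le> B \<Longrightarrow> \<bar>A'\<bar> \<le> B \<Longrightarrow> \<bar>(A + A') / 2\<bar> \<le> (B::real)"
  by (auto simp: abs_le_iff field_simps)

text \<open>Averaging commutes with changing another entry, so all expansions survive with averaged
  coefficients; in the averaged entry itself the function is constant.\<close>

lemma entrywise_smooth_sign_avg:
  assumes "entrywise_smooth s I c F" "0 \<le> c" "0 < s"
  shows "entrywise_smooth s I c (sign_avg w F)"
proof -
  from assms(1) obtain F1 F2 where meas: "F \<in> borel_measurable vectors" and bd: "\<And>x. \<bar>F x\<bar> \<le> c"
    and F12: "\<And>k. k \<in> I \<Longrightarrow> F1 k \<in> borel_measurable vectors \<and> F2 k \<in> borel_measurable vectors"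
    and A: "\<And>k x. k \<in> I \<Longrightarrow> \<bar>F1 k x\<bar> \<le> c / s ^ 3" "\<And>k x. k \<in> I \<Longrightarrow> \<bar>F2 k x\<bar> \<le> c / s ^ 4"
    and B: "\<And>k x v. k \<in> I \<Longrightarrow> \<bar>F (x(k := v)) - F x\<bar> \<le> c / s ^ 3 * \<bar>v - x k\<bar>"
    and C: "\<And>k x v. k \<in> I \<Longrightarrow> \<bar>F (x(k := v)) - F x - (v - x k) * F1 k x\<bar> \<le> c / s ^ 4 * (v - x k)\<^sup>2"
    and D: "\<And>k x v. k \<in> I \<Longrightarrow> \<bar>F (x(k := v)) - F x - (v - x k) * F1 k x - (v - x k)\<^sup>2 * F2 k x\<bar> \<le> c / s ^ 5 * \<bar>v - x k\<bar> ^ 3"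
    and E: "\<And>k u x v. k \<in> I \<Longrightarrow> u \<in> I \<Longrightarrow> \<bar>F1 k (x(u := v)) - F1 k x\<bar> \<le> c / s ^ 4 * \<bar>v - x u\<bar>"
    and G: "\<And>k u x v. k \<in> I \<Longrightarrow> u \<in> I \<Longrightarrow> \<bar>F2 k (x(u := v)) - F2 k x\<bar> \<le> c / s ^ 5 * \<bar>v - x u\<bar>"
    unfolding entrywise_smooth_def by blast
  define P1 where "P1 k = (if k = w then (\<lambda>_. 0) else sign_avg w (F1 k))" for k
  define P2 where "P2 k = (if k = w then (\<lambda>_. 0) else sign_avg w (F2 k))" for k
  have pos: "0 \<le> c / s ^ m" "0 \<le> c * \<bar>z\<bar> / s ^ m" "0 \<le> c * \<bar>z\<bar> ^ j / s ^ m" "0 \<le> c * z\<^sup>2 / s ^ m"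
    for m j and z :: real using assms by simp_all
  have comm: "k \<noteq> w \<Longrightarrow> (x(k := v))(w := z) = (x(w := z))(k := v)" for x :: "'a \<Rightarrow> real" and k v z
    by (rule fun_upd_twist)
  show ?thesis
  proof (rule entrywise_smoothI[where D = P1 and E = P2])
    show "sign_avg w F \<in> borel_measurable vectors" by (rule sign_avg_measurable[OF meas])
    show "\<bar>sign_avg w F x\<bar> \<le> c" for x unfolding sign_avg_def by (rule abs_average[OF bd bd])
    fix k v and x :: "'a \<Rightarrow> real" assume k: "k \<in> I"
    show "P1 k \<in> borel_measurable vectors"
      using F12[OF k] by (auto simp: P1_def intro!: sign_avg_measurable)
    show "P2 k \<in> borel_measurable vectors"
      using F12[OF k] by (auto simp: P2_def intro!: sign_avg_measurable)
    show "\<bar>P1 k x\<bar> \<le> c / s ^ 3" 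
      using abs_average[OF A(1)[OF k, of "x(w := 1)"] A(1)[OF k, of "x(w := -1)"]] pos
      by (auto simp: P1_def sign_avg_def)
    show "\<bar>P2 k x\<bar> \<le> c / s ^ 4" 
      using abs_average[OF A(2)[OF k, of "x(w := 1)"] A(2)[OF k, of "x(w := -1)"]] pos
      by (auto simp: P2_def sign_avg_def)
    let ?p = "x(w := 1)" and ?m = "x(w := -1)"
    show "\<bar>sign_avg w F (x(k := v)) - sign_avg w F x\<bar> \<le> c / s ^ 3 * \<bar>v - x k\<bar>"
    proof (cases "k = w")
      case False
      have "sign_avg w F (x(k := v)) - sign_avg w F x = ((F (?p(k := v)) - F ?p) + (F (?m(k := v)) - F ?m)) / 2"
        using False by (simp add: sign_avg_def comm field_simps)
      also have "\<bar>\<dots>\<bar> \<le> c / s ^ 3 * \<bar>v - x k\<bar>"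
        using abs_average[OF B[OF k, of ?p v, unfolded fun_upd_other[OF False]] B[OF k, of ?m v, unfolded fun_upd_other[OF False]]] .
      finally show ?thesis .
    qed (use pos in \<open>auto simp: sign_avg_def\<close>)
    show "\<bar>sign_avg w F (x(k := v)) - sign_avg w F x - (v - x k) * P1 k x\<bar> \<le> c / s ^ 4 * (v - x k)\<^sup>2"
    proof (cases "k = w")
      case False
      have "sign_avg w F (x(k := v)) - sign_avg w F x - (v - x k) * P1 k x
        = ((F (?p(k := v)) - F ?p - (v - x k) * F1 k ?p) + (F (?m(k := v)) - F ?m - (v - x k) * F1 k ?m)) / 2"
        using False by (simp add: sign_avg_def comm P1_def field_simps)
      also have "\<bar>\<dots>\<bar> \<le> c / s ^ 4 * (v - x k)\<^sup>2"
        using abs_average[OF C[OF k, of ?p v, unfolded fun_upd_other[OF False]] C[OF k, of ?m v, unfolded fun_upd_other[OF False]]] by simp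
      finally show ?thesis .
    qed (use pos in \<open>auto simp: sign_avg_def P1_def\<close>)
    show "\<bar>sign_avg w F (x(k := v)) - sign_avg w F x - (v - x k) * P1 k x - (v - x k)\<^sup>2 * P2 k x\<bar>
        \<le> c / s ^ 5 * \<bar>v - x k\<bar> ^ 3"
    proof (cases "k = w")
      case False
      have "sign_avg w F (x(k := v)) - sign_avg w F x - (v - x k) * P1 k x - (v - x k)\<^sup>2 * P2 k x
        = ((F (?p(k := v)) - F ?p - (v - x k) * F1 k ?p - (v - x k)\<^sup>2 * F2 k ?p)
         + (F (?m(k := v)) - F ?m - (v - x k) * F1 k ?m - (v - x k)\<^sup>2 * F2 k ?m)) / 2"
        using False by (simp add: sign_avg_def comm P1_def P2_def field_simps)
      also have "\<bar>\<dots>\<bar> \<le> c / s ^ 5 * \<bar>v - x k\<bar> ^ 3"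
        using abs_average[OF D[OF k, of ?p v, unfolded fun_upd_other[OF False]] D[OF k, of ?m v, unfolded fun_upd_other[OF False]]] by simp
      finally show ?thesis .
    qed (use pos in \<open>auto simp: sign_avg_def P1_def P2_def\<close>)
    fix u assume u: "u \<in> I"
    have lip: "\<bar>sign_avg w Q (x(u := v)) - sign_avg w Q x\<bar> \<le> c / s ^ m * \<bar>v - x u\<bar>"
      if Q: "\<And>x. \<bar>Q (x(u := v)) - Q x\<bar> \<le> c / s ^ m * \<bar>v - x u\<bar>" for Q m
    proof (cases "u = w")
      case False
      have "sign_avg w Q (x(u := v)) - sign_avg w Q x
        = ((Q (?p(u := v)) - Q ?p) + (Q (?m(u := v)) - Q ?m)) / 2"
        using False by (simp add: sign_avg_def comm field_simps)
      also have "\<bar>\<dots>\<bar> \<le> c / s ^ m * \<bar>v - x u\<bar>"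
        using abs_average[OF Q[of ?p, unfolded fun_upd_other[OF False]] Q[of ?m, unfolded fun_upd_other[OF False]]] by simp
      finally show ?thesis .
    qed (use pos in \<open>auto simp: sign_avg_def\<close>)
    show "\<bar>P1 k (x(u := v)) - P1 k x\<bar> \<le> c / s ^ 4 * \<bar>v - x u\<bar>"
      using lip[of "F1 k" 4, OF E[OF k u]] pos by (auto simp: P1_def)
    show "\<bar>P2 k (x(u := v)) - P2 k x\<bar> \<le> c / s ^ 5 * \<bar>v - x u\<bar>"
      using lip[of "F2 k" 5, OF G[OF k u]] pos by (auto simp: P2_def)
  qed
qed

lemma depends_on_sign_avg:
  assumes "depends_on (insert k S) F" shows "depends_on S (sign_avg k F)"
proof -
  have eq: "F (x(k := v)) = F ((zero_outside S x)(k := v))" for x v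
  proof -
    have "zero_outside (insert k S) (x(k := v)) = zero_outside (insert k S) ((zero_outside S x)(k := v))"
      by (auto simp: zero_outside_def)
    thus ?thesis using assms unfolding depends_on_def by metis
  qed
  show ?thesis unfolding depends_on_def sign_avg_def using eq by metis
qed

text \<open>Setting finitely many entries to zero one after the other.\<close>

lemma lipschitz_zero_outside:
  assumes "finite T" and "\<And>u x v. u \<in> T \<Longrightarrow> \<bar>Q (x(u := v)) - Q x\<bar> \<le> L * \<bar>v - x u\<bar>" "0 \<le> L"
  shows "\<bar>Q (zero_outside (S \<union> T) x) - Q (zero_outside S x)\<bar> \<le> L * (\<Sum>u\<in>T. \<bar>x u\<bar>)"
  using assms(1,2)
proof (induction T)
  case (insert t T)
  have IH: "\<bar>Q (zero_outside (S \<union> T) x) - Q (zero_outside S x)\<bar> \<le> L * (\<Sum>u\<in>T. \<bar>x u\<bar>)"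
    using insert by auto
  have "\<bar>Q (zero_outside (S \<union> insert t T) x) - Q (zero_outside (S \<union> T) x)\<bar> \<le> L * \<bar>x t\<bar>"
  proof (cases "t \<in> S")
    case True
    hence "S \<union> insert t T = S \<union> T" by auto
    thus ?thesis using assms(3) by simp
  next
    case False
    have "zero_outside (S \<union> insert t T) x = (zero_outside (S \<union> T) x)(t := x t)"
      by (auto simp: zero_outside_def)
    moreover have "zero_outside (S \<union> T) x t = 0" using False insert.hyps by (simp add: zero_outside_def)
    ultimately show ?thesis using insert.prems[of t "zero_outside (S \<union> T) x" "x t"] by (simp del: fun_upd_apply)
  qed
  with IH insert.hyps show ?case by (simp add: distrib_left)
qed simp

lemma space_sigma_rv [simp]: "space (sigma_rv M X S) = space M"
  unfolding sigma_rv_def by (rule space_measure_of_conv)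

lemma sigma_rv_measurable:
  assumes "u \<in> S" shows "X u \<in> borel_measurable (sigma_rv M X S)"
proof (rule measurableI)
  fix A :: "real set" assume A: "A \<in> sets borel"
  have "{X u -` A \<inter> space M |u A. u \<in> S \<and> A \<in> sets borel} \<subseteq> Pow (space M)" by auto
  thus "X u -` A \<inter> space (sigma_rv M X S) \<in> sets (sigma_rv M X S)"
    unfolding space_sigma_rv sigma_rv_def using assms A by (auto simp: sets_measure_of)
qed simp

lemma sigma_rv_subalgebra:
  assumes "\<And>u. u \<in> S \<Longrightarrow> X u \<in> borel_measurable M"
  shows "subalgebra M (sigma_rv M X S)"
  unfolding subalgebra_def
proof
  have sub: "{X u -` A \<inter> space M |u A. u \<in> S \<and> A \<in> sets borel} \<subseteq> sets M"
    using assms by (auto intro: measurable_sets)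
  show "sets (sigma_rv M X S) \<subseteq> sets M"
    unfolding sigma_rv_def
    by (subst sets_measure_of) (use sub sets.space_closed in \<open>auto intro!: sets.sigma_sets_subset\<close>)
qed simp

lemma (in prob_space) sigma_rv_finite_subalgebra:
  assumes "\<And>u. u \<in> S \<Longrightarrow> X u \<in> borel_measurable M"
  shows "sigma_finite_subalgebra M (sigma_rv M X S)"
proof -
  interpret finite_measure_subalgebra M "sigma_rv M X S"
    by unfold_locales (rule sigma_rv_subalgebra[OF assms])
  show ?thesis by unfold_locales
qed

section \<open>Replacing the entries one by one\<close>

definition large_part :: "'a measure \<Rightarrow> ('a \<Rightarrow> real) \<Rightarrow> real \<Rightarrow> real" where
  "large_part M Y \<theta> = (LINT \<omega>|M. (Y \<omega>)\<^sup>2 * of_bool (\<bar>Y \<omega>\<bar> > \<theta>))"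

lemma large_part_nonneg: "0 \<le> large_part M Y \<theta>"
  unfolding large_part_def by (rule integral_nonneg_AE) auto

text \<open>If \<open>w\<close> is large, then either \<open>z\<close> is large as well, or \<open>z\<^sup>2 \<le> \<theta>\<^sup>2 < w\<^sup>2\<close>. Thus a product with the
  indicator of a different large entry is still controlled by the Lindeberg sums.\<close>

lemma cross_truncation:
  fixes z w \<theta> :: real
  assumes "0 < \<theta>"
  shows "(z\<^sup>2 + 1) * of_bool (\<bar>w\<bar> > \<theta>)
     \<le> z\<^sup>2 * of_bool (\<bar>z\<bar> > \<theta>) + (1 + 1 / \<theta>\<^sup>2) * (w\<^sup>2 * of_bool (\<bar>w\<bar> > \<theta>))"
proof (cases "\<bar>w\<bar> > \<theta>")
  case True
  have w: "\<theta>\<^sup>2 \<le> w\<^sup>2" using True assms by (simp add: abs_le_square_iff[symmetric])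
  hence one: "1 \<le> w\<^sup>2 / \<theta>\<^sup>2" using assms by simp
  show ?thesis
  proof (cases "\<bar>z\<bar> > \<theta>")
    case True
    thus ?thesis using \<open>\<bar>w\<bar> > \<theta>\<close> one add_mono[OF zero_le_power2[of w] one] by (simp add: algebra_simps)
  next
    case False
    hence "z\<^sup>2 \<le> \<theta>\<^sup>2" using assms by (simp add: abs_le_square_iff[symmetric])
    thus ?thesis using \<open>\<bar>w\<bar> > \<theta>\<close> False one w by (simp add: algebra_simps)
  qed
qed auto

text \<open>For \<open>|v| \<le> \<epsilon> s\<close> the cubic bound gains the factor \<open>\<epsilon>\<close>; for larger \<open>v\<close> the quadratic bound is used.\<close>

lemma entrywise_smooth_remainder:
  fixes F :: "('k \<Rightarrow> real) \<Rightarrow> real"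
  assumes s: "0 < s" and \<epsilon>: "0 \<le> \<epsilon>" and c: "0 \<le> c"
    and second: "\<bar>F (z(k := v)) - F z - v * d1\<bar> \<le> c / s ^ 4 * v\<^sup>2"
    and third: "\<bar>F (z(k := v)) - F z - v * d1 - v\<^sup>2 * d2\<bar> \<le> c / s ^ 5 * \<bar>v\<bar> ^ 3"
    and d2: "\<bar>d2\<bar> \<le> c / s ^ 4"
  shows "\<bar>F (z(k := v)) - F z - v * d1 - v\<^sup>2 * d2\<bar>
     \<le> c / s ^ 4 * (\<epsilon> * v\<^sup>2 + 2 * (v\<^sup>2 * of_bool (\<bar>v\<bar> > \<epsilon> * s)))"
proof (cases "\<bar>v\<bar> > \<epsilon> * s")
  case True
  have "\<bar>v\<^sup>2 * d2\<bar> \<le> c / s ^ 4 * v\<^sup>2"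
    using mult_right_mono[OF d2, of "v\<^sup>2"] by (simp add: abs_mult mult_ac)
  hence "\<bar>F (z(k := v)) - F z - v * d1 - v\<^sup>2 * d2\<bar> \<le> c / s ^ 4 * v\<^sup>2 + c / s ^ 4 * v\<^sup>2"
    using order.trans[OF abs_triangle_ineq4 add_mono[OF second]] by blast
  also have "\<dots> \<le> c / s ^ 4 * (\<epsilon> * v\<^sup>2 + 2 * v\<^sup>2)"
    using s \<epsilon> c by (simp add: distrib_left mult_ac)
  finally show ?thesis using True by simp
next
  case False
  have "c / s ^ 5 * \<bar>v\<bar> ^ 3 = c / s ^ 5 * (v\<^sup>2 * \<bar>v\<bar>)"
    by (simp add: power3_eq_cube power2_eq_square mult.assoc)
  also have "\<dots> \<le> c / s ^ 5 * (v\<^sup>2 * (\<epsilon> * s))"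
    using False s c by (intro mult_left_mono) auto
  also have "\<dots> = c / s ^ 4 * (\<epsilon> * v\<^sup>2)" using s by (simp add: eval_nat_numeral field_simps)
  finally show ?thesis using third False by simp
qed

lemma integrable_bounded_mult:
  fixes f g :: "'a \<Rightarrow> real"
  assumes "f \<in> borel_measurable M" "\<And>x. \<bar>f x\<bar> \<le> C" "integrable M g"
  shows "integrable M (\<lambda>x. f x * g x)"
proof (rule Bochner_Integration.integrable_bound[of M "\<lambda>x. C * g x"])
  show "(\<lambda>x. f x * g x) \<in> borel_measurable M" using assms by measurable
  have "0 \<le> C" using assms(2)[of undefined] by linarith
  thus "AE x in M. norm (f x * g x) \<le> norm (C * g x)"
    using assms(2) by (auto simp: abs_mult intro!: mult_right_mono)
qed (use assms in auto)

text \<open>The cost of averaging out entry \<open>k\<close>, given that all later entries have been averaged already. Both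
  \<open>X k\<close> and the sign are compared with the value \<open>0\<close> at \<open>k\<close>. The first-order terms drop out by the
  martingale property and the symmetry of the sign. In the second-order term \<open>(X k)\<^sup>2 - 1\<close> is
  multiplied by a coefficient that depends on the past; restricting its argument to the far past
  changes it by little unless some near entry is large, and then conditioning applies.\<close>

lemma (in prob_space) replacement_step:
  fixes X :: "'k \<Rightarrow> 'a \<Rightarrow> real"
  assumes s: "0 < s" and \<epsilon>: "0 < \<epsilon>" and c: "0 \<le> c"
    and smooth: "entrywise_smooth s I c H"
    and dep: "depends_on (insert k past) H"
    and fin: "finite past" and past: "past \<subseteq> I" "k \<in> I" "k \<notin> past" and far: "far \<subseteq> past"
    and near: "near = past - far"
    and meas: "\<And>u. u \<in> I \<Longrightarrow> X u \<in> borel_measurable M"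
    and sq: "\<And>u. u \<in> I \<Longrightarrow> integrable M (\<lambda>\<omega>. (X u \<omega>)\<^sup>2)"
    and var: "\<And>u. u \<in> I \<Longrightarrow> expectation (\<lambda>\<omega>. (X u \<omega>)\<^sup>2) = 1"
    and mds: "AE \<omega> in M. real_cond_exp M (sigma_rv M X past) (X k) \<omega> = 0"
  shows "\<bar>expectation (\<lambda>\<omega>. H (zero_outside I (\<lambda>u. X u \<omega>)))
        - expectation (\<lambda>\<omega>. sign_avg k H (zero_outside I (\<lambda>u. X u \<omega>)))\<bar>
     \<le> c / s ^ 4 * (expectation (\<lambda>\<omega>. \<bar>real_cond_exp M (sigma_rv M X far) (\<lambda>\<omega>. (X k \<omega>)\<^sup>2 - 1) \<omega>\<bar>)
          + \<epsilon> + 1 / s + 2 * \<epsilon> * card near + 2 * large_part M (X k) (\<epsilon> * s)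
          + (\<Sum>u\<in>near. 2 * large_part M (X k) (\<epsilon> * s)
                + 2 * (1 + 1 / (\<epsilon> * s)\<^sup>2) * large_part M (X u) (\<epsilon> * s)))"
proof -
  obtain F1 F2 where Hm: "H \<in> borel_measurable vectors" and Hbd: "\<And>x. \<bar>H x\<bar> \<le> c"
    and F1m: "F1 k \<in> borel_measurable vectors" and F2m: "F2 k \<in> borel_measurable vectors"
    and F1b: "\<And>x. \<bar>F1 k x\<bar> \<le> c / s ^ 3" and F2b: "\<And>x. \<bar>F2 k x\<bar> \<le> c / s ^ 4"
    and second: "\<And>x v. \<bar>H (x(k := v)) - H x - (v - x k) * F1 k x\<bar> \<le> c / s ^ 4 * (v - x k)\<^sup>2"
    and third: "\<And>x v. \<bar>H (x(k := v)) - H x - (v - x k) * F1 k x - (v - x k)\<^sup>2 * F2 k x\<bar> \<le> c / s ^ 5 * \<bar>v - x k\<bar> ^ 3"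
    and F2lip: "\<And>u x v. u \<in> I \<Longrightarrow> \<bar>F2 k (x(u := v)) - F2 k x\<bar> \<le> c / s ^ 5 * \<bar>v - x u\<bar>"
    using smooth past(2) unfolding entrywise_smooth_def by blast
  define V where "V \<omega> = zero_outside I (\<lambda>u. X u \<omega>)" for \<omega>
  define Z where "Z \<omega> = zero_outside past (\<lambda>u. X u \<omega>)" for \<omega>
  define Zf where "Zf \<omega> = zero_outside far (\<lambda>u. X u \<omega>)" for \<omega>
  define \<theta> where "\<theta> = \<epsilon> * s"
  have \<theta>: "0 < \<theta>" using s \<epsilon> by (simp add: \<theta>_def)
  have finnear: "finite near" using fin near by simp
  have nearI: "near \<subseteq> I" using near past by blast
  have Hupd: "H ((V \<omega>)(k := v)) = H ((Z \<omega>)(k := v))" for \<omega> v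
  proof -
    have "zero_outside (insert k past) ((V \<omega>)(k := v)) = zero_outside (insert k past) ((Z \<omega>)(k := v))"
      using past by (intro ext) (auto simp: V_def Z_def zero_outside_def)
    thus ?thesis using dep unfolding depends_on_def by metis
  qed
  have Vk: "(V \<omega>)(k := X k \<omega>) = V \<omega>" for \<omega> using past by (auto simp: V_def zero_outside_def)
  have Zk: "Z \<omega> k = 0" for \<omega> using past by (simp add: Z_def zero_outside_def)
  define \<rho> where "\<rho> \<omega> v = H ((Z \<omega>)(k := v)) - H (Z \<omega>) - v * F1 k (Z \<omega>) - v\<^sup>2 * F2 k (Z \<omega>)" for \<omega> v
  have \<rho>1: "\<bar>\<rho> \<omega> v\<bar> \<le> c / s ^ 4 * (\<epsilon> * v\<^sup>2 + 2 * (v\<^sup>2 * of_bool (\<bar>v\<bar> > \<theta>)))" for \<omega> v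
    unfolding \<rho>_def \<theta>_def
    by (rule entrywise_smooth_remainder)
       (use s \<epsilon> c second[of "Z \<omega>" v] third[of "Z \<omega>" v] F2b Zk in \<open>simp_all del: fun_upd_apply\<close>)
  have \<rho>2: "\<bar>\<rho> \<omega> v\<bar> \<le> c / s ^ 5" if "\<bar>v\<bar> = 1" for \<omega> v
    using third[of "Z \<omega>" v] that by (simp add: \<rho>_def Zk del: fun_upd_apply)
  define D where "D \<omega> = F2 k (Z \<omega>) - F2 k (Zf \<omega>)" for \<omega>
  define B where "B u \<omega> = (of_bool (\<bar>X u \<omega>\<bar> > \<theta>) :: real)" for u \<omega>
  have Dbd: "\<bar>D \<omega>\<bar> \<le> c / s ^ 4 * (\<epsilon> * card near + 2 * (\<Sum>u\<in>near. B u \<omega>))" for \<omega>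
  proof (cases "\<exists>u\<in>near. \<bar>X u \<omega>\<bar> > \<theta>")
    case True
    then obtain u where u: "u \<in> near" "\<bar>X u \<omega>\<bar> > \<theta>" by blast
    have "B u \<omega> \<le> (\<Sum>u\<in>near. B u \<omega>)"
      by (rule member_le_sum) (use u finnear in \<open>auto simp: B_def\<close>)
    hence one: "1 \<le> (\<Sum>u\<in>near. B u \<omega>)" using u by (simp add: B_def)
    have "\<bar>D \<omega>\<bar> \<le> c / s ^ 4 * 2"
      unfolding D_def mult_2_right using order.trans[OF abs_triangle_ineq4 add_mono[OF F2b F2b]] .
    also have "c / s ^ 4 * 2 \<le> c / s ^ 4 * (\<epsilon> * card near + 2 * (\<Sum>u\<in>near. B u \<omega>))"
      using one c s \<epsilon> by (intro mult_left_mono) (auto intro: order.trans[of 2 "2 * (\<Sum>u\<in>near. B u \<omega>)"])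
    finally show ?thesis .
  next
    case False
    have "past = far \<union> near" using near far by blast
    hence "\<bar>D \<omega>\<bar> \<le> c / s ^ 5 * (\<Sum>u\<in>near. \<bar>X u \<omega>\<bar>)"
      unfolding D_def Z_def Zf_def
      using lipschitz_zero_outside[OF finnear, of "F2 k" "c / s ^ 5" far "\<lambda>u. X u \<omega>"] F2lip nearI c s by auto
    also have "\<dots> \<le> c / s ^ 5 * (\<Sum>u\<in>near. \<theta>)"
      using False c s by (intro mult_left_mono sum_mono) (auto simp: not_less)
    also have "\<dots> = c / s ^ 4 * (\<epsilon> * card near)"
      using s by (simp add: \<theta>_def eval_nat_numeral field_simps)
    also have "\<dots> \<le> c / s ^ 4 * (\<epsilon> * card near + 2 * (\<Sum>u\<in>near. B u \<omega>))"
      using c s by (intro mult_left_mono) (auto simp: B_def intro!: sum_nonneg)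
    finally show ?thesis .
  qed
  \<comment> \<open>The increment without the two terms whose expectations are evaluated by conditioning.\<close>
  define rem where "rem \<omega> = H (V \<omega>) - sign_avg k H (V \<omega>) - X k \<omega> * F1 k (Z \<omega>)
      - F2 k (Zf \<omega>) * ((X k \<omega>)\<^sup>2 - 1)" for \<omega>
  have rem_eq: "rem \<omega> = ((X k \<omega>)\<^sup>2 - 1) * D \<omega> + \<rho> \<omega> (X k \<omega>) - (\<rho> \<omega> 1 + \<rho> \<omega> (- 1)) / 2" for \<omega>
    unfolding rem_def sign_avg_def Hupd[of \<omega> 1] Hupd[of \<omega> "- 1"] Hupd[of \<omega> "X k \<omega>", unfolded Vk] \<rho>_def D_def
    by (simp add: field_simps del: fun_upd_apply)
  define nr where "nr \<omega> = (\<Sum>u\<in>near. 2 * ((X k \<omega>)\<^sup>2 * B k \<omega>) + 2 * (1 + 1 / \<theta>\<^sup>2) * ((X u \<omega>)\<^sup>2 * B u \<omega>))" for \<omega>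
  \<comment> \<open>An integrable bound for \<open>rem\<close> with an explicit expectation.\<close>
  define g where "g \<omega> = c / s ^ 4 * (\<epsilon> * card near * ((X k \<omega>)\<^sup>2 + 1) + nr \<omega>
      + \<epsilon> * (X k \<omega>)\<^sup>2 + 2 * ((X k \<omega>)\<^sup>2 * B k \<omega>) + 1 / s)" for \<omega>
  have rem_bd: "\<bar>rem \<omega>\<bar> \<le> g \<omega>" for \<omega>
  proof -
    have "\<bar>((X k \<omega>)\<^sup>2 - 1) * D \<omega>\<bar> \<le> ((X k \<omega>)\<^sup>2 + 1) * (c / s ^ 4 * (\<epsilon> * card near + 2 * (\<Sum>u\<in>near. B u \<omega>)))"
      unfolding abs_mult by (intro mult_mono Dbd) (auto simp: abs_le_iff)
    also have "\<dots> = c / s ^ 4 * (\<epsilon> * card near * ((X k \<omega>)\<^sup>2 + 1) + (\<Sum>u\<in>near. 2 * (((X k \<omega>)\<^sup>2 + 1) * B u \<omega>)))"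
    proof -
      have "(a + 1) * (L * (e + 2 * S)) = L * (e * (a + 1) + 2 * ((a + 1) * S))" for a L e S :: real
        by (simp add: algebra_simps)
      thus ?thesis unfolding sum_distrib_left[symmetric] .
    qed
    also have "\<dots> \<le> c / s ^ 4 * (\<epsilon> * card near * ((X k \<omega>)\<^sup>2 + 1) + nr \<omega>)"
      unfolding nr_def
    proof (intro mult_left_mono add_left_mono sum_mono)
      fix u
      show "2 * (((X k \<omega>)\<^sup>2 + 1) * B u \<omega>)
         \<le> 2 * ((X k \<omega>)\<^sup>2 * B k \<omega>) + 2 * (1 + 1 / \<theta>\<^sup>2) * ((X u \<omega>)\<^sup>2 * B u \<omega>)"
        using cross_truncation[OF \<theta>, of "X k \<omega>" "X u \<omega>"] unfolding B_def by (simp only: mult.assoc)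
    qed (use c s in auto)
    finally have 1: "\<bar>((X k \<omega>)\<^sup>2 - 1) * D \<omega>\<bar> \<le> \<dots>" .
    have 2: "\<bar>\<rho> \<omega> (X k \<omega>)\<bar> \<le> c / s ^ 4 * (\<epsilon> * (X k \<omega>)\<^sup>2 + 2 * ((X k \<omega>)\<^sup>2 * B k \<omega>))"
      using \<rho>1[of \<omega> "X k \<omega>"] by (simp add: B_def)
    have "\<bar>(\<rho> \<omega> 1 + \<rho> \<omega> (- 1)) / 2\<bar> \<le> c / s ^ 5" by (rule abs_average; rule \<rho>2) auto
    also have "\<dots> = c / s ^ 4 * (1 / s)" using s by (simp add: eval_nat_numeral field_simps)
    finally have 3: "\<bar>(\<rho> \<omega> 1 + \<rho> \<omega> (- 1)) / 2\<bar> \<le> c / s ^ 4 * (1 / s)" .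
    show ?thesis
      unfolding rem_eq
      using order.trans[OF abs_triangle_ineq4 add_mono[OF order.trans[OF abs_triangle_ineq add_mono[OF 1 2]] 3]]
      unfolding g_def distrib_left[of "c / s ^ 4", symmetric] by (simp only: add.assoc)
  qed
  note [measurable] = Hm F1m F2m
  have Vm: "V \<in> measurable M vectors" unfolding V_def by (rule measurable_zero_outside) (rule meas)
  have Xm [measurable]: "X k \<in> borel_measurable M" using meas past by blast
  have sqk: "integrable M (\<lambda>\<omega>. (X k \<omega>)\<^sup>2)" using sq past by blast
  have Xint: "integrable M (X k)"
    by (rule square_integrable_imp_integrable[OF Xm sqk])
  have large_int: "integrable M (\<lambda>\<omega>. (X u \<omega>)\<^sup>2 * B u \<omega>)" if "u \<in> I" for u
  proof (rule Bochner_Integration.integrable_bound[OF sq[OF that]])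
    note [measurable] = meas[OF that]
    show "(\<lambda>\<omega>. (X u \<omega>)\<^sup>2 * B u \<omega>) \<in> borel_measurable M" unfolding B_def by measurable
  qed (auto simp: B_def)
  have large_eq: "expectation (\<lambda>\<omega>. (X u \<omega>)\<^sup>2 * B u \<omega>) = large_part M (X u) \<theta>" for u
    by (simp add: large_part_def B_def)
  have g_int: "integrable M g"
    unfolding g_def nr_def using large_int nearI past sqk
    by (intro integrable_mult_right Bochner_Integration.integrable_add Bochner_Integration.integrable_sum integrable_const) auto
  have g_E: "expectation g = c / s ^ 4 * (2 * \<epsilon> * card near
      + (\<Sum>u\<in>near. 2 * large_part M (X k) \<theta> + 2 * (1 + 1 / \<theta>\<^sup>2) * large_part M (X u) \<theta>)
      + \<epsilon> + 2 * large_part M (X k) \<theta> + 1 / s)"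
  proof -
    define t where "t u \<omega> = 2 * ((X k \<omega>)\<^sup>2 * B k \<omega>) + 2 * (1 + 1 / \<theta>\<^sup>2) * ((X u \<omega>)\<^sup>2 * B u \<omega>)" for u \<omega>
    have near_E: "expectation nr
      = (\<Sum>u\<in>near. 2 * large_part M (X k) \<theta> + 2 * (1 + 1 / \<theta>\<^sup>2) * large_part M (X u) \<theta>)"
      unfolding nr_def t_def[symmetric]
    proof (subst Bochner_Integration.integral_sum)
      show i: "integrable M (t u)" if "u \<in> near" for u
        using large_int nearI past that unfolding t_def by (intro Bochner_Integration.integrable_add integrable_mult_right) auto
      show "(\<Sum>u\<in>near. expectation (t u))
        = (\<Sum>u\<in>near. 2 * large_part M (X k) \<theta> + 2 * (1 + 1 / \<theta>\<^sup>2) * large_part M (X u) \<theta>)"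
      proof (rule sum.cong[OF refl])
        fix u assume "u \<in> near"
        hence "u \<in> I" using nearI by blast
        thus "expectation (t u) = 2 * large_part M (X k) \<theta> + 2 * (1 + 1 / \<theta>\<^sup>2) * large_part M (X u) \<theta>"
          using large_int past unfolding t_def
          by (subst Bochner_Integration.integral_add) (auto simp: large_eq)
      qed
    qed
    have near_int: "integrable M nr"
      unfolding nr_def using large_int nearI past
      by (intro Bochner_Integration.integrable_sum Bochner_Integration.integrable_add integrable_mult_right) auto
    show ?thesis
      unfolding g_def using near_int large_int[OF past(2)] sqk
      by (simp only: near_E[symmetric]) (simp add: large_eq var[OF past(2)] prob_space)
  qed
  have ZmS: "Z \<in> measurable (sigma_rv M X past) vectors"
    unfolding Z_def by (rule measurable_zero_outside) (rule sigma_rv_measurable)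
  have ZfmS: "Zf \<in> measurable (sigma_rv M X far) vectors"
    unfolding Zf_def by (rule measurable_zero_outside) (rule sigma_rv_measurable)
  have Zm: "Z \<in> measurable M vectors" unfolding Z_def by (rule measurable_zero_outside) (use meas past in blast)
  have Zfm: "Zf \<in> measurable M vectors" unfolding Zf_def by (rule measurable_zero_outside) (use meas past far in blast)
  interpret P: sigma_finite_subalgebra M "sigma_rv M X past"
    by (rule sigma_rv_finite_subalgebra) (use meas past in blast)
  interpret Q: sigma_finite_subalgebra M "sigma_rv M X far"
    by (rule sigma_rv_finite_subalgebra) (use meas past far in blast)
  have F1Z: "(\<lambda>\<omega>. F1 k (Z \<omega>)) \<in> borel_measurable (sigma_rv M X past)"
    using measurable_compose[OF ZmS F1m] .
  have F2Z: "(\<lambda>\<omega>. F2 k (Zf \<omega>)) \<in> borel_measurable (sigma_rv M X far)"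
    using measurable_compose[OF ZfmS F2m] .
  have F1Z': "(\<lambda>\<omega>. F1 k (Z \<omega>)) \<in> borel_measurable M" using measurable_compose[OF Zm F1m] .
  have F2Z': "(\<lambda>\<omega>. F2 k (Zf \<omega>)) \<in> borel_measurable M" using measurable_compose[OF Zfm F2m] .
  have int1: "integrable M (\<lambda>\<omega>. F1 k (Z \<omega>) * X k \<omega>)"
    by (rule integrable_bounded_mult[OF F1Z' F1b Xint])
  have int2: "integrable M (\<lambda>\<omega>. F2 k (Zf \<omega>) * ((X k \<omega>)\<^sup>2 - 1))"
    by (rule integrable_bounded_mult[OF F2Z' F2b]) (use sqk in auto)
  have zero1: "expectation (\<lambda>\<omega>. F1 k (Z \<omega>) * X k \<omega>) = 0"
  proof -
    have "expectation (\<lambda>\<omega>. F1 k (Z \<omega>) * X k \<omega>)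
        = expectation (\<lambda>\<omega>. F1 k (Z \<omega>) * real_cond_exp M (sigma_rv M X past) (X k) \<omega>)"
      using P.real_cond_exp_intg(2)[OF int1 F1Z Xm] by simp
    also have "\<dots> = expectation (\<lambda>\<omega>. 0)"
      by (rule integral_cong_AE) (use mds F1Z' in auto)
    finally show ?thesis by simp
  qed
  let ?\<kappa> = "expectation (\<lambda>\<omega>. \<bar>real_cond_exp M (sigma_rv M X far) (\<lambda>\<omega>. (X k \<omega>)\<^sup>2 - 1) \<omega>\<bar>)"
  have bd2: "\<bar>expectation (\<lambda>\<omega>. F2 k (Zf \<omega>) * ((X k \<omega>)\<^sup>2 - 1))\<bar> \<le> c / s ^ 4 * ?\<kappa>"
  proof -
    have m: "(\<lambda>\<omega>. (X k \<omega>)\<^sup>2 - 1) \<in> borel_measurable M" by measurable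
    have ci: "integrable M (real_cond_exp M (sigma_rv M X far) (\<lambda>\<omega>. (X k \<omega>)\<^sup>2 - 1))"
      by (rule Q.real_cond_exp_int(1)) (use sqk in auto)
    have "\<bar>expectation (\<lambda>\<omega>. F2 k (Zf \<omega>) * ((X k \<omega>)\<^sup>2 - 1))\<bar>
        = \<bar>expectation (\<lambda>\<omega>. F2 k (Zf \<omega>) * real_cond_exp M (sigma_rv M X far) (\<lambda>\<omega>. (X k \<omega>)\<^sup>2 - 1) \<omega>)\<bar>"
      using Q.real_cond_exp_intg(2)[OF int2 F2Z m] by simp
    also have "\<dots> \<le> expectation (\<lambda>\<omega>. \<bar>F2 k (Zf \<omega>) * real_cond_exp M (sigma_rv M X far) (\<lambda>\<omega>. (X k \<omega>)\<^sup>2 - 1) \<omega>\<bar>)"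
      by (rule integral_abs_bound)
    also have "\<dots> \<le> expectation (\<lambda>\<omega>. c / s ^ 4 * \<bar>real_cond_exp M (sigma_rv M X far) (\<lambda>\<omega>. (X k \<omega>)\<^sup>2 - 1) \<omega>\<bar>)"
    proof (rule integral_mono)
      show "integrable M (\<lambda>\<omega>. \<bar>F2 k (Zf \<omega>) * real_cond_exp M (sigma_rv M X far) (\<lambda>\<omega>. (X k \<omega>)\<^sup>2 - 1) \<omega>\<bar>)"
        by (rule integrable_abs[OF Q.real_cond_exp_intg(1)[OF int2 F2Z m]])
    qed (use ci F2b in \<open>auto simp only: abs_mult intro!: mult_right_mono integrable_mult_right integrable_abs\<close>)
    finally show ?thesis by simp
  qed
  have Hint: "integrable M (\<lambda>\<omega>. H (V \<omega>))"
    by (rule integrable_const_bound[of _ c]) (use Hbd measurable_compose[OF Vm Hm] in auto)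
  have sign_bd: "\<bar>sign_avg k H x\<bar> \<le> c" for x
    unfolding sign_avg_def by (rule abs_average[OF Hbd Hbd])
  have Sint: "integrable M (\<lambda>\<omega>. sign_avg k H (V \<omega>))"
    by (rule integrable_const_bound[of _ c])
       (use measurable_compose[OF Vm sign_avg_measurable[OF Hm]] sign_bd in auto)
  have rem_int: "integrable M rem"
    unfolding rem_def using Hint Sint int1 int2
    by (intro Bochner_Integration.integrable_diff) (auto simp: mult.commute)
  have "expectation (\<lambda>\<omega>. H (V \<omega>)) - expectation (\<lambda>\<omega>. sign_avg k H (V \<omega>))
     = expectation (\<lambda>\<omega>. rem \<omega> + F1 k (Z \<omega>) * X k \<omega> + F2 k (Zf \<omega>) * ((X k \<omega>)\<^sup>2 - 1))"
    using Hint Sint by (subst Bochner_Integration.integral_diff[symmetric]) (auto simp: rem_def mult.commute)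
  also have "\<dots> = expectation rem + expectation (\<lambda>\<omega>. F2 k (Zf \<omega>) * ((X k \<omega>)\<^sup>2 - 1))"
    using rem_int int1 int2 zero1 by simp
  also have "\<bar>\<dots>\<bar> \<le> expectation g + c / s ^ 4 * ?\<kappa>"
  proof (rule order.trans[OF abs_triangle_ineq add_mono[OF _ bd2]])
    have "\<bar>expectation rem\<bar> \<le> expectation (\<lambda>\<omega>. \<bar>rem \<omega>\<bar>)" by (rule integral_abs_bound)
    also have "\<dots> \<le> expectation g"
      by (rule integral_mono) (use rem_int g_int rem_bd in auto)
    finally show "\<bar>expectation rem\<bar> \<le> expectation g" .
  qed
  finally show ?thesis unfolding g_E V_def \<theta>_def by (simp add: algebra_simps)
qed

text \<open>Induction from the last entry backwards. When \<open>k\<close> is its last entry, the function at hand depends only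
  on \<open>k\<close> and on the entries before it in the list, which is what the single step requires.\<close>

lemma telescoping_replacement:
  fixes EV :: "(('k \<Rightarrow> real) \<Rightarrow> real) \<Rightarrow> real"
  assumes s: "0 < s" and c: "0 \<le> c"
    and const: "\<And>F. depends_on {} F \<Longrightarrow> EV F = F (\<lambda>_. 0)"
    and "\<And>H k ys zs. ks = ys @ k # zs \<Longrightarrow> entrywise_smooth s I c H \<Longrightarrow> depends_on (insert k (set ys)) H
        \<Longrightarrow> \<bar>EV H - EV (sign_avg k H)\<bar> \<le> \<delta> k"
    and "entrywise_smooth s I c F" "depends_on (set ks) F"
  shows "\<bar>EV F - foldr sign_avg ks F (\<lambda>_. 0)\<bar> \<le> (\<Sum>k\<leftarrow>ks. \<delta> k)"
  using assms(4-)
proof (induction ks arbitrary: F rule: rev_induct)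
  case Nil
  thus ?case using const[of F] by simp
next
  case (snoc k ks)
  have "\<bar>EV (sign_avg k F) - foldr sign_avg ks (sign_avg k F) (\<lambda>_. 0)\<bar> \<le> (\<Sum>k\<leftarrow>ks. \<delta> k)"
  proof (rule snoc.IH)
    fix H k' ys zs assume "ks = ys @ k' # zs" "entrywise_smooth s I c H" "depends_on (insert k' (set ys)) H"
    thus "\<bar>EV H - EV (sign_avg k' H)\<bar> \<le> \<delta> k'" using snoc.prems(1)[of ys k' "zs @ [k]" H] by simp
  next
    show "entrywise_smooth s I c (sign_avg k F)" by (rule entrywise_smooth_sign_avg[OF snoc.prems(2) c s])
    show "depends_on (set ks) (sign_avg k F)" using snoc.prems(3) by (intro depends_on_sign_avg) simp
  qed
  moreover have "\<bar>EV F - EV (sign_avg k F)\<bar> \<le> \<delta> k"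
    using snoc.prems(1)[of ks k "[]" F] snoc.prems(2,3) by simp
  ultimately show ?case by simp
qed

definition entry_list :: "nat \<Rightarrow> nat \<Rightarrow> (int \<times> int) list" where
  "entry_list p n = concat (map (\<lambda>i. map (Pair i) [1..int n]) [1..int p])"

lemma set_entry_list [simp]: "set (entry_list p n) = entries p n"
  by (auto simp: entry_list_def entries_def)

lemma sorted_wrt_less_upto: "sorted_wrt (<) [i..j]"
proof (induction i j rule: upto.induct)
  case (1 i j)
  thus ?case by (cases "i \<le> j") (simp_all add: upto_rec1)
qed

lemma sorted_entry_list: "sorted_wrt lex_less (entry_list p n)"
proof -
  have row: "sorted_wrt lex_less (map (Pair i) js)" if "sorted_wrt (<) js" for i js
    using that by (induction js) (auto simp: lex_less_def)
  have "sorted_wrt lex_less (concat (map (\<lambda>i. map (Pair i) [1..int n]) is))" if "sorted_wrt (<) is" for "is"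
    using that
  proof (induction "is")
    case (Cons i "is")
    have "\<forall>u\<in>set (map (Pair i) [1..int n]). \<forall>w\<in>set (concat (map (\<lambda>i. map (Pair i) [1..int n]) is)). lex_less u w"
      using Cons.prems by (auto simp: lex_less_def)
    thus ?case using Cons row[OF sorted_wrt_less_upto, of i 1 "int n"] by (simp add: sorted_wrt_append)
  qed simp
  thus ?thesis unfolding entry_list_def using sorted_wrt_less_upto by blast
qed

lemma entry_list_past:
  assumes "entry_list p n = ys @ k # zs"
  shows "set ys = {u \<in> entries p n. lex_less u k}"
proof -
  have "sorted_wrt lex_less (ys @ k # zs)" using sorted_entry_list[of p n] assms by simp
  hence 1: "\<forall>u\<in>set ys. lex_less u k" and 2: "\<forall>u\<in>set zs. lex_less k u" by (auto simp: sorted_wrt_append)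
  have "entries p n = set ys \<union> {k} \<union> set zs" using set_entry_list[of p n] assms by auto
  thus ?thesis using 1 2 by (auto simp: lex_less_def)
qed

lemma distinct_entry_list: "distinct (entry_list p n)"
proof -
  have "distinct xs" if "sorted_wrt lex_less xs" for xs
    using that by (induction xs) (auto simp: lex_less_def)
  thus ?thesis using sorted_entry_list by blast
qed

lemma finite_entries [simp]: "finite (entries p n)"
  by (simp add: entries_def)

lemma card_entries: "card (entries p n) = p * n"
  by (simp add: entries_def card_cartesian_product)

definition near_past :: "nat \<Rightarrow> nat \<Rightarrow> nat \<Rightarrow> int \<times> int \<Rightarrow> (int \<times> int) set" where
  "near_past a p n k = {u \<in> entries p n. lex_less u k} - (entries p n \<inter> far_past a k)"

lemma box_card: "card {u::int\<times>int. \<bar>fst u - i\<bar> < int a \<and> \<bar>snd u - j\<bar> < int a} \<le> 4 * a\<^sup>2"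
  "finite {u::int\<times>int. \<bar>fst u - i\<bar> < int a \<and> \<bar>snd u - j\<bar> < int a}"
proof -
  have eq: "{u::int\<times>int. \<bar>fst u - i\<bar> < int a \<and> \<bar>snd u - j\<bar> < int a} = {i - int a<..<i + int a} \<times> {j - int a<..<j + int a}"
    by auto
  have "card ({i - int a<..<i + int a} \<times> {j - int a<..<j + int a}) \<le> (2 * a) * (2 * a)"
    unfolding card_cartesian_product by (intro mult_le_mono) auto
  thus "card {u::int\<times>int. \<bar>fst u - i\<bar> < int a \<and> \<bar>snd u - j\<bar> < int a} \<le> 4 * a\<^sup>2"
    "finite {u::int\<times>int. \<bar>fst u - i\<bar> < int a \<and> \<bar>snd u - j\<bar> < int a}"
    unfolding eq by (simp_all add: power2_eq_square)
qed

lemma near_past_close: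
  "u \<in> near_past a p n k \<Longrightarrow> \<bar>fst u - fst k\<bar> < int a \<and> \<bar>snd u - snd k\<bar> < int a"
  by (auto simp: near_past_def far_past_def lex_le_def)

lemma card_near_past: "card (near_past a p n k) \<le> 4 * a\<^sup>2"
proof -
  have "card (near_past a p n k) \<le> card {u::int\<times>int. \<bar>fst u - fst k\<bar> < int a \<and> \<bar>snd u - snd k\<bar> < int a}"
    by (rule card_mono[OF box_card(2)]) (use near_past_close in blast)
  thus ?thesis using box_card(1) order.trans by blast
qed

text \<open>Each entry lies in the near past of at most \<open>4 a\<^sup>2\<close> others.\<close>

lemma sum_near_past:
  assumes "\<And>u. 0 \<le> f u"
  shows "(\<Sum>k\<in>entries p n. \<Sum>u\<in>near_past a p n k. f u) \<le> 4 * (real a)\<^sup>2 * (\<Sum>u\<in>entries p n. (f u :: real))"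
proof -
  have "(\<Sum>k\<in>entries p n. \<Sum>u\<in>near_past a p n k. f u)
      = (\<Sum>k\<in>entries p n. \<Sum>u\<in>{u \<in> entries p n. u \<in> near_past a p n k}. f u)"
    by (intro sum.cong refl) (auto simp: near_past_def)
  also have "\<dots> = (\<Sum>u\<in>entries p n. \<Sum>k\<in>{k \<in> entries p n. u \<in> near_past a p n k}. f u)"
    by (rule sum.swap_restrict) auto
  also have "\<dots> \<le> (\<Sum>u\<in>entries p n. 4 * (real a)\<^sup>2 * f u)"
  proof (rule sum_mono)
    fix u
    have "card {k \<in> entries p n. u \<in> near_past a p n k}
        \<le> card {k::int\<times>int. \<bar>fst k - fst u\<bar> < int a \<and> \<bar>snd k - snd u\<bar> < int a}"
      by (rule card_mono[OF box_card(2)]) (use near_past_close in \<open>fastforce simp: abs_minus_commute\<close>)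
    hence "card {k \<in> entries p n. u \<in> near_past a p n k} \<le> 4 * a\<^sup>2"
      using box_card(1)[of "fst u" a "snd u"] by linarith
    hence "real (card {k \<in> entries p n. u \<in> near_past a p n k}) \<le> real (4 * a\<^sup>2)"
      by (simp only: of_nat_le_iff)
    hence "real (card {k \<in> entries p n. u \<in> near_past a p n k}) \<le> 4 * (real a)\<^sup>2" by simp
    thus "(\<Sum>k\<in>{k \<in> entries p n. u \<in> near_past a p n k}. f u) \<le> 4 * (real a)\<^sup>2 * f u"
      using assms by (simp add: mult_right_mono)
  qed
  also have "\<dots> = 4 * (real a)\<^sup>2 * (\<Sum>u\<in>entries p n. f u)" by (simp add: sum_distrib_left)
  finally show ?thesis .
qed

lemma (in prob_space) replacement_total:
  fixes X :: "int \<times> int \<Rightarrow> 'a \<Rightarrow> real"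
  assumes n: "0 < n" and \<epsilon>: "0 < \<epsilon>" and c: "0 \<le> c" and a: "1 \<le> a"
    and smooth: "entrywise_smooth (sqrt (real n)) (entries p n) c F"
    and dep: "depends_on (entries p n) F"
    and meas: "\<And>u. u \<in> entries p n \<Longrightarrow> X u \<in> borel_measurable M"
    and sq: "\<And>u. u \<in> entries p n \<Longrightarrow> integrable M (\<lambda>\<omega>. (X u \<omega>)\<^sup>2)"
    and var: "\<And>u. u \<in> entries p n \<Longrightarrow> expectation (\<lambda>\<omega>. (X u \<omega>)\<^sup>2) = 1"
    and mds: "\<And>k. k \<in> entries p n \<Longrightarrow>
      AE \<omega> in M. real_cond_exp M (sigma_rv M X {u \<in> entries p n. lex_less u k}) (X k) \<omega> = 0"
  shows "\<bar>expectation (\<lambda>\<omega>. F (zero_outside (entries p n) (\<lambda>u. X u \<omega>))) - foldr sign_avg (entry_list p n) F (\<lambda>_. 0)\<bar>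
     \<le> c / (real n)\<^sup>2 *
        ((\<Sum>k\<in>entries p n. expectation (\<lambda>\<omega>. \<bar>real_cond_exp M (sigma_rv M X (entries p n \<inter> far_past a k)) (\<lambda>\<omega>. (X k \<omega>)\<^sup>2 - 1) \<omega>\<bar>))
         + real (p * n) * (\<epsilon> + 1 / sqrt (real n) + 8 * \<epsilon> * (real a)\<^sup>2)
         + (2 + 8 * (real a)\<^sup>2 + 8 * (real a)\<^sup>2 * (1 + 1 / (\<epsilon> * sqrt (real n))\<^sup>2))
           * (\<Sum>k\<in>entries p n. large_part M (X k) (\<epsilon> * sqrt (real n))))"
proof -
  let ?s = "sqrt (real n)" let ?I = "entries p n" 
  define E where "E = 1 + 1 / (\<epsilon> * ?s)\<^sup>2"
  define r where "r = 1 / ?s"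
  define \<Lambda> where "\<Lambda> k = large_part M (X k) (\<epsilon> * ?s)" for k
  have \<Lambda>0: "0 \<le> \<Lambda> k" for k by (simp add: \<Lambda>_def large_part_nonneg)
  have E0: "0 \<le> E" by (simp add: E_def)
  define \<kappa> where "\<kappa> k = expectation (\<lambda>\<omega>. \<bar>real_cond_exp M (sigma_rv M X (?I \<inter> far_past a k)) (\<lambda>\<omega>. (X k \<omega>)\<^sup>2 - 1) \<omega>\<bar>)" for k
  define \<delta> where "\<delta> k = c / ?s ^ 4 * (\<kappa> k + \<epsilon> + r + 2 * \<epsilon> * card (near_past a p n k) + 2 * \<Lambda> k
     + (\<Sum>u\<in>near_past a p n k. 2 * \<Lambda> k + 2 * E * \<Lambda> u))" for k
  have s: "0 < ?s" using n by simp
  have s4: "?s ^ 4 = (real n)\<^sup>2"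
  proof -
    have "?s ^ 4 = ?s\<^sup>2 * ?s\<^sup>2" by (simp only: power2_eq_square power4_eq_xxxx mult.assoc)
    thus ?thesis by (simp add: power2_eq_square)
  qed
  have "\<bar>expectation (\<lambda>\<omega>. F (zero_outside ?I (\<lambda>u. X u \<omega>))) - foldr sign_avg (entry_list p n) F (\<lambda>_. 0)\<bar>
      \<le> (\<Sum>k\<leftarrow>entry_list p n. \<delta> k)"
  proof (rule telescoping_replacement[where EV = "\<lambda>F. expectation (\<lambda>\<omega>. F (zero_outside ?I (\<lambda>u. X u \<omega>)))", OF s c])
    fix F :: "(int \<times> int \<Rightarrow> real) \<Rightarrow> real" assume "depends_on {} F"
    hence "F x = F (\<lambda>_. 0)" for x unfolding depends_on_def zero_outside_def by simp
    hence "(\<lambda>\<omega>. F (zero_outside ?I (\<lambda>u. X u \<omega>))) = (\<lambda>_. F (\<lambda>_. 0))" by blast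
    thus "expectation (\<lambda>\<omega>. F (zero_outside ?I (\<lambda>u. X u \<omega>))) = F (\<lambda>_. 0)" by (simp add: prob_space)
  next
    fix H k ys zs
    assume dec: "entry_list p n = ys @ k # zs" and H: "entrywise_smooth ?s ?I c H"
      and dH: "depends_on (insert k (set ys)) H"
    have past: "set ys = {u \<in> ?I. lex_less u k}" by (rule entry_list_past[OF dec])
    have k: "k \<in> ?I" using set_entry_list[of p n] dec by auto
    show "\<bar>expectation (\<lambda>\<omega>. H (zero_outside ?I (\<lambda>u. X u \<omega>))) - expectation (\<lambda>\<omega>. sign_avg k H (zero_outside ?I (\<lambda>u. X u \<omega>)))\<bar> \<le> \<delta> k"
      unfolding \<delta>_def \<kappa>_def E_def r_def \<Lambda>_def
    proof (rule replacement_step[OF s \<epsilon> c H, where past = "{u \<in> ?I. lex_less u k}"])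
      show "depends_on (insert k {u \<in> ?I. lex_less u k}) H" using dH past by simp
      show "?I \<inter> far_past a k \<subseteq> {u \<in> ?I. lex_less u k}"
        using a by (auto simp: far_past_def lex_le_def)
      show "k \<notin> {u \<in> ?I. lex_less u k}" by (simp add: lex_less_def)
    qed (use k meas sq var mds[OF k] in \<open>auto simp: near_past_def\<close>)
  qed (use smooth dep in auto)
  also have "\<dots> = (\<Sum>k\<in>?I. \<delta> k)"
    using sum_list_distinct_conv_sum_set[OF distinct_entry_list, of \<delta> p n] by simp
  also have "\<dots> = c / (real n)\<^sup>2 * (\<Sum>k\<in>?I. \<kappa> k + \<epsilon> + r + 2 * \<epsilon> * card (near_past a p n k) + 2 * \<Lambda> k
     + (\<Sum>u\<in>near_past a p n k. 2 * \<Lambda> k + 2 * E * \<Lambda> u))"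
    unfolding \<delta>_def s4 by (simp only: sum_distrib_left)
  also have "\<dots> \<le> c / (real n)\<^sup>2 * ((\<Sum>k\<in>?I. \<kappa> k) + real (p * n) * (\<epsilon> + r + 8 * \<epsilon> * (real a)\<^sup>2)
         + (2 + 8 * (real a)\<^sup>2 + 8 * (real a)\<^sup>2 * E) * (\<Sum>k\<in>?I. \<Lambda> k))"
  proof (rule mult_left_mono)
    have card: "real (card (near_past a p n k)) \<le> 4 * (real a)\<^sup>2" for k
    proof -
      have "real (card (near_past a p n k)) \<le> real (4 * a\<^sup>2)"
        using card_near_past[of a p n k] by (simp only: of_nat_le_iff)
      thus ?thesis by simp
    qed
    have "(\<Sum>k\<in>?I. \<kappa> k + \<epsilon> + r + 2 * \<epsilon> * card (near_past a p n k) + 2 * \<Lambda> k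
        + (\<Sum>u\<in>near_past a p n k. 2 * \<Lambda> k + 2 * E * \<Lambda> u))
      \<le> (\<Sum>k\<in>?I. \<kappa> k + (\<epsilon> + r + 8 * \<epsilon> * (real a)\<^sup>2) + (2 + 8 * (real a)\<^sup>2) * \<Lambda> k
        + 2 * E * (\<Sum>u\<in>near_past a p n k. \<Lambda> u))"
    proof (rule sum_mono)
      fix k
      have 1: "2 * \<epsilon> * card (near_past a p n k) \<le> 2 * \<epsilon> * (4 * (real a)\<^sup>2)"
        using \<epsilon> by (intro mult_left_mono card) auto
      have 2: "2 * \<Lambda> k * card (near_past a p n k) \<le> 2 * \<Lambda> k * (4 * (real a)\<^sup>2)"
        by (intro mult_left_mono card) (simp add: \<Lambda>0)
      have 3: "(\<Sum>u\<in>near_past a p n k. 2 * \<Lambda> k + 2 * E * \<Lambda> u)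
         = 2 * \<Lambda> k * card (near_past a p n k) + 2 * E * (\<Sum>u\<in>near_past a p n k. \<Lambda> u)"
        by (simp add: sum.distrib sum_distrib_left mult_ac)
      show "\<kappa> k + \<epsilon> + r + 2 * \<epsilon> * card (near_past a p n k) + 2 * \<Lambda> k
        + (\<Sum>u\<in>near_past a p n k. 2 * \<Lambda> k + 2 * E * \<Lambda> u)
        \<le> \<kappa> k + (\<epsilon> + r + 8 * \<epsilon> * (real a)\<^sup>2) + (2 + 8 * (real a)\<^sup>2) * \<Lambda> k
        + 2 * E * (\<Sum>u\<in>near_past a p n k. \<Lambda> u)"
      proof -
        have "2 * \<epsilon> * card (near_past a p n k) \<le> 8 * \<epsilon> * (real a)\<^sup>2"
          "2 * \<Lambda> k * card (near_past a p n k) \<le> 8 * (real a)\<^sup>2 * \<Lambda> k"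
          using 1 2 by (simp_all only: mult_ac)
        thus ?thesis unfolding 3 distrib_right by linarith
      qed
    qed
    also have "\<dots> = (\<Sum>k\<in>?I. \<kappa> k) + real (p * n) * (\<epsilon> + r + 8 * \<epsilon> * (real a)\<^sup>2)
        + (2 + 8 * (real a)\<^sup>2) * (\<Sum>k\<in>?I. \<Lambda> k) + 2 * E * (\<Sum>k\<in>?I. \<Sum>u\<in>near_past a p n k. \<Lambda> u)"
    proof -
      have "(\<Sum>k\<in>?I. \<kappa> k + C + D * \<Lambda> k + F * T k)
         = (\<Sum>k\<in>?I. \<kappa> k) + real (p * n) * C + D * (\<Sum>k\<in>?I. \<Lambda> k) + F * (\<Sum>k\<in>?I. T k)"
        for C D F :: real and T
        by (simp add: sum.distrib sum_distrib_left card_entries)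
      thus ?thesis .
    qed
    also have "\<dots> \<le> (\<Sum>k\<in>?I. \<kappa> k) + real (p * n) * (\<epsilon> + r + 8 * \<epsilon> * (real a)\<^sup>2)
        + (2 + 8 * (real a)\<^sup>2) * (\<Sum>k\<in>?I. \<Lambda> k) + 2 * E * (4 * (real a)\<^sup>2 * (\<Sum>k\<in>?I. \<Lambda> k))"
      by (intro add_left_mono mult_left_mono sum_near_past \<Lambda>0) (simp add: E0)
    also have "\<dots> = (\<Sum>k\<in>?I. \<kappa> k) + real (p * n) * (\<epsilon> + r + 8 * \<epsilon> * (real a)\<^sup>2)
         + (2 + 8 * (real a)\<^sup>2 + 8 * (real a)\<^sup>2 * E) * (\<Sum>k\<in>?I. \<Lambda> k)"
      by (simp add: algebra_simps)
    finally show "(\<Sum>k\<in>?I. \<kappa> k + \<epsilon> + r + 2 * \<epsilon> * card (near_past a p n k) + 2 * \<Lambda> k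
        + (\<Sum>u\<in>near_past a p n k. 2 * \<Lambda> k + 2 * E * \<Lambda> u)) \<le> \<dots>" .
  qed (use c in simp)
  finally show ?thesis unfolding \<kappa>_def E_def r_def \<Lambda>_def .
qed

lemma sum_entries: "(\<Sum>i = 1..int p. \<Sum>j = 1..int n. f (i, j)) = (\<Sum>k\<in>entries p n. f k)"
  unfolding entries_def sum.cartesian_product by (rule sum.cong) auto

text \<open>The parameters are fixed in this order: \<open>a\<close> is chosen so that the conditional
  variance term is small, then \<open>\<epsilon>\<close> in terms of \<open>a\<close>, and finally \<open>n\<close> tends to infinity.\<close>

lemma lindeberg_replacement:
  fixes M :: "nat \<Rightarrow> 'a measure"
    and X :: "nat \<Rightarrow> int \<times> int \<Rightarrow> 'a \<Rightarrow> real"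
    and p :: "nat \<Rightarrow> nat" and y :: real
  assumes prob: "\<And>n. prob_space (M n)"
    and ratio: "(\<lambda>n. real (p n) / real n) \<longlonglongrightarrow> y"
    and meas: "\<And>n k. k \<in> entries (p n) n \<Longrightarrow> X n k \<in> borel_measurable (M n)"
    and sq: "\<And>n k. k \<in> entries (p n) n \<Longrightarrow> integrable (M n) (\<lambda>\<omega>. (X n k \<omega>)\<^sup>2)"
    and var: "\<And>n k. k \<in> entries (p n) n \<Longrightarrow> (LINT \<omega>|M n. (X n k \<omega>)\<^sup>2) = 1"
    and mds: "\<And>n k. k \<in> entries (p n) n \<Longrightarrow> AE \<omega> in M n.
         real_cond_exp (M n) (sigma_rv (M n) (X n) {u \<in> entries (p n) n. lex_less u k}) (X n k) \<omega> = 0"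
    and cond_var: "(\<lambda>a. limsup (\<lambda>n. ereal (1 / (real n)\<^sup>2 *
          (\<Sum>i = 1..int (p n). \<Sum>j = 1..int n. LINT \<omega>|M n.
               \<bar>real_cond_exp (M n) (sigma_rv (M n) (X n) (entries (p n) n \<inter> far_past a (i, j)))
                  (\<lambda>\<omega>. (X n (i, j) \<omega>)\<^sup>2 - 1) \<omega>\<bar>)))) \<longlonglongrightarrow> 0"
    and lindeberg: "\<And>\<epsilon>::real. \<epsilon> > 0 \<Longrightarrow> (\<lambda>n. 1 / (real n)\<^sup>2 *
            (\<Sum>i = 1..int (p n). \<Sum>j = 1..int n. LINT \<omega>|M n. (X n (i, j) \<omega>)\<^sup>2
                    * of_bool (\<bar>X n (i, j) \<omega>\<bar> > \<epsilon> * sqrt (real n)))) \<longlonglongrightarrow> 0"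
    and c: "0 \<le> c"
    and smooth: "\<forall>\<^sub>F n in sequentially. entrywise_smooth (sqrt (real n)) (entries (p n) n) c (F n)"
    and dep: "\<And>n. depends_on (entries (p n) n) (F n)"
  shows "(\<lambda>n. (LINT \<omega>|M n. F n (zero_outside (entries (p n) n) (\<lambda>u. X n u \<omega>)))
            - foldr sign_avg (entry_list (p n) n) (F n) (\<lambda>_. 0)) \<longlonglongrightarrow> 0"
proof (rule tendstoI)
  fix \<eta> :: real assume \<eta>: "0 < \<eta>"
  define A where "A a n = 1 / (real n)\<^sup>2 * (\<Sum>k\<in>entries (p n) n. LINT \<omega>|M n.
      \<bar>real_cond_exp (M n) (sigma_rv (M n) (X n) (entries (p n) n \<inter> far_past a k)) (\<lambda>\<omega>. (X n k \<omega>)\<^sup>2 - 1) \<omega>\<bar>)" for a n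
  define L where "L \<epsilon> n = 1 / (real n)\<^sup>2 * (\<Sum>k\<in>entries (p n) n. large_part (M n) (X n k) (\<epsilon> * sqrt (real n)))" for \<epsilon> n
  have A_lim: "(\<lambda>a. limsup (\<lambda>n. ereal (A a n))) \<longlonglongrightarrow> 0"
    using cond_var unfolding A_def sum_entries[symmetric] .
  have L_lim: "(\<lambda>n. L \<epsilon> n) \<longlonglongrightarrow> 0" if "0 < \<epsilon>" for \<epsilon>
    using lindeberg[OF that] unfolding L_def large_part_def sum_entries[symmetric] .
  define \<eta>' where "\<eta>' = \<eta> / (3 * (c + 1))"
  have \<eta>': "0 < \<eta>'" "c * \<eta>' < \<eta> / 3" using \<eta> c by (simp_all add: \<eta>'_def field_simps)
  have "\<forall>\<^sub>F a in sequentially. limsup (\<lambda>n. ereal (A a n)) < ereal \<eta>'"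
    using order_tendstoD(2)[OF A_lim, of "ereal \<eta>'"] \<eta>' by (simp add: zero_ereal_def)
  then obtain a where a: "1 \<le> a" "limsup (\<lambda>n. ereal (A a n)) < ereal \<eta>'"
    using eventually_happens[OF eventually_conj[OF eventually_ge_at_top[of 1]]] trivial_limit_sequentially by blast
  have evA: "\<forall>\<^sub>F n in sequentially. A a n < \<eta>'"
    using Limsup_lessD[OF a(2)] by simp
  define \<epsilon> where "\<epsilon> = \<eta> / (3 * (c * (\<bar>y\<bar> + 1) * (1 + 8 * (real a)\<^sup>2) + 1))"
  have pos: "0 \<le> c * (\<bar>y\<bar> + 1) * (1 + 8 * (real a)\<^sup>2)" using c by simp
  have \<epsilon>: "0 < \<epsilon>" unfolding \<epsilon>_def using \<eta> pos by (intro divide_pos_pos) auto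
  have \<epsilon>_small: "c * (y * (\<epsilon> * (1 + 8 * (real a)\<^sup>2))) < \<eta> / 3"
  proof -
    have "c * (y * (\<epsilon> * (1 + 8 * (real a)\<^sup>2))) \<le> c * ((\<bar>y\<bar> + 1) * (\<epsilon> * (1 + 8 * (real a)\<^sup>2)))"
      using c \<epsilon> by (intro mult_left_mono mult_right_mono) auto
    also have "\<dots> = \<epsilon> * (c * (\<bar>y\<bar> + 1) * (1 + 8 * (real a)\<^sup>2))" by (simp add: mult_ac)
    also have "\<dots> < \<epsilon> * (c * (\<bar>y\<bar> + 1) * (1 + 8 * (real a)\<^sup>2) + 1)" using \<epsilon> by simp
    also have "\<dots> = \<eta> / 3"
    proof -
      have "\<eta> / (3 * (K + 1)) * (K + 1) = \<eta> / 3" if "0 \<le> K" for K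
        using that by (simp add: field_simps add_nonneg_eq_0_iff)
      thus ?thesis unfolding \<epsilon>_def using pos by blast
    qed
    finally show ?thesis .
  qed
  define C where "C = 2 + 8 * (real a)\<^sup>2 + 8 * (real a)\<^sup>2 * (1 + 1 / \<epsilon>\<^sup>2)"
  have "(\<lambda>n. c * (real (p n) / real n * (\<epsilon> * (1 + 8 * (real a)\<^sup>2) + 1 / sqrt (real n)) + C * L \<epsilon> n))
     \<longlonglongrightarrow> c * (y * (\<epsilon> * (1 + 8 * (real a)\<^sup>2) + 0) + C * 0)"
    by (intro tendsto_intros ratio L_lim[OF \<epsilon>] tendsto_divide_0[OF tendsto_const]
        filterlim_at_top_imp_at_infinity filterlim_compose[OF sqrt_at_top filterlim_real_sequentially])
  hence evB: "\<forall>\<^sub>F n in sequentially.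
      c * (real (p n) / real n * (\<epsilon> * (1 + 8 * (real a)\<^sup>2) + 1 / sqrt (real n)) + C * L \<epsilon> n) < \<eta> / 3"
    using order_tendstoD(2) \<epsilon>_small by fastforce
  show "\<forall>\<^sub>F n in sequentially. dist ((LINT \<omega>|M n. F n (zero_outside (entries (p n) n) (\<lambda>u. X n u \<omega>)))
            - foldr sign_avg (entry_list (p n) n) (F n) (\<lambda>_. 0)) 0 < \<eta>"
    using evA evB smooth eventually_gt_at_top[of 0]
  proof eventually_elim
    case (elim n)
    interpret prob_space "M n" by (rule prob)
    let ?S = "\<Sum>k\<in>entries (p n) n. large_part (M n) (X n k) (\<epsilon> * sqrt (real n))"
    have n: "1 \<le> real n" using elim by simp
    have coef: "2 + 8 * (real a)\<^sup>2 + 8 * (real a)\<^sup>2 * (1 + 1 / (\<epsilon> * sqrt (real n))\<^sup>2) \<le> C"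
    proof -
      have "\<epsilon>\<^sup>2 * 1 \<le> \<epsilon>\<^sup>2 * real n" using n by (intro mult_left_mono) auto
      hence "1 / (\<epsilon> * sqrt (real n))\<^sup>2 \<le> 1 / \<epsilon>\<^sup>2"
        using \<epsilon> n by (intro divide_left_mono) (auto simp: power_mult_distrib)
      thus ?thesis unfolding C_def by (intro add_left_mono mult_left_mono) auto
    qed
    have "\<bar>expectation (\<lambda>\<omega>. F n (zero_outside (entries (p n) n) (\<lambda>u. X n u \<omega>))) - foldr sign_avg (entry_list (p n) n) (F n) (\<lambda>_. 0)\<bar>
     \<le> c / (real n)\<^sup>2 *
        ((\<Sum>k\<in>entries (p n) n. expectation (\<lambda>\<omega>. \<bar>real_cond_exp (M n) (sigma_rv (M n) (X n) (entries (p n) n \<inter> far_past a k)) (\<lambda>\<omega>. (X n k \<omega>)\<^sup>2 - 1) \<omega>\<bar>))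
         + real (p n * n) * (\<epsilon> + 1 / sqrt (real n) + 8 * \<epsilon> * (real a)\<^sup>2)
         + (2 + 8 * (real a)\<^sup>2 + 8 * (real a)\<^sup>2 * (1 + 1 / (\<epsilon> * sqrt (real n))\<^sup>2)) * ?S)"
      by (rule replacement_total) (use elim \<epsilon> c a meas sq var mds dep in auto)
    also have "\<dots> \<le> c / (real n)\<^sup>2 *
        ((\<Sum>k\<in>entries (p n) n. expectation (\<lambda>\<omega>. \<bar>real_cond_exp (M n) (sigma_rv (M n) (X n) (entries (p n) n \<inter> far_past a k)) (\<lambda>\<omega>. (X n k \<omega>)\<^sup>2 - 1) \<omega>\<bar>))
         + real (p n * n) * (\<epsilon> + 1 / sqrt (real n) + 8 * \<epsilon> * (real a)\<^sup>2) + C * ?S)"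
      using c by (intro mult_left_mono add_left_mono mult_right_mono coef sum_nonneg large_part_nonneg) auto
    also have "\<dots> = c * A a n + c * (real (p n) / real n * (\<epsilon> * (1 + 8 * (real a)\<^sup>2) + 1 / sqrt (real n)) + C * L \<epsilon> n)"
    proof -
      have "c / m\<^sup>2 * (K + q * m * (\<epsilon> + r + 8 * \<epsilon> * b) + C * S)
        = c * (1 / m\<^sup>2 * K) + c * (q / m * (\<epsilon> * (1 + 8 * b) + r) + C * (1 / m\<^sup>2 * S))" if "m \<noteq> 0" for K q m r b S :: real
        using that by (simp add: field_simps power2_eq_square)
      from this[of "real n"] show ?thesis unfolding A_def L_def of_nat_mult using n by simp
    qed
    also have "c * A a n \<le> c * \<eta>'" using elim c by (intro mult_left_mono) auto
    finally show ?case unfolding dist_real_def diff_0_right using elim(2) \<eta>'(2) \<eta> by linarith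
  qed
qed

section \<open>The normalised trace is smooth in each entry\<close>

lemma det_measurable:
  fixes A :: "'b \<Rightarrow> real Matrix.mat"
  assumes "\<And>x. A x \<in> carrier_mat N N"
    and "\<And>i j. i < N \<Longrightarrow> j < N \<Longrightarrow> (\<lambda>x. A x $$ (i, j)) \<in> borel_measurable \<M>"
  shows "(\<lambda>x. Determinant.det (A x)) \<in> borel_measurable \<M>"
proof -
  have "(\<lambda>x. \<Sum>\<pi>\<in>{\<pi>. \<pi> permutes {0..<N}}. signof \<pi> * (\<Prod>i = 0..<N. A x $$ (i, \<pi> i))) \<in> borel_measurable \<M>"
  proof (intro borel_measurable_sum borel_measurable_times borel_measurable_prod borel_measurable_const)
    fix \<pi> i assume "\<pi> \<in> {\<pi>. \<pi> permutes {0..<N}}" "i \<in> {0..<N}"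
    thus "(\<lambda>x. A x $$ (i, \<pi> i)) \<in> borel_measurable \<M>"
      using permutes_in_image[of \<pi> "{0..<N}" i] by (intro assms(2)) auto
  qed
  thus ?thesis by (simp add: det_def'[OF assms(1)])
qed

lemma shift_inverse_measurable:
  assumes K: "\<And>i j. (\<lambda>x. K x i j) \<in> borel_measurable \<M>" and "a < N" "b < N"
  shows "(\<lambda>x. shift_inverse r N (K x) a b) \<in> borel_measurable \<M>"
proof -
  define A where "A x = Matrix.mat N N (\<lambda>(i, j). (if i = j then r else 0) + K x i j)" for x
  have A: "(\<lambda>x. A x $$ (i, j)) \<in> borel_measurable \<M>" if "i < N" "j < N" for i j
  proof -
    have "(\<lambda>x. A x $$ (i, j)) = (\<lambda>x. (if i = j then r else 0) + K x i j)"
      using that by (simp add: A_def)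
    thus ?thesis using borel_measurable_add[OF borel_measurable_const K] by simp
  qed
  have "(\<lambda>x. Determinant.det (mat_delete (A x) b a)) \<in> borel_measurable \<M>"
  proof (rule det_measurable)
    fix i j assume ij: "i < N - 1" "j < N - 1"
    define i' j' where "i' = (if i < b then i else Suc i)" and "j' = (if j < a then j else Suc j)"
    have "mat_delete (A x) b a $$ (i, j) = A x $$ (i', j')" for x
      using ij by (simp add: mat_delete_def A_def i'_def j'_def)
    moreover have "i' < N" "j' < N" using ij by (auto simp: i'_def j'_def)
    ultimately show "(\<lambda>x. mat_delete (A x) b a $$ (i, j)) \<in> borel_measurable \<M>"
      using A by presburger
  qed (simp add: mat_delete_def A_def)
  moreover have "(\<lambda>x. Determinant.det (A x)) \<in> borel_measurable \<M>"
    by (rule det_measurable[OF _ A]) (auto simp: A_def)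
  ultimately have "(\<lambda>x. (- 1) ^ (b + a) * Determinant.det (mat_delete (A x) b a) / Determinant.det (A x)) \<in> borel_measurable \<M>"
    by measurable
  thus ?thesis by (simp add: shift_inverse_def Let_def cofactor_def A_def)
qed

lemma block_resolvent_measurable:
  assumes "a < p + n" "b < p + n"
  shows "(\<lambda>x. block_resolvent r p n x a b) \<in> borel_measurable vectors"
  unfolding block_resolvent_def
proof (rule shift_inverse_measurable[OF _ assms])
  fix i j
  show "(\<lambda>x. skew_block p n x i j) \<in> borel_measurable vectors"
    by (cases "i < p \<and> p \<le> j"; cases "j < p \<and> p \<le> i") (auto simp: skew_block_def intro!: borel_measurable_divide borel_measurable_uminus measurable_coordinate)
qed

definition norm_trace :: "real \<Rightarrow> nat \<Rightarrow> nat \<Rightarrow> (int \<times> int \<Rightarrow> real) \<Rightarrow> real" where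
  "norm_trace r p n x = (\<Sum>c<p + n. block_resolvent r p n x c c) / real n"

lemma norm_trace_bound:
  assumes "0 < r" "0 < n"
  shows "\<bar>norm_trace r p n x\<bar> \<le> (real p / real n + 1) / r"
proof -
  have "\<bar>\<Sum>c<p + n. block_resolvent r p n x c c\<bar> \<le> (\<Sum>c<p + n. 1 / r)"
    by (rule order.trans[OF sum_abs]) (intro sum_mono block_resolvent_entry_bound; use assms in auto)
  hence "\<bar>\<Sum>c<p + n. block_resolvent r p n x c c\<bar> \<le> real (p + n) * (1 / r)" by simp
  hence "\<bar>norm_trace r p n x\<bar> \<le> (real (p + n) * (1 / r)) / real n"
    unfolding norm_trace_def abs_divide abs_of_nat by (rule divide_right_mono) simp
  also have "\<dots> = (real p / real n + 1) / r" using assms by (simp add: field_simps)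
  finally show ?thesis .
qed

text \<open>Up to the normalisation, the coefficients are those of the trace expansion; each step in an entry of \<open>X\<close>
  is divided by \<open>\<surd>n\<close> in the block matrix.\<close>

lemma norm_trace_smooth:
  assumes r: "0 < r" and n: "0 < n"
    and c: "(real p / real n + 1) / r + 2 / r\<^sup>2 + 8 / r ^ 3 + 24 / r ^ 4 \<le> c"
  shows "entrywise_smooth (sqrt (real n)) (entries p n) c (norm_trace r p n)"
proof -
  define s where "s = sqrt (real n)"
  have s: "0 < s" using n by (simp add: s_def)
  have ns: "real n = s * s" using n by (simp add: s_def)
  define \<beta> where "\<beta> = 1 / r"
  have \<beta>: "0 \<le> \<beta>" using r by (simp add: \<beta>_def)
  have c': "(real p / real n + 1) / r + 2 * \<beta>\<^sup>2 + 8 * \<beta> ^ 3 + 24 * \<beta> ^ 4 \<le> c"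
    using c by (simp add: \<beta>_def power_divide)
  have t0: "0 \<le> (real p / real n + 1) / r" "0 \<le> \<beta>\<^sup>2" "0 \<le> \<beta> ^ 3" "0 \<le> \<beta> ^ 4" using r \<beta> by auto
  have cb: "(real p / real n + 1) / r \<le> c" "2 * \<beta>\<^sup>2 \<le> c" "4 * \<beta> ^ 3 \<le> c" "8 * \<beta> ^ 3 \<le> c" "8 * \<beta> ^ 4 \<le> c" "24 * \<beta> ^ 4 \<le> c"
    using c' t0 by linarith+
  let ?N = "p + n"
  let ?G = "block_resolvent r p n"
  let ?U = "\<lambda>x. mprod ?N (?G x) (?G x)"
  define F1 where "F1 k x = - (?U x (col_index p k) (row_index k) - ?U x (row_index k) (col_index p k)) / s ^ 3" for k x
  define F2 where "F2 k x = second_form (row_index k) (col_index p k) (?G x) (?U x) / s ^ 4" for k x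
  have Gm: "(\<lambda>x. ?G x a b) \<in> borel_measurable vectors" if "a < ?N" "b < ?N" for a b
    using block_resolvent_measurable that .
  have Um: "(\<lambda>x. ?U x a b) \<in> borel_measurable vectors" if "a < ?N" "b < ?N" for a b
    unfolding mprod_def by (intro borel_measurable_sum borel_measurable_times Gm) (use that in auto)
  have dm: "\<bar>d / s ^ m\<bar> \<le> B / s ^ m" if "\<bar>d\<bar> \<le> B" for d B m
    using divide_right_mono[OF that, of "s ^ m"] s by simp
  have dm2: "\<bar>d / (s * s)\<bar> \<le> B / (s * s)" if "\<bar>d\<bar> \<le> B" for d B
    using divide_right_mono[OF that, of "s * s"] s by simp
  have scale: "C / s ^ m * z \<le> c / s ^ m * z" if "C \<le> c" "0 \<le> z" for C z m
    using that s by (intro mult_right_mono divide_right_mono) auto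
  show ?thesis
    unfolding s_def[symmetric]
  proof (rule entrywise_smoothI[where D = F1 and E = F2])
    show "norm_trace r p n \<in> borel_measurable vectors"
      unfolding norm_trace_def[abs_def]
      by (intro borel_measurable_divide borel_measurable_sum Gm borel_measurable_const) auto
    show "\<bar>norm_trace r p n x\<bar> \<le> c" for x
      using norm_trace_bound[OF r n, of p x] cb(1) by linarith
  next
    fix k assume k: "k \<in> entries p n"
    let ?a = "row_index k" let ?b = "col_index p k"
    have ab: "?a < ?N" "?b < ?N" using index_bounds[OF k] by auto
    show "F1 k \<in> borel_measurable vectors"
      unfolding F1_def by (intro borel_measurable_divide borel_measurable_diff borel_measurable_uminus Um ab borel_measurable_const)
    show "F2 k \<in> borel_measurable vectors"
      unfolding F2_def second_form_def
      by (intro borel_measurable_divide borel_measurable_diff borel_measurable_add borel_measurable_times Um Gm ab borel_measurable_const)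
  next
    fix k and x :: "int \<times> int \<Rightarrow> real" and v assume k: "k \<in> entries p n"
    let ?a = "row_index k" let ?b = "col_index p k"
    have ab: "?a < ?N" "?b < ?N" using index_bounds[OF k] by auto
    define w where "w = v - x k"
    define v' where "v' = w / s"
    let ?H = "?G (x(k := v))"
    have pert: "?H c d = ?G x c d - v' * (?G x c ?a * ?H ?b d - ?G x c ?b * ?H ?a d)"
      if "c < ?N" "d < ?N" for c d
      using block_resolvent_update[OF r k that] by (simp add: v'_def w_def s_def)
    have ebd: "\<bar>?G z c d\<bar> \<le> \<beta>" if "c < ?N" "d < ?N" for z c d
      using block_resolvent_entry_bound[OF r that] by (simp add: \<beta>_def)
    have pbd: "\<bar>mprod ?N (?G z) (?G z') c d\<bar> \<le> \<beta>\<^sup>2" if "c < ?N" "d < ?N" for z z' c d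
      using block_resolvent_product_bound[OF r that] by (simp add: \<beta>_def)
    interpret P: rank_two_perturbation ?N ?a ?b "?G x" ?H v' \<beta>
      by unfold_locales (fact ab pert \<beta> ebd pbd)+
    have diff: "norm_trace r p n (x(k := v)) - norm_trace r p n x
       = ((\<Sum>c<?N. ?H c c) - (\<Sum>c<?N. ?G x c c)) / (s * s)"
      by (simp add: norm_trace_def ns diff_divide_distrib)
    have av: "\<bar>v'\<bar> = \<bar>w\<bar> / s" using s by (simp add: v'_def)
    have 1: "\<bar>?U x ?b ?a - ?U x ?a ?b\<bar> \<le> 2 * \<beta>\<^sup>2"
      by (rule P.first_coefficient_bound)
    show "\<bar>F1 k x\<bar> \<le> c / s ^ 3"
      using 1 cb(2) s by (simp add: F1_def divide_right_mono)
    have 2: "\<bar>second_form ?a ?b (?G x) (?U x)\<bar> \<le> 4 * (\<beta> * \<beta>\<^sup>2)"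
      by (rule P.second_form_bound) (use ebd pbd ab in auto)
    show "\<bar>F2 k x\<bar> \<le> c / s ^ 4"
      using 2 cb(3) s by (simp add: F2_def divide_right_mono power3_eq_cube power2_eq_square mult.assoc)
    have "\<bar>norm_trace r p n (x(k := v)) - norm_trace r p n x\<bar> \<le> 2 * \<beta>\<^sup>2 * \<bar>v'\<bar> / (s * s)"
      unfolding diff by (rule dm2[OF P.trace_change_1])
    also have "\<dots> = 2 * \<beta>\<^sup>2 / s ^ 3 * \<bar>w\<bar>" unfolding av using s by (simp add: field_simps eval_nat_numeral)
    also have "\<dots> \<le> c / s ^ 3 * \<bar>w\<bar>" by (rule scale) (use cb in auto)
    finally show "\<bar>norm_trace r p n (x(k := v)) - norm_trace r p n x\<bar> \<le> c / s ^ 3 * \<bar>v - x k\<bar>" by (simp add: w_def)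
    have e1: "norm_trace r p n (x(k := v)) - norm_trace r p n x - w * F1 k x
       = ((\<Sum>c<?N. ?H c c) - (\<Sum>c<?N. ?G x c c) + v' * (?U x ?b ?a - ?U x ?a ?b)) / (s * s)"
    proof -
      have "D / (s * s) - w * (- u / s ^ 3) = (D + w / s * u) / (s * s)" for D u :: real
        using s by (simp add: field_simps eval_nat_numeral)
      thus ?thesis unfolding diff F1_def v'_def .
    qed
    have "\<bar>norm_trace r p n (x(k := v)) - norm_trace r p n x - w * F1 k x\<bar> \<le> 4 * \<beta> ^ 3 * v'\<^sup>2 / (s * s)"
      unfolding e1 by (rule dm2[OF P.trace_change_2])
    also have "\<dots> = 4 * \<beta> ^ 3 / s ^ 4 * w\<^sup>2" unfolding v'_def using s by (simp add: field_simps eval_nat_numeral)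
    also have "\<dots> \<le> c / s ^ 4 * w\<^sup>2" by (rule scale) (use cb in auto)
    finally show "\<bar>norm_trace r p n (x(k := v)) - norm_trace r p n x - (v - x k) * F1 k x\<bar> \<le> c / s ^ 4 * (v - x k)\<^sup>2"
      by (simp add: w_def)
    have e2: "norm_trace r p n (x(k := v)) - norm_trace r p n x - w * F1 k x - w\<^sup>2 * F2 k x
       = ((\<Sum>c<?N. ?H c c) - (\<Sum>c<?N. ?G x c c) + v' * (?U x ?b ?a - ?U x ?a ?b)
          - v'\<^sup>2 * second_form ?a ?b (?G x) (?U x)) / (s * s)"
    proof -
      have "D / (s * s) - w\<^sup>2 * (u / s ^ 4) = (D - (w / s)\<^sup>2 * u) / (s * s)" for D u :: real
        using s by (simp add: field_simps eval_nat_numeral)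
      thus ?thesis unfolding e1 F2_def v'_def .
    qed
    have "\<bar>norm_trace r p n (x(k := v)) - norm_trace r p n x - w * F1 k x - w\<^sup>2 * F2 k x\<bar>
       \<le> 8 * \<beta> ^ 4 * \<bar>v'\<bar> ^ 3 / (s * s)"
      unfolding e2 by (rule dm2[OF P.trace_change_3])
    also have "\<dots> = 8 * \<beta> ^ 4 / s ^ 5 * \<bar>w\<bar> ^ 3" unfolding av using s by (simp add: field_simps eval_nat_numeral)
    also have "\<dots> \<le> c / s ^ 5 * \<bar>w\<bar> ^ 3" by (rule scale) (use cb in auto)
    finally show "\<bar>norm_trace r p n (x(k := v)) - norm_trace r p n x - (v - x k) * F1 k x - (v - x k)\<^sup>2 * F2 k x\<bar>
       \<le> c / s ^ 5 * \<bar>v - x k\<bar> ^ 3" by (simp add: w_def)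
    fix u assume u: "u \<in> entries p n"
    let ?a' = "row_index u" let ?b' = "col_index p u"
    have ab': "?a' < ?N" "?b' < ?N" using index_bounds[OF u] by auto
    define z where "z = v - x u"
    let ?H = "?G (x(u := v))"
    have pert': "?H c d = ?G x c d - z / s * (?G x c ?a' * ?H ?b' d - ?G x c ?b' * ?H ?a' d)"
      if "c < ?N" "d < ?N" for c d
      using block_resolvent_update[OF r u that] by (simp add: z_def s_def)
    interpret P': rank_two_perturbation ?N ?a' ?b' "?G x" ?H "z / s" \<beta>
      by unfold_locales (fact ab' pert' \<beta> ebd pbd)+
    have az: "\<bar>z / s\<bar> = \<bar>z\<bar> / s" using s by simp
    have f1: "F1 k (x(u := v)) - F1 k x = - ((?U (x(u := v)) ?b ?a - ?U (x(u := v)) ?a ?b) - (?U x ?b ?a - ?U x ?a ?b)) / s ^ 3"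
      unfolding F1_def by (simp add: diff_divide_distrib add_divide_distrib)
    have "\<bar>F1 k (x(u := v)) - F1 k x\<bar> \<le> 8 * \<beta> ^ 3 * \<bar>z / s\<bar> / s ^ 3"
      unfolding f1 by (rule dm) (use P'.first_coefficient_change[OF ab] in \<open>simp only: abs_minus_cancel\<close>)
    also have "\<dots> = 8 * \<beta> ^ 3 / s ^ 4 * \<bar>z\<bar>" unfolding az using s by (simp add: field_simps eval_nat_numeral)
    also have "\<dots> \<le> c / s ^ 4 * \<bar>z\<bar>" by (rule scale) (use cb in auto)
    finally show "\<bar>F1 k (x(u := v)) - F1 k x\<bar> \<le> c / s ^ 4 * \<bar>v - x u\<bar>" by (simp add: z_def)
    have f2: "F2 k (x(u := v)) - F2 k x
      = (second_form ?a ?b ?H (?U (x(u := v))) - second_form ?a ?b (?G x) (?U x)) / s ^ 4"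
      unfolding F2_def by (simp add: diff_divide_distrib)
    have "\<bar>F2 k (x(u := v)) - F2 k x\<bar> \<le> 24 * \<beta> ^ 4 * \<bar>z / s\<bar> / s ^ 4"
      unfolding f2 by (rule dm[OF P'.second_coefficient_change[OF ab]])
    also have "\<dots> = 24 * \<beta> ^ 4 / s ^ 5 * \<bar>z\<bar>" unfolding az using s by (simp add: field_simps eval_nat_numeral)
    also have "\<dots> \<le> c / s ^ 5 * \<bar>z\<bar>" by (rule scale) (use cb in auto)
    finally show "\<bar>F2 k (x(u := v)) - F2 k x\<bar> \<le> c / s ^ 5 * \<bar>v - x u\<bar>" by (simp add: z_def)
  qed
qed

text \<open>The product rule: with \<open>\<Delta>\<close> the increment of \<open>f\<close>, the increment of the square is
  \<open>2 (f - m) \<Delta> + \<Delta>\<^sup>2\<close>, where the square of the first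
  coefficient of \<open>f\<close> enters the second coefficient and the rest of \<open>\<Delta>\<^sup>2\<close> is of lower order.\<close>

lemma entrywise_smooth_square:
  assumes f: "entrywise_smooth s I c f" and s: "1 \<le> s" and m: "\<bar>m\<bar> \<le> c"
  shows "entrywise_smooth s I (8 * c\<^sup>2) (\<lambda>x. (f x - m)\<^sup>2)"
proof -
  from f obtain F1 F2 where meas: "f \<in> borel_measurable vectors" and bd: "\<And>x. \<bar>f x\<bar> \<le> c"
    and F12: "\<And>k. k \<in> I \<Longrightarrow> F1 k \<in> borel_measurable vectors \<and> F2 k \<in> borel_measurable vectors"
    and A1: "\<And>k x. k \<in> I \<Longrightarrow> \<bar>F1 k x\<bar> \<le> c / s ^ 3" and A2: "\<And>k x. k \<in> I \<Longrightarrow> \<bar>F2 k x\<bar> \<le> c / s ^ 4"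
    and B: "\<And>k x v. k \<in> I \<Longrightarrow> \<bar>f (x(k := v)) - f x\<bar> \<le> c / s ^ 3 * \<bar>v - x k\<bar>"
    and C: "\<And>k x v. k \<in> I \<Longrightarrow> \<bar>f (x(k := v)) - f x - (v - x k) * F1 k x\<bar> \<le> c / s ^ 4 * (v - x k)\<^sup>2"
    and D: "\<And>k x v. k \<in> I \<Longrightarrow> \<bar>f (x(k := v)) - f x - (v - x k) * F1 k x - (v - x k)\<^sup>2 * F2 k x\<bar> \<le> c / s ^ 5 * \<bar>v - x k\<bar> ^ 3"
    and E: "\<And>k u x v. k \<in> I \<Longrightarrow> u \<in> I \<Longrightarrow> \<bar>F1 k (x(u := v)) - F1 k x\<bar> \<le> c / s ^ 4 * \<bar>v - x u\<bar>"
    and G: "\<And>k u x v. k \<in> I \<Longrightarrow> u \<in> I \<Longrightarrow> \<bar>F2 k (x(u := v)) - F2 k x\<bar> \<le> c / s ^ 5 * \<bar>v - x u\<bar>"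
    unfolding entrywise_smooth_def by blast
  have c: "0 \<le> c" using m by linarith
  have s0: "0 < s" using s by linarith
  define g where "g x = f x - m" for x
  have gb: "\<bar>g x\<bar> \<le> 2 * c" for x using bd[of x] m unfolding g_def by linarith
  have gd: "g (x(k := v)) - g x = f (x(k := v)) - f x" for x k v by (simp add: g_def)
  define P1 where "P1 k x = 2 * g x * F1 k x" for k x
  define P2 where "P2 k x = 2 * g x * F2 k x + (F1 k x)\<^sup>2" for k x
  have prod: "\<bar>X * Y\<bar> \<le> a * b" if "\<bar>X\<bar> \<le> a" "\<bar>Y\<bar> \<le> b" for X Y a b :: real
    unfolding abs_mult using that by (intro mult_mono) auto
  have add: "\<bar>X + Y\<bar> \<le> a + b" if "\<bar>X\<bar> \<le> a" "\<bar>Y\<bar> \<le> b" for X Y a b :: real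
    using that by linarith
  \<comment> \<open>Since \<open>s \<ge> 1\<close>, surplus powers of \<open>s\<close> in a denominator may be dropped.\<close>
  have drop: "A / s ^ i * z \<le> B / s ^ j * z" if "j \<le> i" "0 \<le> A" "A \<le> B" "0 \<le> z" for A B z i j
  proof -
    have "A / s ^ i \<le> B / s ^ j"
      using that s s0 by (intro frac_le power_increasing) auto
    thus ?thesis using that by (intro mult_right_mono) auto
  qed
  have drop1: "A / s ^ i \<le> B / s ^ j" if "j \<le> i" "0 \<le> A" "A \<le> B" for A B i j
    using drop[OF that, of 1] by simp
  show ?thesis
  proof (rule entrywise_smoothI[where D = P1 and E = P2])
    show "(\<lambda>x. (f x - m)\<^sup>2) \<in> borel_measurable vectors" using meas by measurable
    show "\<bar>(f x - m)\<^sup>2\<bar> \<le> 8 * c\<^sup>2" for x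
    proof -
      have "\<bar>g x * g x\<bar> \<le> (2 * c) * (2 * c)" by (rule prod[OF gb gb])
      also have "\<dots> \<le> 8 * c\<^sup>2" by (simp add: power2_eq_square)
      finally show ?thesis by (simp add: g_def power2_eq_square)
    qed
    fix k assume k: "k \<in> I"
    note [measurable] = meas
    have [measurable]: "F1 k \<in> borel_measurable vectors" "F2 k \<in> borel_measurable vectors" using F12[OF k] by auto
    show "P1 k \<in> borel_measurable vectors" unfolding P1_def[abs_def] g_def by measurable
    show "P2 k \<in> borel_measurable vectors" unfolding P2_def[abs_def] g_def by measurable
    have F1sq: "\<bar>(F1 k x)\<^sup>2\<bar> \<le> c\<^sup>2 / s ^ 6" for x
      using prod[OF A1[OF k] A1[OF k], of x x] by (simp add: power2_eq_square eval_nat_numeral mult_ac)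
    show "\<bar>P1 k x\<bar> \<le> 8 * c\<^sup>2 / s ^ 3" for x
    proof -
      have "\<bar>2 * (g x * F1 k x)\<bar> \<le> 2 * (2 * c * (c / s ^ 3))"
        using prod[OF gb A1[OF k], of x x] by (simp add: abs_mult)
      also have "\<dots> = 4 * c\<^sup>2 / s ^ 3" by (simp add: power2_eq_square)
      also have "\<dots> \<le> 8 * c\<^sup>2 / s ^ 3" by (rule drop1) auto
      finally show ?thesis by (simp add: P1_def mult.assoc)
    qed
    show "\<bar>P2 k x\<bar> \<le> 8 * c\<^sup>2 / s ^ 4" for x
    proof -
      have "\<bar>2 * (g x * F2 k x)\<bar> \<le> 2 * (2 * c * (c / s ^ 4))"
        using prod[OF gb A2[OF k], of x x] by (simp add: abs_mult)
      also have "\<dots> = 4 * c\<^sup>2 / s ^ 4" by (simp add: power2_eq_square)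
      finally have "\<bar>P2 k x\<bar> \<le> 4 * c\<^sup>2 / s ^ 4 + c\<^sup>2 / s ^ 6"
        unfolding P2_def mult.assoc by (intro add F1sq)
      also have "\<dots> \<le> 4 * c\<^sup>2 / s ^ 4 + c\<^sup>2 / s ^ 4" by (intro add_left_mono drop1) auto
      also have "\<dots> \<le> 8 * c\<^sup>2 / s ^ 4"
        unfolding add_divide_distrib[symmetric] by (rule drop1) auto
      finally show ?thesis .
    qed
    fix x :: "'a \<Rightarrow> real" and v
    define w where "w = v - x k"
    define \<Delta> where "\<Delta> = f (x(k := v)) - f x"
    have sq: "(f (x(k := v)) - m)\<^sup>2 - (f x - m)\<^sup>2 = \<Delta> * (g (x(k := v)) + g x)"
      "(f (x(k := v)) - m)\<^sup>2 - (f x - m)\<^sup>2 = 2 * g x * \<Delta> + \<Delta> * \<Delta>"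
      by (simp_all add: \<Delta>_def g_def power2_eq_square algebra_simps)
    have \<Delta>: "\<bar>\<Delta>\<bar> \<le> c / s ^ 3 * \<bar>w\<bar>" using B[OF k] by (simp add: \<Delta>_def w_def)
    have \<Delta>1: "\<bar>\<Delta> - w * F1 k x\<bar> \<le> c / s ^ 4 * w\<^sup>2" using C[OF k] by (simp add: \<Delta>_def w_def)
    have \<Delta>2: "\<bar>\<Delta> - w * F1 k x - w\<^sup>2 * F2 k x\<bar> \<le> c / s ^ 5 * \<bar>w\<bar> ^ 3" using D[OF k] by (simp add: \<Delta>_def w_def)
    have wF1: "\<bar>w * F1 k x\<bar> \<le> c / s ^ 3 * \<bar>w\<bar>" using prod[OF order.refl A1[OF k], of w x] by (simp add: mult.commute)
    show "\<bar>(f (x(k := v)) - m)\<^sup>2 - (f x - m)\<^sup>2\<bar> \<le> 8 * c\<^sup>2 / s ^ 3 * \<bar>v - x k\<bar>"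
    proof -
      have "\<bar>\<Delta> * (g (x(k := v)) + g x)\<bar> \<le> (c / s ^ 3 * \<bar>w\<bar>) * (2 * c + 2 * c)"
        by (intro prod add \<Delta> gb)
      also have "\<dots> = 4 * c\<^sup>2 / s ^ 3 * \<bar>w\<bar>" by (simp add: power2_eq_square)
      also have "\<dots> \<le> 8 * c\<^sup>2 / s ^ 3 * \<bar>w\<bar>" by (rule drop) auto
      finally show ?thesis unfolding sq(1) w_def .
    qed
    show "\<bar>(f (x(k := v)) - m)\<^sup>2 - (f x - m)\<^sup>2 - (v - x k) * P1 k x\<bar> \<le> 8 * c\<^sup>2 / s ^ 4 * (v - x k)\<^sup>2"
    proof -
      have eq: "(f (x(k := v)) - m)\<^sup>2 - (f x - m)\<^sup>2 - w * P1 k x = 2 * (g x * (\<Delta> - w * F1 k x)) + \<Delta> * \<Delta>"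
        unfolding sq(2) P1_def by (simp add: algebra_simps)
      have h1: "\<bar>2 * (g x * (\<Delta> - w * F1 k x))\<bar> \<le> 2 * (2 * c * (c / s ^ 4 * w\<^sup>2))"
        using prod[OF gb \<Delta>1, of x] by (simp add: abs_mult)
      have h2: "\<bar>\<Delta> * \<Delta>\<bar> \<le> (c / s ^ 3 * \<bar>w\<bar>) * (c / s ^ 3 * \<bar>w\<bar>)" by (intro prod \<Delta>)
      have "\<bar>(f (x(k := v)) - m)\<^sup>2 - (f x - m)\<^sup>2 - w * P1 k x\<bar>
         \<le> 2 * (2 * c * (c / s ^ 4 * w\<^sup>2)) + (c / s ^ 3 * \<bar>w\<bar>) * (c / s ^ 3 * \<bar>w\<bar>)"
        unfolding eq by (rule add[OF h1 h2])
      also have "\<dots> = 4 * c\<^sup>2 / s ^ 4 * w\<^sup>2 + c\<^sup>2 / s ^ 6 * w\<^sup>2"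
        unfolding power2_abs[of w, symmetric] using s0 by (simp add: field_simps eval_nat_numeral del: abs_mult_self_eq power2_abs)
      also have "\<dots> \<le> 4 * c\<^sup>2 / s ^ 4 * w\<^sup>2 + c\<^sup>2 / s ^ 4 * w\<^sup>2" by (intro add_left_mono drop) auto
      also have "\<dots> \<le> 8 * c\<^sup>2 / s ^ 4 * w\<^sup>2"
        unfolding distrib_right[symmetric] add_divide_distrib[symmetric] by (rule drop) auto
      finally show ?thesis unfolding w_def .
    qed
    show "\<bar>(f (x(k := v)) - m)\<^sup>2 - (f x - m)\<^sup>2 - (v - x k) * P1 k x - (v - x k)\<^sup>2 * P2 k x\<bar>
        \<le> 8 * c\<^sup>2 / s ^ 5 * \<bar>v - x k\<bar> ^ 3"
    proof -
      have eq: "(f (x(k := v)) - m)\<^sup>2 - (f x - m)\<^sup>2 - w * P1 k x - w\<^sup>2 * P2 k x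
         = 2 * (g x * (\<Delta> - w * F1 k x - w\<^sup>2 * F2 k x)) + (\<Delta> - w * F1 k x) * (\<Delta> + w * F1 k x)"
        unfolding sq(2) P1_def P2_def by (simp add: algebra_simps power2_eq_square)
      have h1: "\<bar>2 * (g x * (\<Delta> - w * F1 k x - w\<^sup>2 * F2 k x))\<bar> \<le> 2 * (2 * c * (c / s ^ 5 * \<bar>w\<bar> ^ 3))"
        using prod[OF gb \<Delta>2, of x] by (simp add: abs_mult)
      have h2: "\<bar>(\<Delta> - w * F1 k x) * (\<Delta> + w * F1 k x)\<bar>
          \<le> (c / s ^ 4 * w\<^sup>2) * (c / s ^ 3 * \<bar>w\<bar> + c / s ^ 3 * \<bar>w\<bar>)"
        by (intro prod \<Delta>1 add \<Delta> wF1)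
      have "\<bar>(f (x(k := v)) - m)\<^sup>2 - (f x - m)\<^sup>2 - w * P1 k x - w\<^sup>2 * P2 k x\<bar>
         \<le> 2 * (2 * c * (c / s ^ 5 * \<bar>w\<bar> ^ 3)) + (c / s ^ 4 * w\<^sup>2) * (c / s ^ 3 * \<bar>w\<bar> + c / s ^ 3 * \<bar>w\<bar>)"
        unfolding eq by (rule add[OF h1 h2])
      also have "\<dots> = 4 * c\<^sup>2 / s ^ 5 * \<bar>w\<bar> ^ 3 + 2 * c\<^sup>2 / s ^ 7 * \<bar>w\<bar> ^ 3"
        unfolding power2_abs[of w, symmetric] using s0 by (simp add: field_simps eval_nat_numeral del: abs_mult_self_eq power2_abs)
      also have "\<dots> \<le> 4 * c\<^sup>2 / s ^ 5 * \<bar>w\<bar> ^ 3 + 2 * c\<^sup>2 / s ^ 5 * \<bar>w\<bar> ^ 3" by (intro add_left_mono drop) auto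
      also have "\<dots> \<le> 8 * c\<^sup>2 / s ^ 5 * \<bar>w\<bar> ^ 3"
        unfolding distrib_right[symmetric] add_divide_distrib[symmetric] by (rule drop) auto
      finally show ?thesis unfolding w_def .
    qed
    fix u assume u: "u \<in> I"
    let ?x = "x(u := v)"
    define z where "z = v - x u"
    have gz: "\<bar>g ?x - g x\<bar> \<le> c / s ^ 3 * \<bar>z\<bar>" using B[OF u] by (simp add: gd z_def)
    have F1z: "\<bar>F1 k ?x - F1 k x\<bar> \<le> c / s ^ 4 * \<bar>z\<bar>" using E[OF k u] by (simp add: z_def)
    have F2z: "\<bar>F2 k ?x - F2 k x\<bar> \<le> c / s ^ 5 * \<bar>z\<bar>" using G[OF k u] by (simp add: z_def)
    show "\<bar>P1 k ?x - P1 k x\<bar> \<le> 8 * c\<^sup>2 / s ^ 4 * \<bar>v - x u\<bar>"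
    proof -
      have eq: "P1 k ?x - P1 k x = 2 * ((g ?x - g x) * F1 k ?x) + 2 * (g x * (F1 k ?x - F1 k x))"
        unfolding P1_def by (simp add: algebra_simps)
      have h1: "\<bar>2 * ((g ?x - g x) * F1 k ?x)\<bar> \<le> 2 * ((c / s ^ 3 * \<bar>z\<bar>) * (c / s ^ 3))"
        using prod[OF gz A1[OF k], of ?x] by (simp add: abs_mult)
      have h2: "\<bar>2 * (g x * (F1 k ?x - F1 k x))\<bar> \<le> 2 * (2 * c * (c / s ^ 4 * \<bar>z\<bar>))"
        using prod[OF gb F1z, of x] by (simp add: abs_mult)
      have "\<bar>P1 k ?x - P1 k x\<bar> \<le> 2 * ((c / s ^ 3 * \<bar>z\<bar>) * (c / s ^ 3)) + 2 * (2 * c * (c / s ^ 4 * \<bar>z\<bar>))"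
        unfolding eq by (rule add[OF h1 h2])
      also have "\<dots> = 2 * c\<^sup>2 / s ^ 6 * \<bar>z\<bar> + 4 * c\<^sup>2 / s ^ 4 * \<bar>z\<bar>"
        using s0 by (simp add: field_simps eval_nat_numeral)
      also have "\<dots> \<le> 2 * c\<^sup>2 / s ^ 4 * \<bar>z\<bar> + 4 * c\<^sup>2 / s ^ 4 * \<bar>z\<bar>" by (intro add_right_mono drop) auto
      also have "\<dots> \<le> 8 * c\<^sup>2 / s ^ 4 * \<bar>z\<bar>"
        unfolding distrib_right[symmetric] add_divide_distrib[symmetric] by (rule drop) auto
      finally show ?thesis unfolding z_def .
    qed
    show "\<bar>P2 k ?x - P2 k x\<bar> \<le> 8 * c\<^sup>2 / s ^ 5 * \<bar>v - x u\<bar>"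
    proof -
      have eq: "P2 k ?x - P2 k x = 2 * ((g ?x - g x) * F2 k ?x) + 2 * (g x * (F2 k ?x - F2 k x))
          + (F1 k ?x - F1 k x) * (F1 k ?x + F1 k x)"
        unfolding P2_def by (simp add: algebra_simps power2_eq_square)
      have h1: "\<bar>2 * ((g ?x - g x) * F2 k ?x)\<bar> \<le> 2 * ((c / s ^ 3 * \<bar>z\<bar>) * (c / s ^ 4))"
        using prod[OF gz A2[OF k], of ?x] by (simp add: abs_mult)
      have h2: "\<bar>2 * (g x * (F2 k ?x - F2 k x))\<bar> \<le> 2 * (2 * c * (c / s ^ 5 * \<bar>z\<bar>))"
        using prod[OF gb F2z, of x] by (simp add: abs_mult)
      have h3: "\<bar>(F1 k ?x - F1 k x) * (F1 k ?x + F1 k x)\<bar> \<le> (c / s ^ 4 * \<bar>z\<bar>) * (c / s ^ 3 + c / s ^ 3)"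
        by (intro prod F1z add A1 k)
      have "\<bar>P2 k ?x - P2 k x\<bar> \<le> 2 * ((c / s ^ 3 * \<bar>z\<bar>) * (c / s ^ 4)) + 2 * (2 * c * (c / s ^ 5 * \<bar>z\<bar>))
          + (c / s ^ 4 * \<bar>z\<bar>) * (c / s ^ 3 + c / s ^ 3)"
        unfolding eq by (rule add[OF add[OF h1 h2] h3])
      also have "\<dots> = 4 * c\<^sup>2 / s ^ 7 * \<bar>z\<bar> + 4 * c\<^sup>2 / s ^ 5 * \<bar>z\<bar>"
        using s0 by (simp add: field_simps eval_nat_numeral)
      also have "\<dots> \<le> 4 * c\<^sup>2 / s ^ 5 * \<bar>z\<bar> + 4 * c\<^sup>2 / s ^ 5 * \<bar>z\<bar>" by (intro add_right_mono drop) auto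
      also have "\<dots> = 8 * c\<^sup>2 / s ^ 5 * \<bar>z\<bar>" by simp
      finally show ?thesis unfolding z_def .
    qed
  qed
qed

lemma norm_trace_depends: "depends_on (entries p n) (norm_trace r p n)"
proof -
  have sk: "skew_block p n x a b = skew_block p n (zero_outside (entries p n) x) a b" if "a < p + n" "b < p + n" for x a b
    using that by (auto simp: skew_block_def zero_outside_def entries_def)
  have "Matrix.mat (p + n) (p + n) (\<lambda>(i, j). (if i = j then r else 0) + skew_block p n x i j)
      = Matrix.mat (p + n) (p + n) (\<lambda>(i, j). (if i = j then r else 0) + skew_block p n (zero_outside (entries p n) x) i j)" for x
  proof (rule cong_mat)
    fix i j assume "i < p + n" "j < p + n"
    from sk[OF this, of x] show "(case (i, j) of (i, j) \<Rightarrow> (if i = j then r else 0) + skew_block p n x i j)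
      = (case (i, j) of (i, j) \<Rightarrow> (if i = j then r else 0) + skew_block p n (zero_outside (entries p n) x) i j)"
      by (simp only: prod.case)
  qed auto
  hence "block_resolvent r p n x = block_resolvent r p n (zero_outside (entries p n) x)" for x
    unfolding block_resolvent_def shift_inverse_def[abs_def] by (simp only:)
  hence "norm_trace r p n x = norm_trace r p n (zero_outside (entries p n) x)" for x
    unfolding norm_trace_def by (simp only:)
  thus ?thesis unfolding depends_on_def by (intro allI)
qed

section \<open>The self-consistent equation for random signs\<close>

text \<open>The expectation over independent fair signs. A function of the listed entries only does not see the
  starting value \<open>0\<close>.\<close>

definition mean_signs :: "'k list \<Rightarrow> (('k \<Rightarrow> real) \<Rightarrow> real) \<Rightarrow> real" where
  "mean_signs ks F = foldr sign_avg ks F (\<lambda>_. 0)"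

lemma foldr_sign_avg_add: "foldr sign_avg ks (\<lambda>x. F x + G x) = (\<lambda>x. foldr sign_avg ks F x + foldr sign_avg ks G x)"
  by (induction ks) (auto simp: sign_avg_def fun_eq_iff field_simps)

lemma foldr_sign_avg_scale: "foldr sign_avg ks (\<lambda>x. c * F x) = (\<lambda>x. c * foldr sign_avg ks F x)"
  by (induction ks) (auto simp: sign_avg_def fun_eq_iff field_simps)

lemma foldr_sign_avg_const: "foldr sign_avg ks (\<lambda>x. c) = (\<lambda>x. c)"
  by (induction ks) (auto simp: sign_avg_def fun_eq_iff)

lemma foldr_sign_avg_mono: "(\<And>x. F x \<le> G x) \<Longrightarrow> foldr sign_avg ks F x \<le> foldr sign_avg ks G x"
  by (induction ks arbitrary: x) (auto simp: sign_avg_def intro!: divide_right_mono add_mono)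

lemma mean_signs_add: "mean_signs ks (\<lambda>x. F x + G x) = mean_signs ks F + mean_signs ks G"
  by (simp add: mean_signs_def foldr_sign_avg_add)

lemma mean_signs_scale: "mean_signs ks (\<lambda>x. c * F x) = c * mean_signs ks F"
  by (simp add: mean_signs_def foldr_sign_avg_scale)

lemma mean_signs_const: "mean_signs ks (\<lambda>x. c) = c"
  by (simp add: mean_signs_def foldr_sign_avg_const)

lemma mean_signs_mono: "(\<And>x. F x \<le> G x) \<Longrightarrow> mean_signs ks F \<le> mean_signs ks G"
  unfolding mean_signs_def by (rule foldr_sign_avg_mono)

lemma mean_signs_sum: "mean_signs ks (\<lambda>x. \<Sum>i\<in>A. F i x) = (\<Sum>i\<in>A. mean_signs ks (F i))"
  by (induction A rule: infinite_finite_induct) (simp_all add: mean_signs_add mean_signs_const)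

lemma sign_avg_commute: "sign_avg k (sign_avg u F) = sign_avg u (sign_avg k F)"
proof (cases "k = u")
  case False
  thus ?thesis by (simp add: sign_avg_def fun_eq_iff fun_upd_twist[OF False] field_simps)
qed simp

lemma sign_avg_idem: "sign_avg k (sign_avg k F) = sign_avg k F"
  by (simp add: sign_avg_def fun_eq_iff)

lemma foldr_sign_avg_commute: "foldr sign_avg ks (sign_avg k F) = sign_avg k (foldr sign_avg ks F)"
  by (induction ks) (simp_all add: sign_avg_commute)

lemma mean_signs_sign_avg:
  assumes "k \<in> set ks" shows "mean_signs ks (sign_avg k F) = mean_signs ks F"
proof -
  have "sign_avg k (foldr sign_avg ks F) = foldr sign_avg ks F"
    using assms
  proof (induction ks)
    case (Cons u us)
    thus ?case by (cases "k = u") (simp_all add: sign_avg_idem sign_avg_commute[of k u])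
  qed simp
  thus ?thesis unfolding mean_signs_def foldr_sign_avg_commute by simp
qed

lemma sum_entries_index:
  "(\<Sum>k\<in>entries p n. f (row_index k) (col_index p k)) = (\<Sum>i<p. \<Sum>j\<in>{p..<p + n}. f i j)"
  unfolding sum.cartesian_product
  by (rule sum.reindex_bij_witness[where i = "\<lambda>(i, j). (int i + 1, int (j - p) + 1)"
        and j = "\<lambda>k. (row_index k, col_index p k)"])
     (auto simp: entries_def row_index_def col_index_def)

definition upper_trace :: "real \<Rightarrow> nat \<Rightarrow> nat \<Rightarrow> (int \<times> int \<Rightarrow> real) \<Rightarrow> real" where
  "upper_trace r p n x = (\<Sum>i<p. block_resolvent r p n x i i) / real n"

definition lower_trace :: "real \<Rightarrow> nat \<Rightarrow> nat \<Rightarrow> (int \<times> int \<Rightarrow> real) \<Rightarrow> real" where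
  "lower_trace r p n x = (\<Sum>j\<in>{p..<p + n}. block_resolvent r p n x j j) / real n"

text \<open>The normalised inner product of the upper right blocks of \<open>K\<close> and \<open>G\<close>.\<close>

definition coupling :: "real \<Rightarrow> nat \<Rightarrow> nat \<Rightarrow> (int \<times> int \<Rightarrow> real) \<Rightarrow> real" where
  "coupling r p n x = (\<Sum>k\<in>entries p n. x k * block_resolvent r p n x (row_index k) (col_index p k)) / (real n * sqrt (real n))"

lemma sum_split_blocks: "(\<Sum>c<p + n. f c) = (\<Sum>c<p. f c) + (\<Sum>c\<in>{p..<p + n}. (f c :: real))" for p n :: nat
  by (simp add: sum.atLeastLessThan_concat flip: atLeast0LessThan)

lemma norm_trace_split: "norm_trace r p n x = upper_trace r p n x + lower_trace r p n x"
  unfolding norm_trace_def upper_trace_def lower_trace_def sum_split_blocks by (simp add: add_divide_distrib)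

lemma coupling_blocks:
  assumes "0 < n"
  shows "coupling r p n x = (\<Sum>i<p. \<Sum>j\<in>{p..<p + n}. skew_block p n x i j * block_resolvent r p n x i j) / real n"
proof -
  have eq: "skew_block p n x (row_index k) (col_index p k) = x k / sqrt (real n)" if "k \<in> entries p n" for k
    using index_bounds[OF that] entry_index_iff[OF that, of "col_index p k" "row_index k"]
    by (simp add: skew_block_def del: of_nat_diff)
  have "(\<Sum>k\<in>entries p n. x k * block_resolvent r p n x (row_index k) (col_index p k)) / sqrt (real n)
     = (\<Sum>k\<in>entries p n. skew_block p n x (row_index k) (col_index p k) * block_resolvent r p n x (row_index k) (col_index p k))"
    unfolding sum_divide_distrib by (intro sum.cong refl) (simp add: eq)
  thus ?thesis unfolding coupling_def sum_entries_index[symmetric] using assms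
    by (simp add: field_simps)
qed

text \<open>The traces over the upper rows of \<open>G (r + K) = 1\<close> and over the lower rows of \<open>(r + K) G = 1\<close>. Both
  involve the same off-diagonal block, hence the same coupling term.\<close>

lemma trace_equations:
  assumes r: "0 < r" and n: "0 < n"
  shows "r * upper_trace r p n x = real p / real n + coupling r p n x"
    and "r * lower_trace r p n x = 1 + coupling r p n x"
proof -
  let ?G = "block_resolvent r p n x" let ?K = "skew_block p n x"
  let ?S = "\<Sum>i<p. \<Sum>j\<in>{p..<p + n}. ?K i j * ?G i j"
  have up: "r * ?G i i = 1 + (\<Sum>j\<in>{p..<p + n}. ?K i j * ?G i j)" if i: "i < p" for i
  proof -
    have "1 = (\<Sum>c<p + n. ?G i c * ((if c = i then r else 0) + ?K c i))"
      using shift_inverse_left[OF skew_on_block r, where a = i and b = i] i by (simp add: block_resolvent_def)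
    also have "\<dots> = (\<Sum>c<p + n. if c = i then r * ?G i i else 0) + (\<Sum>c<p + n. ?G i c * ?K c i)"
      unfolding sum.distrib[symmetric] by (intro sum.cong refl) (simp add: algebra_simps)
    also have "(\<Sum>c<p + n. ?G i c * ?K c i) = (\<Sum>c\<in>{p..<p + n}. ?G i c * ?K c i)"
      unfolding sum_split_blocks using i by (simp add: skew_block_def)
    also have "\<dots> = - (\<Sum>j\<in>{p..<p + n}. ?K i j * ?G i j)"
      unfolding sum_negf[symmetric] by (intro sum.cong refl) (use i in \<open>simp add: skew_block_def\<close>)
    finally show ?thesis using i by simp
  qed
  have low: "r * ?G j j = 1 + (\<Sum>i<p. ?K i j * ?G i j)" if j: "j \<in> {p..<p + n}" for j
  proof -
    have "1 = (\<Sum>c<p + n. ((if j = c then r else 0) + ?K j c) * ?G c j)"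
      using shift_inverse_right[OF skew_on_block r, where a = j and b = j] j by (simp add: block_resolvent_def)
    also have "\<dots> = (\<Sum>c<p + n. if j = c then r * ?G j j else 0) + (\<Sum>c<p + n. ?K j c * ?G c j)"
      unfolding sum.distrib[symmetric] by (intro sum.cong refl) (simp add: algebra_simps)
    also have "(\<Sum>c<p + n. ?K j c * ?G c j) = (\<Sum>c<p. ?K j c * ?G c j)"
      unfolding sum_split_blocks using j by (simp add: skew_block_def)
    also have "\<dots> = - (\<Sum>i<p. ?K i j * ?G i j)"
      unfolding sum_negf[symmetric] by (intro sum.cong refl) (use j in \<open>simp add: skew_block_def\<close>)
    finally show ?thesis using j by simp
  qed
  have "r * (\<Sum>i<p. ?G i i) = real p + ?S"
    unfolding sum_distrib_left using up by (simp add: sum.distrib)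
  thus "r * upper_trace r p n x = real p / real n + coupling r p n x"
    unfolding upper_trace_def coupling_blocks[OF n] by (simp flip: add_divide_distrib)
  have "r * (\<Sum>j\<in>{p..<p + n}. ?G j j) = real n + (\<Sum>j\<in>{p..<p + n}. \<Sum>i<p. ?K i j * ?G i j)"
    unfolding sum_distrib_left using low by (simp add: sum.distrib)
  also have "(\<Sum>j\<in>{p..<p + n}. \<Sum>i<p. ?K i j * ?G i j) = ?S" by (rule sum.swap)
  finally show "r * lower_trace r p n x = 1 + coupling r p n x"
    unfolding lower_trace_def coupling_blocks[OF n] using n by (simp add: field_simps)
qed

lemma lower_trace_eq:
  assumes "0 < r" "0 < n"
  shows "lower_trace r p n x = upper_trace r p n x + (1 - real p / real n) / r"
proof -
  have "r * lower_trace r p n x = r * (upper_trace r p n x + (1 - real p / real n) / r)"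
    using trace_equations[OF assms, of p x] assms(1) by (simp add: distrib_left)
  thus ?thesis using assms(1) by simp
qed

text \<open>By integration by parts the coupling is close to \<open>- g\<^sub>1 g\<^sub>2\<close> for the two normalised block traces, so
  this quantity is nearly zero. The trace equations turn it into a quadratic polynomial in \<open>g\<^sub>1\<close>.\<close>

definition self_consistency :: "real \<Rightarrow> nat \<Rightarrow> nat \<Rightarrow> (int \<times> int \<Rightarrow> real) \<Rightarrow> real" where
  "self_consistency r p n x = upper_trace r p n x * lower_trace r p n x + coupling r p n x"

lemma trace_bounds:
  assumes "0 < r" "0 < n"
  shows "\<bar>upper_trace r p n x\<bar> \<le> real p / real n / r" "\<bar>lower_trace r p n x\<bar> \<le> 1 / r"
proof -
  have "\<bar>\<Sum>i<p. block_resolvent r p n x i i\<bar> \<le> (\<Sum>i<p. 1 / r)"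
    by (rule order.trans[OF sum_abs]) (intro sum_mono block_resolvent_entry_bound; use assms in auto)
  hence "\<bar>\<Sum>i<p. block_resolvent r p n x i i\<bar> / real n \<le> (real p * (1 / r)) / real n"
    by (intro divide_right_mono) auto
  thus "\<bar>upper_trace r p n x\<bar> \<le> real p / real n / r" by (simp add: upper_trace_def field_simps)
  have "\<bar>\<Sum>i\<in>{p..<p + n}. block_resolvent r p n x i i\<bar> \<le> (\<Sum>i\<in>{p..<p + n}. 1 / r)"
    by (rule order.trans[OF sum_abs]) (intro sum_mono block_resolvent_entry_bound; use assms in auto)
  hence "\<bar>\<Sum>i\<in>{p..<p + n}. block_resolvent r p n x i i\<bar> / real n \<le> (real n * (1 / r)) / real n"
    by (intro divide_right_mono) auto
  thus "\<bar>lower_trace r p n x\<bar> \<le> 1 / r" using assms by (simp add: lower_trace_def)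
qed

lemma abs_mult_mono: "\<bar>X\<bar> \<le> a \<Longrightarrow> \<bar>Y\<bar> \<le> b \<Longrightarrow> \<bar>X * Y\<bar> \<le> a * (b::real)"
  unfolding abs_mult by (intro mult_mono) auto

lemma abs_add_mono: "\<bar>X\<bar> \<le> a \<Longrightarrow> \<bar>Y\<bar> \<le> b \<Longrightarrow> \<bar>X + Y\<bar> \<le> a + (b::real)"
  by linarith

text \<open>The discrete integration by parts in scalar form: \<open>g\<close> and \<open>h\<close> are entries of the inverse before and
  after the sign flip, which moves each of them by \<open>O(e)\<close>, and \<open>e = 1 / \<surd>n\<close>.\<close>

lemma sign_difference_bound:
  fixes gaa gbb gab haa hbb hab Qg Qh e \<beta> q l :: real
  assumes e: "0 \<le> e" "e \<le> 1" and \<beta>: "0 \<le> \<beta>"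
    and gh: "hab - gab = - (2 * e) * (gaa * hbb - gab * hab)"
    and bd: "\<bar>gaa\<bar> \<le> \<beta>" "\<bar>gbb\<bar> \<le> \<beta>" "\<bar>gab\<bar> \<le> \<beta>" "\<bar>hbb\<bar> \<le> \<beta>" "\<bar>hab\<bar> \<le> \<beta>"
    and d: "\<bar>haa - gaa\<bar> \<le> 4 * \<beta>\<^sup>2 * e" "\<bar>hbb - gbb\<bar> \<le> 4 * \<beta>\<^sup>2 * e" "\<bar>hab - gab\<bar> \<le> 4 * \<beta>\<^sup>2 * e"
    and Q: "\<bar>Qh\<bar> \<le> q" "\<bar>Qh - Qg\<bar> \<le> l * e\<^sup>2"
  shows "\<bar>(hab * Qh - gab * Qg) / 2 + e * (((haa * hbb - hab\<^sup>2) * Qh + (gaa * gbb - gab\<^sup>2) * Qg) / 2)\<bar>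
     \<le> (8 * \<beta> ^ 3 * q + \<beta>\<^sup>2 * l + \<beta> * l) * e\<^sup>2"
proof -
  have l: "0 \<le> l * e\<^sup>2" using Q(2) by linarith
  have "(hab * Qh - gab * Qg) / 2 = ((hab - gab) * Qh + gab * (Qh - Qg)) / 2"
    by (simp add: algebra_simps)
  also have "\<dots> = - e * (gaa * hbb - gab * hab) * Qh + gab * (Qh - Qg) / 2"
    unfolding gh by (simp add: field_simps)
  finally have eq: "(hab * Qh - gab * Qg) / 2 + e * (((haa * hbb - hab\<^sup>2) * Qh + (gaa * gbb - gab\<^sup>2) * Qg) / 2)
     = (e / 2) * ((haa - gaa) * (hbb * Qh) + (gab - hab) * (hab * Qh) + (gbb - hbb) * (gaa * Qh) + (hab - gab) * (gab * Qh)
         + (gaa * gbb - gab * gab) * (Qg - Qh)) + gab / 2 * (Qh - Qg)"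
    by (simp add: field_simps power2_eq_square)
  have d': "\<bar>gab - hab\<bar> \<le> 4 * \<beta>\<^sup>2 * e" "\<bar>gbb - hbb\<bar> \<le> 4 * \<beta>\<^sup>2 * e" "\<bar>Qg - Qh\<bar> \<le> l * e\<^sup>2"
    using d Q by (simp_all add: abs_minus_commute)
  have ww: "\<bar>gaa * gbb - gab * gab\<bar> \<le> \<beta> * \<beta> + \<beta> * \<beta>"
    by (rule order.trans[OF abs_triangle_ineq4 add_mono]; rule abs_mult_mono; fact bd)
  have "\<bar>(e / 2) * ((haa - gaa) * (hbb * Qh) + (gab - hab) * (hab * Qh) + (gbb - hbb) * (gaa * Qh) + (hab - gab) * (gab * Qh)
         + (gaa * gbb - gab * gab) * (Qg - Qh)) + gab / 2 * (Qh - Qg)\<bar>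
     \<le> (e / 2) * (4 * \<beta>\<^sup>2 * e * (\<beta> * q) + 4 * \<beta>\<^sup>2 * e * (\<beta> * q) + 4 * \<beta>\<^sup>2 * e * (\<beta> * q) + 4 * \<beta>\<^sup>2 * e * (\<beta> * q)
         + (\<beta> * \<beta> + \<beta> * \<beta>) * (l * e\<^sup>2)) + \<beta> / 2 * (l * e\<^sup>2)"
    by (intro abs_add_mono abs_mult_mono d d' bd Q ww) (use e bd in auto)
  also have "\<dots> = 8 * \<beta> ^ 3 * q * e\<^sup>2 + e * (\<beta>\<^sup>2 * (l * e\<^sup>2)) + \<beta> / 2 * (l * e\<^sup>2)"
    by (simp add: field_simps power2_eq_square power3_eq_cube)
  also have "\<dots> \<le> 8 * \<beta> ^ 3 * q * e\<^sup>2 + 1 * (\<beta>\<^sup>2 * (l * e\<^sup>2)) + \<beta> * (l * e\<^sup>2)"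
    using e l \<beta> by (intro add_mono mult_right_mono order.refl) auto
  also have "\<dots> = (8 * \<beta> ^ 3 * q + \<beta>\<^sup>2 * l + \<beta> * l) * e\<^sup>2" by (simp add: algebra_simps)
  finally show ?thesis unfolding eq .
qed

text \<open>Averaging over the sign \<open>x k\<close> differentiates \<open>G\<^sub>a\<^sub>b\<close>, whose derivative at the entry \<open>(a, b)\<close> is
  \<open>- (G\<^sub>a\<^sub>a G\<^sub>b\<^sub>b - (G\<^sub>a\<^sub>b)\<^sup>2) / \<surd>n\<close>. The derivative of the other factor is of lower order, since that factor
  depends on traces only.\<close>

lemma sign_integration_by_parts:
  assumes r: "0 < r" and n: "0 < n" and Y: "real p / real n \<le> Y" and k: "k \<in> entries p n"
    and q: "q = Y / r\<^sup>2 + 2 * Y" and l: "l = 2 / r\<^sup>2 * (1 / r + Y / r + r)"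
  defines "a \<equiv> row_index k" and "b \<equiv> col_index p k"
  shows "\<bar>sign_avg k (\<lambda>x. x k * (block_resolvent r p n x a b * self_consistency r p n x)) x
      + 1 / sqrt (real n) * sign_avg k (\<lambda>x. (block_resolvent r p n x a a * block_resolvent r p n x b b - (block_resolvent r p n x a b)\<^sup>2)
            * self_consistency r p n x) x\<bar>
     \<le> (8 * (1 / r) ^ 3 * q + (1 / r)\<^sup>2 * l + 1 / r * l) / real n"
    and "\<bar>self_consistency r p n x\<bar> \<le> q"
proof -
  have Y0: "0 \<le> Y" using Y by (rule order.trans[rotated]) simp
  define \<beta> where "\<beta> = 1 / r"
  have \<beta>: "0 < \<beta>" using r by (simp add: \<beta>_def)
  define e where "e = 1 / sqrt (real n)"
  have e: "0 \<le> e" "e \<le> 1" "e\<^sup>2 = 1 / real n" using n by (simp_all add: e_def power_divide)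
  have ub: "\<bar>upper_trace r p n x\<bar> \<le> Y * \<beta>" "\<bar>lower_trace r p n x\<bar> \<le> \<beta>" for x
    using trace_bounds[OF r n, of p x] divide_right_mono[OF Y, of r] r by (auto simp: \<beta>_def)
  have sc: "self_consistency r p n x = upper_trace r p n x * lower_trace r p n x + (r * upper_trace r p n x - real p / real n)" for x
    using trace_equations(1)[OF r n, of p x] by (simp add: self_consistency_def)
  have Qb: "\<bar>self_consistency r p n x\<bar> \<le> q" for x
  proof -
    have "\<bar>r * upper_trace r p n x\<bar> \<le> r * (Y * \<beta>)" by (intro abs_mult_mono ub) (use r in auto)
    hence "\<bar>r * upper_trace r p n x - real p / real n\<bar> \<le> r * (Y * \<beta>) + Y"
      using Y by (intro order.trans[OF abs_triangle_ineq4 add_mono]) auto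
    hence "\<bar>self_consistency r p n x\<bar> \<le> (Y * \<beta>) * \<beta> + (r * (Y * \<beta>) + Y)"
      unfolding sc by (intro abs_add_mono abs_mult_mono ub)
    also have "\<dots> = q" using r by (simp add: q \<beta>_def power2_eq_square)
    finally show ?thesis .
  qed
  show "\<bar>self_consistency r p n x\<bar> \<le> q" by (rule Qb)
  let ?N = "p + n"
  define xm xp where "xm = x(k := - 1)" and "xp = xm(k := 1)"
  have xp: "x(k := 1) = xp" by (simp add: xm_def xp_def)
  define G H where "G = block_resolvent r p n xm" and "H = block_resolvent r p n xp"
  have ab: "a < ?N" "b < ?N" using index_bounds[OF k] by (auto simp: a_def b_def)
  have pert: "H c d = G c d - (2 * e) * (G c a * H b d - G c b * H a d)" if "c < ?N" "d < ?N" for c d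
    using block_resolvent_update[OF r k that, of xm 1]
    by (simp add: G_def H_def xp_def a_def b_def e_def xm_def)
  have ebd: "\<bar>block_resolvent r p n z c d\<bar> \<le> \<beta>" if "c < ?N" "d < ?N" for z c d
    using block_resolvent_entry_bound[OF r that] by (simp add: \<beta>_def)
  have pbd: "\<bar>mprod ?N (block_resolvent r p n z) (block_resolvent r p n z') c d\<bar> \<le> \<beta>\<^sup>2" if "c < ?N" "d < ?N" for z z' c d
    using block_resolvent_product_bound[OF r that] by (simp add: \<beta>_def)
  interpret P: rank_two_perturbation ?N a b G H "2 * e" \<beta>
  proof unfold_locales
    show "H c d = G c d - 2 * e * (G c a * H b d - G c b * H a d)" if "c < ?N" "d < ?N" for c d
      using pert[OF that] .
    show "0 \<le> \<beta>" using \<beta> by simp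
  qed (unfold G_def H_def, (fact ab ebd pbd)+)
  have dtrace: "\<bar>norm_trace r p n xp - norm_trace r p n xm\<bar> \<le> 4 * \<beta>\<^sup>2 * e\<^sup>2"
  proof -
    have "\<bar>norm_trace r p n xp - norm_trace r p n xm\<bar> = \<bar>(\<Sum>c<?N. H c c) - (\<Sum>c<?N. G c c)\<bar> / real n"
      by (simp add: norm_trace_def G_def H_def flip: diff_divide_distrib)
    also have "\<dots> \<le> (2 * \<beta>\<^sup>2 * \<bar>2 * e\<bar>) / real n" by (intro divide_right_mono P.trace_change_1) simp
    also have "\<dots> = (4 * \<beta>\<^sup>2 * e\<^sup>2) * e" using e by (simp add: mult_ac)
    also have "\<dots> \<le> (4 * \<beta>\<^sup>2 * e\<^sup>2) * 1" using e by (intro mult_left_mono) auto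
    finally show ?thesis by simp
  qed
  have nt: "norm_trace r p n z = 2 * upper_trace r p n z + (1 - real p / real n) / r" for z
    unfolding norm_trace_split lower_trace_eq[OF r n] by simp
  have du: "\<bar>upper_trace r p n xp - upper_trace r p n xm\<bar> \<le> 2 * \<beta>\<^sup>2 * e\<^sup>2"
    using dtrace unfolding nt by linarith
  have dQ: "\<bar>self_consistency r p n xp - self_consistency r p n xm\<bar> \<le> l * e\<^sup>2"
  proof -
    have "self_consistency r p n xp - self_consistency r p n xm
      = (upper_trace r p n xp - upper_trace r p n xm) * (lower_trace r p n xp + upper_trace r p n xm + r)"
      unfolding sc lower_trace_eq[OF r n] by (simp add: algebra_simps)
    also have "\<bar>\<dots>\<bar> \<le> (2 * \<beta>\<^sup>2 * e\<^sup>2) * (\<beta> + Y * \<beta> + r)"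
      by (intro abs_mult_mono abs_add_mono du ub) (use r in auto)
    also have "\<dots> = l * e\<^sup>2" by (simp add: l \<beta>_def power_divide)
    finally show ?thesis .
  qed
  have ch: "\<bar>H c d - G c d\<bar> \<le> 4 * \<beta>\<^sup>2 * e" if "c < ?N" "d < ?N" for c d
    using P.entry_change[OF that] e by simp
  have "\<bar>(H a b * self_consistency r p n xp - G a b * self_consistency r p n xm) / 2
     + e * (((H a a * H b b - (H a b)\<^sup>2) * self_consistency r p n xp + (G a a * G b b - (G a b)\<^sup>2) * self_consistency r p n xm) / 2)\<bar>
     \<le> (8 * \<beta> ^ 3 * q + \<beta>\<^sup>2 * l + \<beta> * l) * e\<^sup>2"
  proof (rule sign_difference_bound)
    show "H a b - G a b = - (2 * e) * (G a a * H b b - G a b * H a b)"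
      using pert[OF ab] by simp
  qed (use e \<beta> ab ebd ch Qb dQ in \<open>auto simp: G_def H_def\<close>)
  thus "\<bar>sign_avg k (\<lambda>x. x k * (block_resolvent r p n x a b * self_consistency r p n x)) x
      + 1 / sqrt (real n) * sign_avg k (\<lambda>x. (block_resolvent r p n x a a * block_resolvent r p n x b b - (block_resolvent r p n x a b)\<^sup>2)
            * self_consistency r p n x) x\<bar>
     \<le> (8 * (1 / r) ^ 3 * q + (1 / r)\<^sup>2 * l + 1 / r * l) / real n"
    unfolding sign_avg_def xp xm_def[symmetric] G_def H_def e_def[symmetric] \<beta>_def[symmetric]
    using e(3) by (simp add: xm_def xp_def)
qed

text \<open>Expand one factor of the square and integrate by parts. The products \<open>G\<^sub>a\<^sub>a G\<^sub>b\<^sub>b\<close> sum up to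
  \<open>n\<^sup>2 g\<^sub>1 g\<^sub>2\<close> and cancel the other term of that factor. The squares \<open>(G\<^sub>a\<^sub>b)\<^sup>2\<close> sum to at most
  \<open>p / r\<^sup>2\<close> by the row bounds, which is negligible after division by \<open>n\<^sup>2\<close>.\<close>

lemma mean_signs_self_consistency:
  assumes r: "0 < r" and n: "0 < n" and Y: "real p / real n \<le> Y"
    and q: "q = Y / r\<^sup>2 + 2 * Y" and l: "l = 2 / r\<^sup>2 * (1 / r + Y / r + r)"
  shows "mean_signs (entry_list p n) (\<lambda>x. (self_consistency r p n x)\<^sup>2)
     \<le> (Y * (8 * (1 / r) ^ 3 * q + (1 / r)\<^sup>2 * l + 1 / r * l) + q * Y / r\<^sup>2) / sqrt (real n)"
proof -
  let ?E = "mean_signs (entry_list p n)" let ?I = "entries p n"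
  let ?Q = "self_consistency r p n" let ?G = "block_resolvent r p n"
  let ?g1 = "upper_trace r p n" and ?g2 = "lower_trace r p n"
  have Y0: "0 \<le> Y" using Y by (rule order.trans[rotated]) simp
  define s where "s = sqrt (real n)"
  have s: "0 < s" "1 \<le> s" and ss: "real n = s * s" using n by (simp_all add: s_def)
  define C where "C = 8 * (1 / r) ^ 3 * q + (1 / r)\<^sup>2 * l + 1 / r * l"
  have C0: "0 \<le> C" unfolding C_def q l using r Y0 by (intro add_nonneg_nonneg mult_nonneg_nonneg) auto
  define \<phi> where "\<phi> k x = (?G x (row_index k) (row_index k) * ?G x (col_index p k) (col_index p k)
     - (?G x (row_index k) (col_index p k))\<^sup>2) * ?Q x" for k x
  define h where "h k x = x k * (?G x (row_index k) (col_index p k) * ?Q x)" for k x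
  have Qsq: "(?Q x)\<^sup>2 = ?Q x * (?g1 x * ?g2 x) + (\<Sum>k\<in>?I. 1 / s ^ 3 * h k x)" for x
  proof -
    have "(\<Sum>k\<in>?I. 1 / s ^ 3 * h k x) = 1 / s ^ 3 * (\<Sum>k\<in>?I. x k * ?G x (row_index k) (col_index p k)) * ?Q x"
      unfolding h_def sum_distrib_left sum_distrib_right by (intro sum.cong refl) (simp add: mult_ac)
    also have "\<dots> = coupling r p n x * ?Q x"
      unfolding coupling_def s_def[symmetric] unfolding ss by (simp add: power3_eq_cube mult.assoc)
    finally show ?thesis by (simp add: power2_eq_square self_consistency_def algebra_simps)
  qed
  have step: "?E (h k) \<le> - (1 / s) * ?E (\<phi> k) + C / real n" if k: "k \<in> ?I" for k
  proof -
    have "?E (h k) = ?E (sign_avg k (h k))" using k by (simp add: mean_signs_sign_avg)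
    also have "\<dots> \<le> ?E (\<lambda>x. - (1 / s) * sign_avg k (\<phi> k) x + C / real n)"
    proof (rule mean_signs_mono)
      fix x
      have "\<bar>sign_avg k (h k) x + 1 / s * sign_avg k (\<phi> k) x\<bar> \<le> C / real n"
        unfolding h_def[abs_def] \<phi>_def[abs_def] C_def s_def
        by (rule sign_integration_by_parts(1)[OF r n Y k q l])
      thus "sign_avg k (h k) x \<le> - (1 / s) * sign_avg k (\<phi> k) x + C / real n" by linarith
    qed
    also have "\<dots> = - (1 / s) * ?E (\<phi> k) + C / real n"
      unfolding mean_signs_add mean_signs_scale mean_signs_const using k by (simp add: mean_signs_sign_avg)
    finally show ?thesis .
  qed
  have rest: "?Q x * (?g1 x * ?g2 x) + (\<Sum>k\<in>?I. - (1 / s ^ 4) * \<phi> k x) \<le> q * Y / r\<^sup>2 / real n" for x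
  proof -
    let ?W = "\<Sum>i<p. \<Sum>j\<in>{p..<p + n}. (?G x i j)\<^sup>2"
    have "(\<Sum>k\<in>?I. \<phi> k x) = (\<Sum>i<p. \<Sum>j\<in>{p..<p + n}. (?G x i i * ?G x j j - (?G x i j)\<^sup>2) * ?Q x)"
      unfolding \<phi>_def by (rule sum_entries_index)
    also have "\<dots> = ((\<Sum>i<p. ?G x i i) * (\<Sum>j\<in>{p..<p + n}. ?G x j j) - ?W) * ?Q x"
    proof -
      have "(\<Sum>i<p. \<Sum>j\<in>{p..<p + n}. (A i * B j - V i j) * z)
          = ((\<Sum>i<p. A i) * (\<Sum>j\<in>{p..<p + n}. B j) - (\<Sum>i<p. \<Sum>j\<in>{p..<p + n}. V i j)) * z"
        for A B :: "nat \<Rightarrow> real" and V and z :: real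
      proof -
        have "(\<Sum>i<p. \<Sum>j\<in>{p..<p + n}. (A i * B j - V i j) * z)
            = (\<Sum>i<p. \<Sum>j\<in>{p..<p + n}. A i * B j - V i j) * z"
          by (simp only: sum_distrib_right)
        also have "\<dots> = ((\<Sum>i<p. \<Sum>j\<in>{p..<p + n}. A i * B j) - (\<Sum>i<p. \<Sum>j\<in>{p..<p + n}. V i j)) * z"
          by (simp only: sum_subtractf)
        finally show ?thesis by (simp only: sum_product)
      qed
      thus ?thesis .
    qed
    also have "\<dots> = (real n * real n * (?g1 x * ?g2 x) - ?W) * ?Q x"
      unfolding upper_trace_def lower_trace_def using n by simp
    finally have sum\<phi>: "(\<Sum>k\<in>?I. \<phi> k x) = (real n * real n * (?g1 x * ?g2 x) - ?W) * ?Q x" .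
    have "?Q x * (?g1 x * ?g2 x) + (\<Sum>k\<in>?I. - (1 / s ^ 4) * \<phi> k x)
       = ?Q x * (?g1 x * ?g2 x) - 1 / s ^ 4 * ((real n * real n * (?g1 x * ?g2 x) - ?W) * ?Q x)"
      unfolding sum_distrib_left[symmetric] sum\<phi> by simp
    also have "\<dots> = ?Q x * (?W / (real n * real n))"
      unfolding ss using s by (simp add: field_simps eval_nat_numeral)
    also have "\<dots> \<le> q * (real p * (1 / r\<^sup>2) / (real n * real n))"
    proof (rule mult_mono)
      show "?Q x \<le> q"
      proof (cases "?I = {}")
        case False
        then obtain k where "k \<in> ?I" by blast
        from sign_integration_by_parts(2)[OF r n Y this q l, of x] show ?thesis by linarith
      next
        case True
        have "p = 0"
        proof (rule ccontr)
          assume "p \<noteq> 0"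
          hence "(1, 1) \<in> ?I" using n by (simp add: entries_def)
          thus False using True by simp
        qed
        hence "?Q x = 0" by (simp add: self_consistency_def upper_trace_def coupling_def entries_def)
        thus ?thesis using Y0 by (simp add: q)
      qed
      show "?W / (real n * real n) \<le> real p * (1 / r\<^sup>2) / (real n * real n)"
      proof (rule divide_right_mono)
        have "?W \<le> (\<Sum>i<p. 1 / r\<^sup>2)"
        proof (rule sum_mono)
          fix i assume "i \<in> {..<p}"
          hence "(\<Sum>j<p + n. (?G x i j)\<^sup>2) \<le> 1 / r\<^sup>2"
            unfolding block_resolvent_def by (intro shift_inverse_row_norm[OF skew_on_block r]) auto
          moreover have "(\<Sum>j\<in>{p..<p + n}. (?G x i j)\<^sup>2) \<le> (\<Sum>j<p + n. (?G x i j)\<^sup>2)"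
            by (rule sum_mono2) auto
          ultimately show "(\<Sum>j\<in>{p..<p + n}. (?G x i j)\<^sup>2) \<le> 1 / r\<^sup>2" by linarith
        qed
        thus "?W \<le> real p * (1 / r\<^sup>2)" by simp
      qed simp
      show "0 \<le> q" using q Y0 by simp
      show "0 \<le> ?W / (real n * real n)" by (intro divide_nonneg_nonneg sum_nonneg) auto
    qed
    also have "\<dots> = q / r\<^sup>2 / real n * (real p / real n)" by simp
    also have "\<dots> \<le> q / r\<^sup>2 / real n * Y" using Y q Y0 by (intro mult_left_mono) auto
    also have "\<dots> = q * Y / r\<^sup>2 / real n" by simp
    finally show ?thesis .
  qed
  have "?E (\<lambda>x. (?Q x)\<^sup>2) = ?E (\<lambda>x. ?Q x * (?g1 x * ?g2 x)) + (\<Sum>k\<in>?I. 1 / s ^ 3 * ?E (h k))"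
    unfolding Qsq mean_signs_add mean_signs_sum mean_signs_scale ..
  also have "\<dots> \<le> ?E (\<lambda>x. ?Q x * (?g1 x * ?g2 x)) + (\<Sum>k\<in>?I. 1 / s ^ 3 * (- (1 / s) * ?E (\<phi> k) + C / real n))"
    by (intro add_left_mono sum_mono mult_left_mono step) (use s in auto)
  also have "\<dots> = ?E (\<lambda>x. ?Q x * (?g1 x * ?g2 x) + (\<Sum>k\<in>?I. - (1 / s ^ 4) * \<phi> k x)) + real p / real n * C / s"
  proof -
    have "(\<Sum>k\<in>?I. 1 / s ^ 3 * (- (1 / s) * ?E (\<phi> k) + C / real n))
        = (\<Sum>k\<in>?I. - (1 / s ^ 4) * ?E (\<phi> k)) + (\<Sum>k\<in>?I. 1 / s ^ 3 * (C / real n))"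
      unfolding sum.distrib[symmetric] using s
      by (intro sum.cong refl) (simp add: field_simps eval_nat_numeral)
    moreover have "(\<Sum>k\<in>?I. 1 / s ^ 3 * (C / real n)) = real p / real n * C / s"
      using s n by (simp add: card_entries ss field_simps eval_nat_numeral)
    ultimately show ?thesis unfolding mean_signs_add mean_signs_sum mean_signs_scale by simp
  qed
  also have "\<dots> \<le> q * Y / r\<^sup>2 / real n + Y * C / s"
  proof (rule add_mono)
    show "?E (\<lambda>x. ?Q x * (?g1 x * ?g2 x) + (\<Sum>k\<in>?I. - (1 / s ^ 4) * \<phi> k x)) \<le> q * Y / r\<^sup>2 / real n"
      using mean_signs_mono[OF rest, of "entry_list p n"] by (simp add: mean_signs_const)
    show "real p / real n * C / s \<le> Y * C / s"
      using Y C0 s by (intro divide_right_mono mult_right_mono) auto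
  qed
  also have "q * Y / r\<^sup>2 / real n \<le> q * Y / r\<^sup>2 / s"
  proof (rule divide_left_mono)
    have "s * 1 \<le> s * s" using s by (intro mult_left_mono) auto
    thus "s \<le> real n" by (simp add: ss)
  qed (use s n q Y0 in auto)
  finally show ?thesis unfolding C_def[symmetric] s_def[symmetric] by (simp add: add_divide_distrib)
qed

section \<open>Eigenvalues of the Gram matrix\<close>

text \<open>Over the complex numbers the characteristic polynomial factors, and a root with eigenvector \<open>v\<close> equals
  \<open>c |A\<^sup>T v|\<^sup>2 / |v|\<^sup>2\<close>, which is real and nonnegative.\<close>

lemma gram_char_poly_splits:
  fixes A :: "real Matrix.mat"
  assumes A: "A \<in> carrier_mat p n" and c: "0 \<le> c"
  shows "\<exists>es. char_poly (c \<cdot>\<^sub>m (A * transpose_mat A)) = (\<Prod>e\<leftarrow>es. [:- e, 1:]) \<and> length es = p \<and> (\<forall>e\<in>set es. 0 \<le> e)"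
proof -
  define S where "S = c \<cdot>\<^sub>m (A * transpose_mat A)"
  define SC where "SC = map_mat complex_of_real S"
  have S: "S \<in> carrier_mat p p" using A by (auto simp: S_def)
  have SC: "SC \<in> carrier_mat p p" using S by (simp add: SC_def)
  have entry: "S $$ (i, l) = c * (\<Sum>j<n. A $$ (i, j) * A $$ (l, j))" if "i < p" "l < p" for i l
    using that A by (simp add: S_def scalar_prod_def atLeast0LessThan)
  obtain as where as: "char_poly SC = (\<Prod>a\<leftarrow>as. [:- a, 1:])" "length as = p"
    using char_poly_factorized[OF SC] by blast
  have real: "\<exists>e\<ge>0. a = complex_of_real e" if "a \<in> set as" for a
  proof -
    have "poly (char_poly SC) a = 0"
      unfolding as(1) poly_prod_list prod_list_zero_iff using that by (auto intro!: image_eqI[of _ _ a])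
    then obtain v where "eigenvector SC v a"
      using eigenvalue_root_char_poly[OF SC] unfolding eigenvalue_def by blast
    hence v: "v \<in> carrier_vec p" "v \<noteq> 0\<^sub>v p" "SC *\<^sub>v v = a \<cdot>\<^sub>v v"
      using SC by (auto simp: eigenvector_def)
    let ?v = "vec_index v"
    define w where "w j = (\<Sum>i<p. complex_of_real (A $$ (i, j)) * ?v i)" for j
    have row: "(\<Sum>l<p. complex_of_real (S $$ (i, l)) * ?v l) = a * ?v i" if "i < p" for i
    proof -
      have "vec_index (SC *\<^sub>v v) i = a * ?v i" using v that by simp
      thus ?thesis using v(1) S that by (simp add: SC_def scalar_prod_def atLeast0LessThan)
    qed
    have "a * (\<Sum>i<p. complex_of_real ((cmod (?v i))\<^sup>2)) = (\<Sum>i<p. cnj (?v i) * (a * ?v i))"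
      unfolding sum_distrib_left by (intro sum.cong refl) (simp only: complex_norm_square mult_ac)
    also have "\<dots> = (\<Sum>i<p. cnj (?v i) * (\<Sum>l<p. complex_of_real (S $$ (i, l)) * ?v l))"
      by (intro sum.cong refl) (simp add: row)
    also have "\<dots> = (\<Sum>i<p. \<Sum>l<p. \<Sum>j<n. complex_of_real c *
        (complex_of_real (A $$ (i, j)) * cnj (?v i)) * (complex_of_real (A $$ (l, j)) * ?v l))"
      unfolding sum_distrib_left
      by (intro sum.cong refl, subst entry) (auto simp: sum_distrib_left sum_distrib_right mult_ac)
    also have "\<dots> = (\<Sum>i<p. \<Sum>j<n. \<Sum>l<p. complex_of_real c *
        (complex_of_real (A $$ (i, j)) * cnj (?v i)) * (complex_of_real (A $$ (l, j)) * ?v l))"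
      by (intro sum.cong refl sum.swap)
    also have "\<dots> = (\<Sum>j<n. \<Sum>i<p. \<Sum>l<p. complex_of_real c *
        (complex_of_real (A $$ (i, j)) * cnj (?v i)) * (complex_of_real (A $$ (l, j)) * ?v l))"
      by (rule sum.swap)
    also have "\<dots> = (\<Sum>j<n. complex_of_real c * (cnj (w j) * w j))"
    proof -
      have cw: "cnj (w j) = (\<Sum>i<p. complex_of_real (A $$ (i, j)) * cnj (?v i))" for j by (simp add: w_def)
      have dist: "d * ((\<Sum>i<p. x i) * (\<Sum>l<p. z l)) = (\<Sum>i<p. \<Sum>l<p. d * x i * z l)" for d :: complex and x z
        by (subst sum_product) (simp only: sum_distrib_left mult.assoc)
      show ?thesis unfolding cw unfolding w_def unfolding dist ..
    qed
    also have "\<dots> = complex_of_real (c * (\<Sum>j<n. (cmod (w j))\<^sup>2))"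
      unfolding sum_distrib_left of_real_sum
      by (intro sum.cong refl) (simp add: complex_norm_square[symmetric] mult.commute[of "cnj _"] del: of_real_power)
    finally have eq: "a * complex_of_real (\<Sum>i<p. (cmod (?v i))\<^sup>2) = complex_of_real (c * (\<Sum>j<n. (cmod (w j))\<^sup>2))"
      by (simp only: of_real_sum)
    have pos: "0 < (\<Sum>i<p. (cmod (?v i))\<^sup>2)"
    proof -
      obtain i where "i < p" "?v i \<noteq> 0"
      proof (rule ccontr)
        assume "\<not> thesis"
        hence "\<forall>i<p. ?v i = 0" using that by blast
        hence "v = 0\<^sub>v p" using v(1) by (intro eq_vecI) auto
        thus False using v(2) by simp
      qed
      thus ?thesis by (intro sum_pos2[of _ i]) auto
    qed
    have "a = complex_of_real (c * (\<Sum>j<n. (cmod (w j))\<^sup>2)) / complex_of_real (\<Sum>i<p. (cmod (?v i))\<^sup>2)"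
      using eq pos by (simp add: nonzero_eq_divide_eq del: of_real_sum)
    hence "a = complex_of_real ((c * (\<Sum>j<n. (cmod (w j))\<^sup>2)) / (\<Sum>i<p. (cmod (?v i))\<^sup>2))"
      by (simp only: of_real_divide)
    moreover have "0 \<le> (c * (\<Sum>j<n. (cmod (w j))\<^sup>2)) / (\<Sum>i<p. (cmod (?v i))\<^sup>2)"
      using c by (intro divide_nonneg_nonneg mult_nonneg_nonneg sum_nonneg) auto
    ultimately show ?thesis by blast
  qed
  define es where "es = map Re as"
  have as_es: "as = map complex_of_real es"
    unfolding es_def map_map using real by (intro map_idI[symmetric]) fastforce
  interpret mp: map_poly_comm_ring_hom "of_real :: real \<Rightarrow> complex" ..
  have "map_poly complex_of_real (\<Prod>e\<leftarrow>xs. [:- e, 1:]) = (\<Prod>a\<leftarrow>map complex_of_real xs. [:- a, 1:])" for xs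
    by (induction xs) (simp_all add: mp.hom_mult del: mult_pCons_left)
  hence "map_poly complex_of_real (\<Prod>e\<leftarrow>es. [:- e, 1:]) = char_poly SC"
    unfolding as(1) as_es .
  moreover have "char_poly SC = map_poly complex_of_real (char_poly S)"
    unfolding SC_def by (rule of_real_hom.char_poly_hom[OF S])
  ultimately have lifted: "map_poly complex_of_real (char_poly S) = map_poly complex_of_real (\<Prod>e\<leftarrow>es. [:- e, 1:])"
    by (simp only:)
  have "complex_of_real (coeff (char_poly S) i) = complex_of_real (coeff (\<Prod>e\<leftarrow>es. [:- e, 1:]) i)" for i
    using arg_cong[OF lifted, of "\<lambda>q. coeff q i"] by (simp only: coeff_map_poly of_real_0)
  hence "char_poly S = (\<Prod>e\<leftarrow>es. [:- e, 1:])"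
    by (intro poly_eqI) (simp only: of_real_eq_iff)
  thus ?thesis unfolding S_def using as(2) by (intro exI[of _ es]) (auto simp: es_def dest!: real)
qed

lemma proots_linear_factors: "proots (\<Prod>e\<leftarrow>es. [:- e, 1:] :: real poly) = mset es"
proof -
  have "proots (\<Prod>q\<leftarrow>map (\<lambda>e. [:- e, 1:]) es. q :: real poly) = (\<Sum>q\<leftarrow>map (\<lambda>e. [:- e, 1:]) es. proots q)"
    by (rule proots_prod_list) auto
  also have "\<dots> = mset es" by (induction es) simp_all
  finally show ?thesis by simp
qed

lemma trace_product_commute:
  fixes A B :: "real Matrix.mat"
  assumes "A \<in> carrier_mat p p" "B \<in> carrier_mat p p"
  shows "(\<Sum>i<p. (A * B) $$ (i, i)) = (\<Sum>i<p. (B * A) $$ (i, i))"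
proof -
  have "(\<Sum>i<p. (A * B) $$ (i, i)) = (\<Sum>i<p. \<Sum>j<p. A $$ (i, j) * B $$ (j, i))"
    using assms by (intro sum.cong refl) (simp add: scalar_prod_def atLeast0LessThan)
  also have "\<dots> = (\<Sum>j<p. \<Sum>i<p. B $$ (j, i) * A $$ (i, j))"
    by (subst sum.swap) (simp add: mult.commute)
  also have "\<dots> = (\<Sum>i<p. (B * A) $$ (i, i))"
    using assms by (intro sum.cong refl) (simp add: scalar_prod_def atLeast0LessThan)
  finally show ?thesis .
qed

text \<open>A right inverse of an upper triangular matrix is upper triangular: its entries below the diagonal vanish
  by induction from the last row upwards.\<close>

lemma upper_triangular_inverse_diag:
  fixes B C :: "real Matrix.mat"
  assumes B: "B \<in> carrier_mat p p" and C: "C \<in> carrier_mat p p"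
    and upper: "\<And>i j. i < p \<Longrightarrow> j < i \<Longrightarrow> B $$ (i, j) = 0" and diag: "\<And>i. i < p \<Longrightarrow> B $$ (i, i) \<noteq> 0"
    and inv: "B * C = 1\<^sub>m p" and i: "i < p"
  shows "C $$ (i, i) = 1 / B $$ (i, i)"
proof -
  have prod: "(\<Sum>k<p. B $$ (i, k) * C $$ (k, j)) = (if i = j then 1 else 0)" if "i < p" "j < p" for i j
  proof -
    have "(B * C) $$ (i, j) = (if i = j then 1 else 0)" using inv that by simp
    thus ?thesis using that B C by (simp add: scalar_prod_def atLeast0LessThan)
  qed
  have lower: "C $$ (i, j) = 0" if "i < p" "j < i" for i j
    using that
  proof (induction "p - i" arbitrary: i rule: less_induct)
    case less
    have "(\<Sum>k<p. B $$ (i, k) * C $$ (k, j)) = (\<Sum>k<p. if k = i then B $$ (i, i) * C $$ (i, j) else 0)"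
    proof (rule sum.cong[OF refl])
      fix k assume k: "k \<in> {..<p}"
      show "B $$ (i, k) * C $$ (k, j) = (if k = i then B $$ (i, i) * C $$ (i, j) else 0)"
        using less.hyps[of k] less.prems upper[of i k] k by (cases k i rule: linorder_cases) auto
    qed
    thus ?case using prod[of i j] diag[of i] less.prems by simp
  qed
  have "(\<Sum>k<p. B $$ (i, k) * C $$ (k, i)) = (\<Sum>k<p. if k = i then B $$ (i, i) * C $$ (i, i) else 0)"
  proof (rule sum.cong[OF refl])
    fix k assume k: "k \<in> {..<p}"
    show "B $$ (i, k) * C $$ (k, i) = (if k = i then B $$ (i, i) * C $$ (i, i) else 0)"
      using lower[of k i] upper[of i k] k i by (cases k i rule: linorder_cases) auto
  qed
  thus ?thesis using prod[of i i] diag[of i] i by (simp add: field_simps)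
qed

text \<open>Conjugate to Schur form, where the inverse has diagonal entries \<open>1 / (e + t)\<close>.\<close>

lemma trace_shifted_inverse:
  fixes S R :: "real Matrix.mat"
  assumes S: "S \<in> carrier_mat p p" and es: "char_poly S = (\<Prod>e\<leftarrow>es. [:- e, 1:])"
    and nz: "\<And>e. e \<in> set es \<Longrightarrow> e + t \<noteq> 0"
    and R: "R \<in> carrier_mat p p" and inv: "(S + t \<cdot>\<^sub>m 1\<^sub>m p) * R = 1\<^sub>m p"
  shows "(\<Sum>i<p. R $$ (i, i)) = (\<Sum>e\<leftarrow>es. 1 / (e + t))"
proof -
  obtain B P Q where dec: "schur_decomposition S es = (B, P, Q)" by (cases "schur_decomposition S es")
  from schur_decomposition[OF S es dec] have wit: "similar_mat_wit S B P Q"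
    and up: "upper_triangular B" and diag: "diag_mat B = es" by auto
  from wit S have c: "B \<in> carrier_mat p p" "P \<in> carrier_mat p p" "Q \<in> carrier_mat p p"
    and PQ: "P * Q = 1\<^sub>m p" "Q * P = 1\<^sub>m p" and SP: "S = P * B * Q"
    by (auto simp: similar_mat_wit_def Let_def)
  let ?I = "t \<cdot>\<^sub>m 1\<^sub>m p"
  have I: "?I \<in> carrier_mat p p" by simp
  define C where "C = Q * R * P"
  have C: "C \<in> carrier_mat p p" using c R by (simp add: C_def)
  have QS: "Q * S = B * Q"
  proof -
    have "Q * S = Q * (P * (B * Q))" using c by (simp add: SP assoc_mult_mat[of P p p B p Q p])
    also have "\<dots> = (Q * P) * (B * Q)" using c by (simp add: assoc_mult_mat[of Q p p P p _ p])
    also have "\<dots> = B * Q" using c PQ by simp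
    finally show ?thesis .
  qed
  have "(B + ?I) * Q = Q * (S + ?I)"
  proof -
    have "(B + ?I) * Q = B * Q + ?I * Q" using c I by (simp add: add_mult_distrib_mat[of B p p ?I Q p])
    also have "?I * Q = Q * ?I"
      using c by (simp add: mult_smult_assoc_mat[of "1\<^sub>m p" p p Q p] mult_smult_distrib[of Q p p "1\<^sub>m p" p])
    also have "B * Q + Q * ?I = Q * (S + ?I)"
      using c I S QS by (simp add: mult_add_distrib_mat[of Q p p S p ?I])
    finally show ?thesis .
  qed
  hence "(B + ?I) * C = Q * (S + ?I) * (R * P)"
    using c R C I S unfolding C_def
    by (simp add: assoc_mult_mat[of Q p p R p P p] assoc_mult_mat[of "B + ?I" p p Q p "R * P" p, symmetric])
  also have "\<dots> = Q * ((S + ?I) * R * P)"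
    using c R I S by (simp add: assoc_mult_mat[of Q p p "S + ?I" p "R * P" p] assoc_mult_mat[of "S + ?I" p p R p P p])
  also have "\<dots> = 1\<^sub>m p" using inv c PQ by simp
  finally have BC: "(B + ?I) * C = 1\<^sub>m p" .
  have di: "es ! i = B $$ (i, i)" "i < length es" if "i < p" for i
    using that c by (auto simp: diag[symmetric] diag_mat_def)
  have len: "length es = p" using c by (auto simp: diag[symmetric] diag_mat_def)
  have Cdiag: "C $$ (i, i) = 1 / (es ! i + t)" if i: "i < p" for i
  proof -
    have "C $$ (i, i) = 1 / (B + ?I) $$ (i, i)"
    proof (rule upper_triangular_inverse_diag[OF _ C _ _ BC i])
      show "(B + ?I) $$ (i, j) = 0" if "i < p" "j < i" for i j
        using that up c by (simp add: upper_triangular_def)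
      show "(B + ?I) $$ (i, i) \<noteq> 0" if "i < p" for i
        using nz[OF nth_mem[OF di(2)[OF that]]] di(1)[OF that] that c by simp
    qed (use c in simp)
    thus ?thesis using i c di(1)[OF i] by simp
  qed
  have "(\<Sum>i<p. C $$ (i, i)) = (\<Sum>i<p. (Q * (R * P)) $$ (i, i))"
    using c R by (simp add: C_def assoc_mult_mat[of Q p p R p P p])
  also have "\<dots> = (\<Sum>i<p. (R * P * Q) $$ (i, i))"
    by (rule trace_product_commute) (use c R in auto)
  also have "R * P * Q = R" using c R PQ by (simp add: assoc_mult_mat[of R p p P p Q p])
  finally have "(\<Sum>i<p. R $$ (i, i)) = (\<Sum>i<p. 1 / (es ! i + t))"
    using Cdiag by simp
  thus ?thesis by (simp add: sum_list_sum_nth len atLeast0LessThan)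
qed

text \<open>Eliminating the lower rows from \<open>(r + K) G = 1\<close> shows that the upper left block is \<open>r (S + r\<^sup>2)\<^sup>-\<^sup>1\<close>.\<close>

lemma upper_block_resolvent:
  assumes r: "0 < r" and i: "i < p" and l: "l < p"
  shows "r\<^sup>2 * block_resolvent r p n x i l
      + (\<Sum>m<p. (\<Sum>j\<in>{p..<p + n}. skew_block p n x i j * skew_block p n x m j) * block_resolvent r p n x m l)
     = (if i = l then r else 0)"
proof -
  let ?G = "block_resolvent r p n x" let ?K = "skew_block p n x"
  have sk: "?K a b = - ?K b a" if "a < p + n" "b < p + n" for a b
    using skew_on_block[of "p + n" p n x] that unfolding skew_on_def by blast
  have split: "(\<Sum>c<p + n. ((if a = c then r else 0) + ?K a c) * ?G c l) = r * ?G a l + (\<Sum>c<p + n. ?K a c * ?G c l)" if "a < p + n" for a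
  proof -
    have "(\<Sum>c<p + n. ((if a = c then r else 0) + ?K a c) * ?G c l)
       = (\<Sum>c<p + n. if a = c then r * ?G a l else 0) + (\<Sum>c<p + n. ?K a c * ?G c l)"
      unfolding sum.distrib[symmetric] by (intro sum.cong refl) (simp add: algebra_simps)
    thus ?thesis using that by simp
  qed
  have eqn: "r * ?G a l + (\<Sum>c<p + n. ?K a c * ?G c l) = (if a = l then 1 else 0)" if "a < p + n" for a
    using shift_inverse_right[OF skew_on_block r that, of l p n x] l split[OF that] by (simp add: block_resolvent_def)
  have up: "r * ?G i l + (\<Sum>j\<in>{p..<p + n}. ?K i j * ?G j l) = (if i = l then 1 else 0)"
    using eqn[of i] i unfolding sum_split_blocks by (simp add: skew_block_def)
  have low: "r * ?G j l = (\<Sum>m<p. ?K m j * ?G m l)" if j: "j \<in> {p..<p + n}" for j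
  proof -
    have "r * ?G j l + (\<Sum>m<p. ?K j m * ?G m l) = 0"
      using eqn[of j] j l unfolding sum_split_blocks by (simp add: skew_block_def)
    moreover have "(\<Sum>m<p. ?K j m * ?G m l) = - (\<Sum>m<p. ?K m j * ?G m l)"
      unfolding sum_negf[symmetric]
    proof (rule sum.cong[OF refl])
      fix m assume "m \<in> {..<p}"
      hence "?K j m = - ?K m j" using j by (intro sk) auto
      thus "?K j m * ?G m l = - (?K m j * ?G m l)" by simp
    qed
    ultimately show ?thesis by simp
  qed
  have "(\<Sum>m<p. (\<Sum>j\<in>{p..<p + n}. ?K i j * ?K m j) * ?G m l) = (\<Sum>m<p. \<Sum>j\<in>{p..<p + n}. ?K i j * (?K m j * ?G m l))"
    by (simp add: sum_distrib_right mult.assoc)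
  also have "\<dots> = (\<Sum>j\<in>{p..<p + n}. ?K i j * (r * ?G j l))"
    by (subst sum.swap) (simp add: low sum_distrib_left)
  also have "\<dots> = r * (\<Sum>j\<in>{p..<p + n}. ?K i j * ?G j l)" by (simp add: sum_distrib_left mult_ac)
  finally have "r\<^sup>2 * ?G i l + (\<Sum>m<p. (\<Sum>j\<in>{p..<p + n}. ?K i j * ?K m j) * ?G m l)
     = r * (r * ?G i l + (\<Sum>j\<in>{p..<p + n}. ?K i j * ?G j l))"
    by (simp add: power2_eq_square distrib_left mult.assoc)
  thus ?thesis unfolding up by simp
qed

lemma data_gram_entry:
  assumes "0 < n" "i < p" "m < p"
  shows "((1 / real n) \<cdot>\<^sub>m (data_matrix p n X \<omega> * transpose_mat (data_matrix p n X \<omega>))) $$ (i, m)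
     = (\<Sum>j\<in>{p..<p + n}. skew_block p n (zero_outside (entries p n) (\<lambda>u. X u \<omega>)) i j
         * skew_block p n (zero_outside (entries p n) (\<lambda>u. X u \<omega>)) m j)"
proof -
  let ?x = "zero_outside (entries p n) (\<lambda>u. X u \<omega>)"
  have K: "skew_block p n ?x i (j + p) = X (int i + 1, int j + 1) \<omega> / sqrt (real n)" if "i < p" "j < n" for i j
    using that by (simp add: skew_block_def zero_outside_def entries_def)
  have "(\<Sum>j\<in>{p..<p + n}. skew_block p n ?x i j * skew_block p n ?x m j)
      = (\<Sum>j<n. skew_block p n ?x i (j + p) * skew_block p n ?x m (j + p))"
    using sum.shift_bounds_nat_ivl[of "\<lambda>j. skew_block p n ?x i j * skew_block p n ?x m j" 0 p n]
    by (simp add: atLeast0LessThan add.commute)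
  also have "\<dots> = (\<Sum>j<n. 1 / real n * (X (int i + 1, int j + 1) \<omega> * X (int m + 1, int j + 1) \<omega>))"
    using assms by (intro sum.cong refl) (simp add: K)
  finally show ?thesis using assms
    by (simp add: data_matrix_def scalar_prod_def atLeast0LessThan sum_divide_distrib)
qed

lemma gram_eigenvalues:
  fixes X :: "int \<times> int \<Rightarrow> 'a \<Rightarrow> real" and p n :: nat and \<omega> :: 'a
  assumes n: "0 < n"
  defines "S \<equiv> (1 / real n) \<cdot>\<^sub>m (data_matrix p n X \<omega> * transpose_mat (data_matrix p n X \<omega>))"
  shows "size (proots (char_poly S)) = p" and "\<And>e. e \<in># proots (char_poly S) \<Longrightarrow> 0 \<le> e"
    and "0 < r \<Longrightarrow> (\<Sum>e\<in>#proots (char_poly S). 1 / (e + r\<^sup>2))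
       = real n / r * upper_trace r p n (zero_outside (entries p n) (\<lambda>u. X u \<omega>))"
proof -
  have D: "data_matrix p n X \<omega> \<in> carrier_mat p n" by (simp add: data_matrix_def)
  have S: "S \<in> carrier_mat p p" using D by (auto simp: S_def)
  obtain es where es: "char_poly S = (\<Prod>e\<leftarrow>es. [:- e, 1:])" "length es = p" "\<forall>e\<in>set es. 0 \<le> e"
    using gram_char_poly_splits[OF D, of "1 / real n"] unfolding S_def by auto
  have pr: "proots (char_poly S) = mset es" unfolding es(1) by (rule proots_linear_factors)
  show "size (proots (char_poly S)) = p" using es(2) by (simp add: pr)
  show "0 \<le> e" if "e \<in># proots (char_poly S)" for e using es(3) that by (simp add: pr)
  assume r: "0 < r"
  let ?x = "zero_outside (entries p n) (\<lambda>u. X u \<omega>)"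
  let ?G = "block_resolvent r p n ?x"
  define R where "R = Matrix.mat p p (\<lambda>(i, j). 1 / r * ?G i j)"
  have R: "R \<in> carrier_mat p p" by (simp add: R_def)
  have "(S + r\<^sup>2 \<cdot>\<^sub>m 1\<^sub>m p) * R = 1\<^sub>m p"
  proof (rule eq_matI)
    fix i l assume "i < dim_row (1\<^sub>m p :: real Matrix.mat)" "l < dim_col (1\<^sub>m p :: real Matrix.mat)"
    hence il: "i < p" "l < p" by auto
    have "((S + r\<^sup>2 \<cdot>\<^sub>m 1\<^sub>m p) * R) $$ (i, l) = (\<Sum>m<p. (S $$ (i, m) + r\<^sup>2 * (if m = i then 1 else 0)) * (1 / r * ?G m l))"
      using il S R by (simp add: scalar_prod_def atLeast0LessThan R_def)
    also have "\<dots> = 1 / r * ((\<Sum>m<p. S $$ (i, m) * ?G m l) + (\<Sum>m<p. if m = i then r\<^sup>2 * ?G i l else 0))"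
      unfolding sum.distrib[symmetric] sum_distrib_left by (intro sum.cong refl) (simp add: algebra_simps)
    also have "\<dots> = 1 / r * (r\<^sup>2 * ?G i l + (\<Sum>m<p. S $$ (i, m) * ?G m l))" using il by simp
    also have "(\<Sum>m<p. S $$ (i, m) * ?G m l)
       = (\<Sum>m<p. (\<Sum>j\<in>{p..<p + n}. skew_block p n ?x i j * skew_block p n ?x m j) * ?G m l)"
      unfolding S_def by (intro sum.cong refl arg_cong2[where f = "(*)"] data_gram_entry[OF n]) (use il in auto)
    also have "1 / r * (r\<^sup>2 * ?G i l + \<dots>) = (if i = l then 1 else 0)"
      unfolding upper_block_resolvent[OF r il] using r by simp
    finally show "((S + r\<^sup>2 \<cdot>\<^sub>m 1\<^sub>m p) * R) $$ (i, l) = 1\<^sub>m p $$ (i, l)" using il by simp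
  qed (use S R in auto)
  hence "(\<Sum>i<p. R $$ (i, i)) = (\<Sum>e\<leftarrow>es. 1 / (e + r\<^sup>2))"
  proof (intro trace_shifted_inverse[OF S es(1) _ R])
    fix e assume "e \<in> set es"
    hence "0 \<le> e" using es(3) by blast
    thus "e + r\<^sup>2 \<noteq> 0" using r by (simp add: add_nonneg_eq_0_iff)
  qed
  also have "(\<Sum>i<p. R $$ (i, i)) = real n / r * upper_trace r p n ?x"
    using n by (simp add: R_def upper_trace_def sum_distrib_left sum_divide_distrib)
  finally show "(\<Sum>e\<in>#proots (char_poly S). 1 / (e + r\<^sup>2)) = real n / r * upper_trace r p n ?x"
    by (simp add: pr sum_mset_sum_list flip: mset_map)
qed

section \<open>From resolvent averages to the Levy distance\<close>

definition admissible :: "(real \<Rightarrow> real) \<Rightarrow> bool" where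
  "admissible f \<longleftrightarrow> f \<in> borel_measurable borel \<and> (\<exists>B. \<forall>x\<ge>0. \<bar>f x\<bar> \<le> B)"

text \<open>Integration against a probability measure on the nonnegative half-line, described by the properties that
  matter here. This covers the average over the eigenvalues as well as the Marchenko--Pastur law, whose
  atom at the origin would make it awkward to present as a measure with a density.\<close>

definition mean_functional :: "((real \<Rightarrow> real) \<Rightarrow> real) \<Rightarrow> bool" where
  "mean_functional I \<longleftrightarrow>
     (\<forall>f g. admissible f \<longrightarrow> admissible g \<longrightarrow> I (\<lambda>x. f x + g x) = I f + I g) \<and>
     (\<forall>f c. admissible f \<longrightarrow> I (\<lambda>x. c * f x) = c * I f) \<and>
     (\<forall>f g. admissible f \<longrightarrow> admissible g \<longrightarrow> (\<forall>x\<ge>0. f x \<le> g x) \<longrightarrow> I f \<le> I g) \<and>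
     I (\<lambda>_. 1) = 1"

lemma mean_functionalD:
  assumes "mean_functional I"
  shows "admissible f \<Longrightarrow> admissible g \<Longrightarrow> I (\<lambda>x. f x + g x) = I f + I g"
    and "admissible f \<Longrightarrow> I (\<lambda>x. c * f x) = c * I f"
    and "admissible f \<Longrightarrow> admissible g \<Longrightarrow> (\<And>x. 0 \<le> x \<Longrightarrow> f x \<le> g x) \<Longrightarrow> I f \<le> I g"
    and "I (\<lambda>_. 1) = 1"
  using assms unfolding mean_functional_def by blast+

lemma admissibleI:
  assumes "f \<in> borel_measurable borel" "\<And>x. 0 \<le> x \<Longrightarrow> \<bar>f x\<bar> \<le> B"
  shows "admissible f"
  using assms unfolding admissible_def by blast

lemma admissible_const: "admissible (\<lambda>_. c)"
  by (rule admissibleI[of _ "\<bar>c\<bar>"]) auto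

lemma admissible_indicator: "admissible (indicat_real {..a})"
  by (rule admissibleI[of _ 1]) (auto simp: indicator_def)

lemma admissible_add: assumes "admissible f" "admissible g" shows "admissible (\<lambda>x. f x + g x)"
proof -
  from assms obtain A B where m: "f \<in> borel_measurable borel" "g \<in> borel_measurable borel"
    and b: "\<forall>x\<ge>0. \<bar>f x\<bar> \<le> A" "\<forall>x\<ge>0. \<bar>g x\<bar> \<le> B" unfolding admissible_def by blast
  show ?thesis
  proof (rule admissibleI[of _ "A + B"])
    show "\<bar>f x + g x\<bar> \<le> A + B" if "0 \<le> x" for x
      using order.trans[OF abs_triangle_ineq add_mono] b that by blast
  qed (use m in measurable)
qed

lemma admissible_scale: assumes "admissible f" shows "admissible (\<lambda>x. c * f x)"
proof -
  from assms obtain A where m: "f \<in> borel_measurable borel" and b: "\<forall>x\<ge>0. \<bar>f x\<bar> \<le> A"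
    unfolding admissible_def by blast
  show ?thesis
    by (rule admissibleI[of _ "\<bar>c\<bar> * A"]) (use m b in \<open>auto simp: abs_mult intro!: mult_left_mono\<close>)
qed

lemma admissible_resolvent_power: assumes "0 < t" shows "admissible (\<lambda>x. (1 / (x + t)) ^ k)"
proof (rule admissibleI[of _ "(1 / t) ^ k"])
  fix x :: real assume "0 \<le> x"
  thus "\<bar>(1 / (x + t)) ^ k\<bar> \<le> (1 / t) ^ k"
    using assms by (simp only: power_abs) (auto intro!: power_mono simp: field_simps)
qed measurable

lemma mean_functional_diff:
  assumes I: "mean_functional I" and f: "admissible f" and g: "admissible g"
    and le: "\<And>x. 0 \<le> x \<Longrightarrow> \<bar>f x - g x\<bar> \<le> \<eta>"
  shows "\<bar>I f - I g\<bar> \<le> \<eta>"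
proof -
  have c: "I (\<lambda>_. \<eta>) = \<eta>"
    using mean_functionalD(2)[OF I admissible_const[of 1], of \<eta>] mean_functionalD(4)[OF I] by simp
  have "I f \<le> I (\<lambda>x. g x + \<eta>)"
    by (rule mean_functionalD(3)[OF I f admissible_add[OF g admissible_const]]) (use le in \<open>force simp: abs_le_iff\<close>)
  moreover have "I g \<le> I (\<lambda>x. f x + \<eta>)"
    by (rule mean_functionalD(3)[OF I g admissible_add[OF f admissible_const]]) (use le in \<open>force simp: abs_le_iff\<close>)
  ultimately show ?thesis
    unfolding mean_functionalD(1)[OF I f admissible_const] mean_functionalD(1)[OF I g admissible_const] c by linarith
qed

definition stieltjes_close :: "((real \<Rightarrow> real) \<Rightarrow> real) \<Rightarrow> ((real \<Rightarrow> real) \<Rightarrow> real) \<Rightarrow> real set \<Rightarrow> real \<Rightarrow> bool" where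
  "stieltjes_close \<nu> \<mu> T \<delta> \<longleftrightarrow> mean_functional \<nu> \<and>
     (\<forall>t\<in>T. \<bar>\<nu> (\<lambda>x. 1 / (x + t)) - \<mu> (\<lambda>x. 1 / (x + t))\<bar> < \<delta>)"

text \<open>The averages of \<open>h\<close> are controlled by finitely many resolvent averages. The functions with this property
  form a linear space that is closed under uniform limits.\<close>

definition stieltjes_determined :: "((real \<Rightarrow> real) \<Rightarrow> real) \<Rightarrow> (real \<Rightarrow> real) \<Rightarrow> bool" where
  "stieltjes_determined \<mu> h \<longleftrightarrow>
     (\<forall>\<epsilon>>0. \<exists>T \<delta>. finite T \<and> T \<subseteq> {0<..} \<and> 0 < \<delta> \<and> (\<forall>\<nu>. stieltjes_close \<nu> \<mu> T \<delta> \<longrightarrow> \<bar>\<nu> h - \<mu> h\<bar> \<le> \<epsilon>))"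

lemma stieltjes_close_mono: "stieltjes_close \<nu> \<mu> T \<delta> \<Longrightarrow> S \<subseteq> T \<Longrightarrow> \<delta> \<le> \<delta>' \<Longrightarrow> stieltjes_close \<nu> \<mu> S \<delta>'"
  unfolding stieltjes_close_def by force

text \<open>The difference quotient in \<open>t\<close> of the \<open>k\<close>-th power. With \<open>a = 1 / (x + t)\<close> the shifted fraction is
  \<open>a q\<close>, and Bernoulli's inequality for \<open>q\<close> and for \<open>1 / q\<close> encloses \<open>1 - q ^ k\<close> between \<open>z - z\<^sup>2\<close>
  and \<open>z = k \<eta> a\<close>. The error is uniform in \<open>x\<close>.\<close>

lemma resolvent_power_difference:
  fixes x t \<eta> :: real
  assumes "0 \<le> x" "0 < t" "0 < \<eta>" "0 < k"
  shows "\<bar>(1 / (x + t)) ^ Suc k - (1 / (real k * \<eta>)) * ((1 / (x + t)) ^ k - (1 / (x + (t + \<eta>))) ^ k)\<bar>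
     \<le> real k * \<eta> * (1 / t) ^ (k + 2)"
proof -
  define a where "a = 1 / (x + t)"
  have a: "0 < a" "a \<le> 1 / t" using assms by (auto simp: a_def field_simps)
  define q where "q = 1 / (1 + \<eta> * a)"
  define z where "z = real k * (\<eta> * a)"
  have \<eta>a: "0 < \<eta> * a" using a assms by simp
  have z: "0 < z" using \<eta>a assms by (simp add: z_def)
  have a': "1 / (x + (t + \<eta>)) = a * q" using assms by (simp add: a_def q_def field_simps)
  have q: "0 < q" "q \<le> 1" "1 - q \<le> \<eta> * a"
  proof -
    show "0 < q" "q \<le> 1" using \<eta>a by (auto simp: q_def)
    have "1 - q = (\<eta> * a) * q" using \<eta>a by (simp add: q_def field_simps)
    also have "\<dots> \<le> (\<eta> * a) * 1" using \<eta>a \<open>q \<le> 1\<close> by (intro mult_left_mono) auto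
    finally show "1 - q \<le> \<eta> * a" by simp
  qed
  have up: "1 - q ^ k \<le> z"
  proof -
    have "1 + real k * (q - 1) \<le> (1 + (q - 1)) ^ k" using q by (intro Bernoulli_inequality) auto
    moreover have "real k * (1 - q) \<le> z" unfolding z_def using q by (intro mult_left_mono) auto
    ultimately show ?thesis by (simp add: algebra_simps)
  qed
  have low: "z - z * z \<le> 1 - q ^ k"
  proof -
    have "1 + z \<le> (1 + \<eta> * a) ^ k" using Bernoulli_inequality[of "\<eta> * a" k] \<eta>a by (simp add: z_def)
    hence "q ^ k \<le> 1 / (1 + z)"
      unfolding q_def power_one_over using z by (intro divide_left_mono) auto
    moreover have "1 / (1 + z) \<le> 1 - z + z * z"
    proof -
      have "1 \<le> (1 - z + z * z) * (1 + z)" using z by (simp add: algebra_simps)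
      thus ?thesis using z by (simp add: field_simps)
    qed
    ultimately show ?thesis by linarith
  qed
  have zz: "\<bar>z - (1 - q ^ k)\<bar> \<le> z * z" using up low by (simp add: abs_le_iff)
  have "a ^ Suc k - (1 / (real k * \<eta>)) * (a ^ k - (a * q) ^ k) = (1 / (real k * \<eta>)) * a ^ k * (z - (1 - q ^ k))"
    using assms by (simp add: z_def power_mult_distrib field_simps)
  also have "\<bar>\<dots>\<bar> = (1 / (real k * \<eta>)) * a ^ k * \<bar>z - (1 - q ^ k)\<bar>"
    using a assms by (simp add: abs_mult)
  also have "\<dots> \<le> (1 / (real k * \<eta>)) * a ^ k * (z * z)"
    using a assms by (intro mult_left_mono zz) auto
  also have "\<dots> = real k * \<eta> * a ^ (k + 2)" using assms by (simp add: z_def field_simps power2_eq_square)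
  also have "\<dots> \<le> real k * \<eta> * (1 / t) ^ (k + 2)"
    using a assms by (intro mult_left_mono power_mono) auto
  finally show ?thesis unfolding a' a_def[symmetric] .
qed

text \<open>A continuous step from \<open>1\<close> on \<open>[0, s]\<close> down to \<open>0\<close> beyond \<open>s + d\<close>. It is piecewise linear in
  \<open>1 / (x + 1)\<close> rather than in \<open>x\<close>, so that the Weierstrass theorem in that variable applies directly.\<close>

definition ramp :: "real \<Rightarrow> real \<Rightarrow> real \<Rightarrow> real" where
  "ramp s d x = max 0 (min 1 ((1 / (x + 1) - 1 / (s + d + 1)) / (1 / (s + 1) - 1 / (s + d + 1))))"

lemma ramp_denominator_pos: "0 \<le> s \<Longrightarrow> 0 < d \<Longrightarrow> 0 < 1 / (s + 1) - 1 / (s + d + 1 :: real)"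
  by (simp add: frac_less2)

lemma admissible_ramp: "admissible (ramp s d)"
  by (rule admissibleI[of _ 1]) (auto simp: ramp_def[abs_def])

lemma ramp_bounds:
  assumes "0 \<le> s" "0 < d" "0 \<le> x"
  shows "indicat_real {..s} x \<le> ramp s d x" "ramp s d x \<le> indicat_real {..s + d} x"
proof -
  have den: "0 < 1 / (s + 1) - 1 / (s + d + 1)" by (rule ramp_denominator_pos[OF assms(1,2)])
  show "indicat_real {..s} x \<le> ramp s d x"
  proof (cases "x \<le> s")
    case True
    hence "1 / (s + 1) \<le> 1 / (x + 1)" using assms by (simp add: field_simps)
    hence "1 \<le> (1 / (x + 1) - 1 / (s + d + 1)) / (1 / (s + 1) - 1 / (s + d + 1))"
      using den by (simp only: le_divide_eq_1_pos)
    thus ?thesis by (simp add: ramp_def)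
  qed (simp add: ramp_def)
  show "ramp s d x \<le> indicat_real {..s + d} x"
  proof (cases "x \<le> s + d")
    case False
    hence "1 / (x + 1) \<le> 1 / (s + d + 1)" using assms by (intro divide_left_mono) auto
    hence "(1 / (x + 1) - 1 / (s + d + 1)) / (1 / (s + 1) - 1 / (s + d + 1)) \<le> 0"
      using den by (intro divide_nonpos_pos) auto
    thus ?thesis using False by (simp add: ramp_def)
  qed (simp add: ramp_def)
qed

context
  fixes \<mu> :: "(real \<Rightarrow> real) \<Rightarrow> real"
  assumes \<mu>: "mean_functional \<mu>"
begin

lemma determined_const: "stieltjes_determined \<mu> (\<lambda>_. c)"
proof -
  have "I (\<lambda>_. c) = c" if "mean_functional I" for I
    using mean_functionalD(2)[OF that admissible_const[of 1], of c] mean_functionalD(4)[OF that] by simp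
  note eq = this
  have "\<bar>\<nu> (\<lambda>_. c) - \<mu> (\<lambda>_. c)\<bar> \<le> \<epsilon>" if "0 < \<epsilon>" "mean_functional \<nu>" for \<nu> \<epsilon>
    unfolding eq[OF \<mu>] eq[OF that(2)] using that(1) by simp
  thus ?thesis unfolding stieltjes_determined_def stieltjes_close_def
    by (intro allI impI exI[of _ "{}"] exI[of _ 1]) auto
qed

lemma determined_resolvent: assumes "0 < t" shows "stieltjes_determined \<mu> (\<lambda>x. 1 / (x + t))"
  unfolding stieltjes_determined_def
proof (intro allI impI)
  fix \<epsilon> :: real assume "0 < \<epsilon>"
  thus "\<exists>T \<delta>. finite T \<and> T \<subseteq> {0<..} \<and> 0 < \<delta> \<and> (\<forall>\<nu>. stieltjes_close \<nu> \<mu> T \<delta> \<longrightarrow> \<bar>\<nu> (\<lambda>x. 1 / (x + t)) - \<mu> (\<lambda>x. 1 / (x + t))\<bar> \<le> \<epsilon>)"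
    using assms by (intro exI[of _ "{t}"] exI[of _ \<epsilon>]) (auto simp: stieltjes_close_def)
qed

lemma determined_add:
  assumes f: "stieltjes_determined \<mu> f" "admissible f" and g: "stieltjes_determined \<mu> g" "admissible g"
  shows "stieltjes_determined \<mu> (\<lambda>x. f x + g x)"
  unfolding stieltjes_determined_def
proof (intro allI impI)
  fix \<epsilon> :: real assume "0 < \<epsilon>"
  hence e: "0 < \<epsilon> / 2" by simp
  from f(1) e obtain T \<delta> where T: "finite T" "T \<subseteq> {0<..}" "0 < \<delta>"
      "\<And>\<nu>. stieltjes_close \<nu> \<mu> T \<delta> \<Longrightarrow> \<bar>\<nu> f - \<mu> f\<bar> \<le> \<epsilon> / 2"
    unfolding stieltjes_determined_def by meson
  from g(1) e obtain T' \<delta>' where T': "finite T'" "T' \<subseteq> {0<..}" "0 < \<delta>'"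
      "\<And>\<nu>. stieltjes_close \<nu> \<mu> T' \<delta>' \<Longrightarrow> \<bar>\<nu> g - \<mu> g\<bar> \<le> \<epsilon> / 2"
    unfolding stieltjes_determined_def by meson
  show "\<exists>T \<delta>. finite T \<and> T \<subseteq> {0<..} \<and> 0 < \<delta> \<and>
      (\<forall>\<nu>. stieltjes_close \<nu> \<mu> T \<delta> \<longrightarrow> \<bar>\<nu> (\<lambda>x. f x + g x) - \<mu> (\<lambda>x. f x + g x)\<bar> \<le> \<epsilon>)"
  proof (intro exI[of _ "T \<union> T'"] exI[of _ "min \<delta> \<delta>'"] conjI allI impI)
    fix \<nu> assume c: "stieltjes_close \<nu> \<mu> (T \<union> T') (min \<delta> \<delta>')"
    hence \<nu>: "mean_functional \<nu>" by (simp add: stieltjes_close_def)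
    have "\<bar>\<nu> f - \<mu> f\<bar> \<le> \<epsilon> / 2" by (rule T(4)[OF stieltjes_close_mono[OF c]]) auto
    moreover have "\<bar>\<nu> g - \<mu> g\<bar> \<le> \<epsilon> / 2" by (rule T'(4)[OF stieltjes_close_mono[OF c]]) auto
    ultimately show "\<bar>\<nu> (\<lambda>x. f x + g x) - \<mu> (\<lambda>x. f x + g x)\<bar> \<le> \<epsilon>"
      unfolding mean_functionalD(1)[OF \<nu> f(2) g(2)] mean_functionalD(1)[OF \<mu> f(2) g(2)] by linarith
  qed (use T T' in auto)
qed

lemma determined_scale:
  assumes f: "stieltjes_determined \<mu> f" "admissible f"
  shows "stieltjes_determined \<mu> (\<lambda>x. c * f x)"
  unfolding stieltjes_determined_def
proof (intro allI impI)
  fix \<epsilon> :: real assume \<epsilon>: "0 < \<epsilon>"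
  define e where "e = \<epsilon> / (\<bar>c\<bar> + 1)"
  have e: "0 < e" "\<bar>c\<bar> * e \<le> \<epsilon>" using \<epsilon> by (simp_all add: e_def field_simps)
  from f(1) e(1) obtain T \<delta> where T: "finite T" "T \<subseteq> {0<..}" "0 < \<delta>"
      "\<And>\<nu>. stieltjes_close \<nu> \<mu> T \<delta> \<Longrightarrow> \<bar>\<nu> f - \<mu> f\<bar> \<le> e"
    unfolding stieltjes_determined_def by meson
  show "\<exists>T \<delta>. finite T \<and> T \<subseteq> {0<..} \<and> 0 < \<delta> \<and>
      (\<forall>\<nu>. stieltjes_close \<nu> \<mu> T \<delta> \<longrightarrow> \<bar>\<nu> (\<lambda>x. c * f x) - \<mu> (\<lambda>x. c * f x)\<bar> \<le> \<epsilon>)"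
  proof (intro exI[of _ T] exI[of _ \<delta>] conjI allI impI)
    fix \<nu> assume cl: "stieltjes_close \<nu> \<mu> T \<delta>"
    hence \<nu>: "mean_functional \<nu>" by (simp add: stieltjes_close_def)
    have "\<bar>c * \<nu> f - c * \<mu> f\<bar> = \<bar>c\<bar> * \<bar>\<nu> f - \<mu> f\<bar>" by (simp add: abs_mult flip: right_diff_distrib)
    also have "\<dots> \<le> \<bar>c\<bar> * e" by (intro mult_left_mono T(4)[OF cl]) auto
    finally show "\<bar>\<nu> (\<lambda>x. c * f x) - \<mu> (\<lambda>x. c * f x)\<bar> \<le> \<epsilon>"
      unfolding mean_functionalD(2)[OF \<nu> f(2)] mean_functionalD(2)[OF \<mu> f(2)] using e(2) by linarith
  qed (use T in auto)
qed

lemma determined_uniform_limit: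
  assumes h: "admissible h"
    and approx: "\<And>\<eta>. 0 < \<eta> \<Longrightarrow> \<exists>g. stieltjes_determined \<mu> g \<and> admissible g \<and> (\<forall>x\<ge>0. \<bar>h x - g x\<bar> \<le> \<eta>)"
  shows "stieltjes_determined \<mu> h"
  unfolding stieltjes_determined_def
proof (intro allI impI)
  fix \<epsilon> :: real assume \<epsilon>: "0 < \<epsilon>"
  hence e: "0 < \<epsilon> / 3" by simp
  from approx[OF e] obtain g where g: "stieltjes_determined \<mu> g" "admissible g" "\<And>x. 0 \<le> x \<Longrightarrow> \<bar>h x - g x\<bar> \<le> \<epsilon> / 3" by blast
  from g(1) e obtain T \<delta> where T: "finite T" "T \<subseteq> {0<..}" "0 < \<delta>"
      "\<And>\<nu>. stieltjes_close \<nu> \<mu> T \<delta> \<Longrightarrow> \<bar>\<nu> g - \<mu> g\<bar> \<le> \<epsilon> / 3"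
    unfolding stieltjes_determined_def by meson
  show "\<exists>T \<delta>. finite T \<and> T \<subseteq> {0<..} \<and> 0 < \<delta> \<and> (\<forall>\<nu>. stieltjes_close \<nu> \<mu> T \<delta> \<longrightarrow> \<bar>\<nu> h - \<mu> h\<bar> \<le> \<epsilon>)"
  proof (intro exI[of _ T] exI[of _ \<delta>] conjI allI impI)
    fix \<nu> assume cl: "stieltjes_close \<nu> \<mu> T \<delta>"
    hence \<nu>: "mean_functional \<nu>" by (simp add: stieltjes_close_def)
    have "\<bar>\<nu> h - \<nu> g\<bar> \<le> \<epsilon> / 3" "\<bar>\<mu> h - \<mu> g\<bar> \<le> \<epsilon> / 3"
      using mean_functional_diff[OF \<nu> h g(2,3)] mean_functional_diff[OF \<mu> h g(2,3)] by auto
    with T(4)[OF cl] show "\<bar>\<nu> h - \<mu> h\<bar> \<le> \<epsilon>" by linarith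
  qed (use T in auto)
qed

lemma determined_resolvent_power: "0 < t \<Longrightarrow> stieltjes_determined \<mu> (\<lambda>x. (1 / (x + t)) ^ k)"
proof (induction k arbitrary: t)
  case 0
  thus ?case using determined_const[of 1] by simp
next
  case (Suc k)
  show ?case
  proof (cases "k = 0")
    case True
    thus ?thesis using determined_resolvent[OF Suc.prems] by simp
  next
    case False
    show ?thesis
    proof (rule determined_uniform_limit[OF admissible_resolvent_power[OF Suc.prems]])
      fix \<eta> :: real assume \<eta>: "0 < \<eta>"
    \<comment> \<open>The step for which the error bound of the difference quotient equals \<open>\<eta>\<close>.\<close>
      define h where "h = \<eta> / (real k * (1 / t) ^ (k + 2))"
      have h: "0 < h" "real k * h * (1 / t) ^ (k + 2) = \<eta>" using \<eta> False Suc.prems by (auto simp: h_def)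
      let ?g = "\<lambda>x. (1 / (real k * h)) * ((1 / (x + t)) ^ k + (- 1) * (1 / (x + (t + h))) ^ k)"
      show "\<exists>g. stieltjes_determined \<mu> g \<and> admissible g \<and> (\<forall>x\<ge>0. \<bar>(1 / (x + t)) ^ Suc k - g x\<bar> \<le> \<eta>)"
      proof (intro exI[of _ ?g] conjI allI impI)
        have th: "0 < t + h" using h Suc.prems by simp
        note adm = admissible_resolvent_power[OF Suc.prems] admissible_scale[OF admissible_resolvent_power[OF th]]
        show "admissible ?g" by (intro admissible_scale[OF admissible_add] adm)
        show "stieltjes_determined \<mu> ?g"
          by (intro determined_scale[OF determined_add] determined_scale adm admissible_add Suc.IH Suc.prems th admissible_resolvent_power)
        fix x :: real assume "0 \<le> x"
        from resolvent_power_difference[OF this Suc.prems h(1), of k] False h(2)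
        show "\<bar>(1 / (x + t)) ^ Suc k - ?g x\<bar> \<le> \<eta>" by simp
      qed
    qed
  qed
qed

lemma determined_continuous:
  assumes q: "continuous_on {0..1} (q :: real \<Rightarrow> real)" and adm: "admissible (\<lambda>x. q (1 / (x + 1)))"
  shows "stieltjes_determined \<mu> (\<lambda>x. q (1 / (x + 1)))"
proof (rule determined_uniform_limit[OF adm])
  fix \<eta> :: real assume \<eta>: "0 < \<eta>"
  obtain P where P: "real_polynomial_function P" "\<And>u. u \<in> {0..1} \<Longrightarrow> \<bar>q u - P u\<bar> < \<eta>"
    using Stone_Weierstrass_real_polynomial_function[OF _ q \<eta>] by auto
  then obtain c m where c: "P = (\<lambda>u. \<Sum>i\<le>m. c i * u ^ i)" unfolding real_polynomial_function_iff_sum by blast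
  have det: "stieltjes_determined \<mu> (\<lambda>x. \<Sum>i\<le>m. c i * (1 / (x + 1)) ^ i) \<and> admissible (\<lambda>x. \<Sum>i\<le>m. c i * (1 / (x + 1)) ^ i)" for m
  proof (induction m)
    case 0
    show ?case using determined_const admissible_const by simp
  next
    case (Suc m)
    show ?case unfolding sum.atMost_Suc
      by (intro conjI determined_add admissible_add determined_scale admissible_scale
          determined_resolvent_power admissible_resolvent_power) (use Suc in auto)
  qed
  show "\<exists>g. stieltjes_determined \<mu> g \<and> admissible g \<and> (\<forall>x\<ge>0. \<bar>q (1 / (x + 1)) - g x\<bar> \<le> \<eta>)"
  proof (intro exI[of _ "\<lambda>x. \<Sum>i\<le>m. c i * (1 / (x + 1)) ^ i"] conjI allI impI)
    fix x :: real assume "0 \<le> x"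
    hence "1 / (x + 1) \<in> {0..1}" by simp
    from P(2)[OF this] show "\<bar>q (1 / (x + 1)) - (\<Sum>i\<le>m. c i * (1 / (x + 1)) ^ i)\<bar> \<le> \<eta>" by (simp add: c)
  qed (use det in auto)
qed

lemma determined_ramp:
  assumes "0 \<le> s" "0 < d" shows "stieltjes_determined \<mu> (ramp s d)"
proof -
  let ?q = "\<lambda>u::real. max 0 (min 1 ((u - 1 / (s + d + 1)) / (1 / (s + 1) - 1 / (s + d + 1))))"
  have "continuous_on {0..1} ?q"
    using ramp_denominator_pos[OF assms] by (intro continuous_intros) auto
  thus ?thesis using determined_continuous[of ?q] admissible_ramp[of s d] unfolding ramp_def[abs_def] by simp
qed

text \<open>Distribution functions are enclosed between the means of ramps on a grid of step \<open>\<epsilon> / 2\<close>; a shift by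
  \<open>\<epsilon>\<close> covers two grid cells. Tightness makes finitely many grid points sufficient.\<close>

lemma stieltjes_levy_continuity:
  assumes tight: "\<And>\<eta>. 0 < \<eta> \<Longrightarrow> \<exists>A. 1 - \<eta> \<le> \<mu> (indicat_real {..A})" and \<epsilon>: "0 < \<epsilon>"
  shows "\<exists>T \<delta>. finite T \<and> T \<subseteq> {0<..} \<and> 0 < \<delta> \<and>
     (\<forall>\<nu>. stieltjes_close \<nu> \<mu> T \<delta> \<longrightarrow>
        levy_dist (\<lambda>x. \<nu> (indicat_real {..x})) (\<lambda>x. \<mu> (indicat_real {..x})) \<le> \<epsilon>)"
proof -
  define d where "d = \<epsilon> / 2"
  have d: "0 < d" "\<epsilon> = d + d" using \<epsilon> by (simp_all add: d_def)
  have cdf_mono: "I (indicat_real {..a}) \<le> I (indicat_real {..b})" if "mean_functional I" "a \<le> b" for I a b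
    by (rule mean_functionalD(3)[OF that(1) admissible_indicator admissible_indicator])
       (use that(2) in \<open>auto simp: indicator_def\<close>)
  have cdf_le1: "I (indicat_real {..a}) \<le> 1" if "mean_functional I" for I a
    using mean_functionalD(3)[OF that admissible_indicator admissible_const[of 1], of a] mean_functionalD(4)[OF that]
    by (simp add: indicator_def)
  have cdf_ge0: "0 \<le> I (indicat_real {..a})" if "mean_functional I" for I a
    using mean_functionalD(3)[OF that admissible_scale[OF admissible_const[of 1], of 0] admissible_indicator, of a]
      mean_functionalD(2)[OF that admissible_const[of 1], of 0] by simp
  have cdf_neg: "I (indicat_real {..a}) = 0" if "mean_functional I" "a < 0" for I a
    using mean_functionalD(3)[OF that(1) admissible_indicator[of a] admissible_scale[OF admissible_const[of 1], of 0]]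
      mean_functionalD(2)[OF that(1) admissible_const[of 1], of 0] cdf_ge0[OF that(1), of a] that(2)
    by (force simp: indicator_def)
  have ramp_mean: "I (indicat_real {..s}) \<le> I (ramp s d)" "I (ramp s d) \<le> I (indicat_real {..s + d})"
    if "mean_functional I" "0 \<le> s" for I s
    by (rule mean_functionalD(3)[OF that(1)]; use admissible_indicator admissible_ramp ramp_bounds[OF that(2) d(1)] in blast)+
  obtain A where A: "1 - d \<le> \<mu> (indicat_real {..A})" using tight[OF d(1)] by blast
  define m where "m = nat \<lceil>A / d\<rceil>"
  have "A / d \<le> real m" unfolding m_def by linarith
  hence "A \<le> real m * d" using d by (simp add: field_simps)
  hence m: "1 - d \<le> \<mu> (indicat_real {..real m * d})" using A cdf_mono[OF \<mu>] order.trans by blast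
  have "\<forall>i. \<exists>T \<delta>. finite T \<and> T \<subseteq> {0<..} \<and> 0 < \<delta> \<and>
      (\<forall>\<nu>. stieltjes_close \<nu> \<mu> T \<delta> \<longrightarrow> \<bar>\<nu> (ramp (real i * d) d) - \<mu> (ramp (real i * d) d)\<bar> \<le> d)"
    using determined_ramp[OF _ d(1)] d unfolding stieltjes_determined_def by simp
  then obtain T \<delta> where T: "\<And>i::nat. finite (T i)" "\<And>i. T i \<subseteq> {0<..}" "\<And>i. 0 < \<delta> i"
    "\<And>i \<nu>. stieltjes_close \<nu> \<mu> (T i) (\<delta> i) \<Longrightarrow> \<bar>\<nu> (ramp (real i * d) d) - \<mu> (ramp (real i * d) d)\<bar> \<le> d"
    by metis
  show ?thesis
  proof (intro exI[of _ "\<Union>i\<le>m. T i"] exI[of _ "Min (\<delta> ` {..m})"] conjI allI impI)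
    fix \<nu> assume close: "stieltjes_close \<nu> \<mu> (\<Union>i\<le>m. T i) (Min (\<delta> ` {..m}))"
    hence \<nu>: "mean_functional \<nu>" by (simp add: stieltjes_close_def)
    have near: "\<bar>\<nu> (ramp (real i * d) d) - \<mu> (ramp (real i * d) d)\<bar> \<le> d" if "i \<le> m" for i
      by (rule T(4)[OF stieltjes_close_mono[OF close]]) (use that in auto)
    let ?F = "\<lambda>x. \<nu> (indicat_real {..x})" and ?G = "\<lambda>x. \<mu> (indicat_real {..x})"
    have FG: "?F (real i * d) \<le> ?G (real i * d + d) + d" "?G (real i * d) \<le> ?F (real i * d + d) + d" if "i \<le> m" for i
      using near[OF that] ramp_mean[OF \<nu>, of "real i * d"] ramp_mean[OF \<mu>, of "real i * d"] d by auto
    have "?F (x - \<epsilon>) - \<epsilon> \<le> ?G x \<and> ?G x \<le> ?F (x + \<epsilon>) + \<epsilon>" for x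
    proof (cases "x < 0")
      case True
      thus ?thesis using cdf_neg[OF \<nu>, of "x - \<epsilon>"] cdf_neg[OF \<mu>, of x] cdf_ge0[OF \<nu>, of "x + \<epsilon>"] \<epsilon> by simp
    next
      case False
      define i where "i = nat \<lfloor>x / d\<rfloor>"
      have "real i \<le> x / d" "x / d < real i + 1" using False d by (simp_all add: i_def)
      hence i: "real i * d \<le> x" "x < real i * d + d" using d by (simp_all add: field_simps)
      have left: "?F (x - \<epsilon>) - \<epsilon> \<le> ?G x"
      proof (cases "i = 0")
        case True
        hence "x - \<epsilon> < 0" using i d by simp
        thus ?thesis using cdf_neg[OF \<nu>] cdf_ge0[OF \<mu>, of x] \<epsilon> by simp
      next
        case False
        then obtain j where j: "i = Suc j" by (cases i) auto
        have xj: "x - \<epsilon> \<le> real j * d" "real j * d + d \<le> x" using i d by (simp_all add: j algebra_simps)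
        show ?thesis
        proof (cases "j \<le> m")
          case True
          thus ?thesis using cdf_mono[OF \<nu> xj(1)] FG(1)[OF True] cdf_mono[OF \<mu> xj(2)] d by linarith
        next
          case False
          hence "real m * d \<le> real j * d" using d by (intro mult_right_mono) auto
          hence "real m * d \<le> x" using xj d by linarith
          thus ?thesis using m cdf_mono[OF \<mu>, of "real m * d" x] cdf_le1[OF \<nu>, of "x - \<epsilon>"] d by linarith
        qed
      qed
      have right: "?G x \<le> ?F (x + \<epsilon>) + \<epsilon>"
      proof (cases "Suc i \<le> m")
        case True
        have xi: "x \<le> real (Suc i) * d" "real (Suc i) * d + d \<le> x + \<epsilon>" using i d by (simp_all add: algebra_simps)
        show ?thesis using cdf_mono[OF \<mu> xi(1)] FG(2)[OF True] cdf_mono[OF \<nu> xi(2)] d by linarith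
      next
        case False
        hence "real m * d \<le> real i * d" using d by (intro mult_right_mono) auto
        hence "real m * d + d \<le> x + \<epsilon>" using i d by linarith
        thus ?thesis using m FG(2)[of m] cdf_mono[OF \<nu>, of "real m * d + d" "x + \<epsilon>"] cdf_le1[OF \<mu>, of x] d by simp
      qed
      show ?thesis using left right by blast
    qed
    thus "levy_dist ?F ?G \<le> \<epsilon>"
      unfolding levy_dist_def using \<epsilon> by (intro cInf_lower bdd_belowI[of _ 0]) auto
  qed (use T in \<open>auto simp: Min_gr_iff\<close>)
qed

end

section \<open>The Marchenko--Pastur law\<close>

context
  fixes b c t :: real
  assumes bc: "b < c" and bt: "0 \<le> b + t"
begin

text \<open>Obtained from the substitution \<open>w\<^sup>2 = (x - b) / (c - x)\<close>, which makes the integrand rational. For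
  \<open>b + t = 0\<close> the last term vanishes because of its factor, so the formula covers this case as well.\<close>

definition semicircle_primitive :: "real \<Rightarrow> real" where
  "semicircle_primitive x = sqrt ((c - x) * (x - b)) + (b + c + 2 * t) * arctan (sqrt ((x - b) / (c - x)))
     - 2 * sqrt ((b + t) * (c + t)) * arctan (sqrt ((c + t) / (b + t)) * sqrt ((x - b) / (c - x)))"

lemma semicircle_primitive_deriv:
  assumes x: "b < x" "x < c"
  shows "(semicircle_primitive has_real_derivative sqrt ((c - x) * (x - b)) / (x + t)) (at x)"
proof -
  define q where "q = sqrt ((c - x) * (x - b))"
  define w where "w = sqrt ((x - b) / (c - x))"
  define \<kappa> where "\<kappa> = sqrt ((c + t) / (b + t))"
  have q: "0 < q" "q\<^sup>2 = (c - x) * (x - b)" using x by (simp_all add: q_def)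
  have w: "0 < w" "w\<^sup>2 = (x - b) / (c - x)" using x by (simp_all add: w_def)
  have wq: "w * (c - x) = q"
  proof -
    have "(w * (c - x))\<^sup>2 = q\<^sup>2" using x by (simp add: power_mult_distrib w q) (simp add: power2_eq_square)
    thus ?thesis by (rule power2_eq_imp_eq) (use x w q in auto)
  qed
  have xt: "0 < x + t" "0 < c + t" using x bt by linarith+
  have dq: "((\<lambda>x. sqrt ((c - x) * (x - b))) has_real_derivative (b + c - 2 * x) / (2 * q)) (at x)"
  proof -
    have "((\<lambda>x. (c - x) * (x - b)) has_real_derivative b + c - 2 * x) (at x)"
      by (auto intro!: derivative_eq_intros)
    moreover have "0 < (c - x) * (x - b)" using x by simp
    ultimately have "((\<lambda>x. sqrt ((c - x) * (x - b))) has_real_derivative inverse q / 2 * (b + c - 2 * x)) (at x)"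
      unfolding q_def by (intro DERIV_chain2[OF DERIV_real_sqrt])
    thus ?thesis by (rule DERIV_cong) (simp add: field_simps)
  qed
  have dr: "((\<lambda>x. (x - b) / (c - x)) has_real_derivative (c - b) / (c - x)\<^sup>2) (at x)"
    using x by (auto intro!: derivative_eq_intros simp: field_simps power2_eq_square)
  have dw: "((\<lambda>x. sqrt ((x - b) / (c - x))) has_real_derivative (c - b) / (c - x)\<^sup>2 / (2 * w)) (at x)"
  proof -
    have "0 < (x - b) / (c - x)" using x by simp
    hence "((\<lambda>x. sqrt ((x - b) / (c - x))) has_real_derivative inverse w / 2 * ((c - b) / (c - x)\<^sup>2)) (at x)"
      unfolding w_def by (intro DERIV_chain2[OF DERIV_real_sqrt] dr)
    thus ?thesis by (rule DERIV_cong) (simp add: field_simps)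
  qed
  have dw': "(c - b) / (c - x)\<^sup>2 / (2 * w) = (c - b) / (2 * q * (c - x))"
    unfolding wq[symmetric] using x w by (simp add: field_simps power2_eq_square)
  have datan: "((\<lambda>x. arctan (sqrt ((x - b) / (c - x)))) has_real_derivative 1 / (2 * q)) (at x)"
  proof -
    have w1: "1 + w\<^sup>2 = (c - b) / (c - x)" using x by (simp add: w field_simps)
    have "inverse (1 + w\<^sup>2) * ((c - b) / (c - x)\<^sup>2 / (2 * w)) = 1 / (2 * q)"
    proof -
      have "inverse (D / E) * (D / (2 * q * E)) = 1 / (2 * q)" if "D \<noteq> 0" "E \<noteq> 0" for D E
        using that q(1) by (simp add: field_simps)
      from this[of "c - b" "c - x"] show ?thesis unfolding dw' w1 using x bc by simp
    qed
    thus ?thesis using DERIV_chain2[OF DERIV_arctan dw] by (simp add: w_def)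
  qed
  have datan2: "((\<lambda>x. 2 * sqrt ((b + t) * (c + t)) * arctan (\<kappa> * sqrt ((x - b) / (c - x)))) has_real_derivative
      (b + t) * (c + t) / (q * (x + t))) (at x)"
  proof (cases "b + t = 0")
    case True
    thus ?thesis by simp
  next
    case False
    hence bt': "0 < b + t" using bt by simp
    have \<kappa>: "0 < \<kappa>" "\<kappa>\<^sup>2 = (c + t) / (b + t)" using bt' xt by (simp_all add: \<kappa>_def)
    have w2: "1 + (\<kappa> * w)\<^sup>2 = (x + t) * (c - b) / ((b + t) * (c - x))"
    proof -
      have "1 + C / A * (Z / E) = (A * E + C * Z) / (A * E)" if "A \<noteq> 0" "E \<noteq> 0" for A C E Z :: real
        using that by (simp add: field_simps)
      moreover have "(b + t) * (c - x) + (c + t) * (x - b) = (x + t) * (c - b)" by (simp add: algebra_simps)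
      ultimately show ?thesis using x bt' by (simp add: power_mult_distrib \<kappa> w)
    qed
    have e1: "inverse (1 + (\<kappa> * w)\<^sup>2) * (\<kappa> * ((c - b) / (c - x)\<^sup>2 / (2 * w))) = \<kappa> * (b + t) / (2 * q * (x + t))"
    proof -
      have "inverse (F * D / (A * E)) * (\<kappa> * (D / (2 * q * E))) = \<kappa> * A / (2 * q * F)"
        if "D \<noteq> 0" "E \<noteq> 0" "F \<noteq> 0" "A \<noteq> 0" for D E F A
        using that q(1) by (simp add: field_simps)
      from this[of "c - b" "c - x" "x + t" "b + t"] show ?thesis unfolding dw' w2 using x bc xt bt' by simp
    qed
    have e2: "2 * sqrt ((b + t) * (c + t)) * (\<kappa> * (b + t) / (2 * q * (x + t))) = (b + t) * (c + t) / (q * (x + t))"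
    proof -
      have "sqrt ((b + t) * (c + t)) * \<kappa> = sqrt (((b + t) * (c + t)) * ((c + t) / (b + t)))"
        unfolding \<kappa>_def by (rule real_sqrt_mult[symmetric])
      also have "((b + t) * (c + t)) * ((c + t) / (b + t)) = (c + t)\<^sup>2" using bt' by (simp add: power2_eq_square)
      finally have "sqrt ((b + t) * (c + t)) * \<kappa> = c + t" using xt by simp
      moreover have "2 * sqrt ((b + t) * (c + t)) * (\<kappa> * (b + t) / (2 * q * (x + t)))
         = (sqrt ((b + t) * (c + t)) * \<kappa>) * (b + t) / (q * (x + t))" by simp
      ultimately show ?thesis by (simp add: mult.commute)
    qed
    have "((\<lambda>x. arctan (\<kappa> * sqrt ((x - b) / (c - x)))) has_real_derivative
        inverse (1 + (\<kappa> * w)\<^sup>2) * (\<kappa> * ((c - b) / (c - x)\<^sup>2 / (2 * w)))) (at x)"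
      unfolding w_def by (intro DERIV_chain2[OF DERIV_arctan] DERIV_cmult dw[unfolded w_def])
    from DERIV_cmult[OF this, of "2 * sqrt ((b + t) * (c + t))"] show ?thesis unfolding e1 e2 .
  qed
  have "(semicircle_primitive has_real_derivative (b + c - 2 * x) / (2 * q) + (b + c + 2 * t) * (1 / (2 * q))
      - (b + t) * (c + t) / (q * (x + t))) (at x)"
    unfolding semicircle_primitive_def[abs_def] \<kappa>_def[symmetric]
    by (intro DERIV_diff DERIV_add dq DERIV_cmult datan datan2)
  moreover have "(b + c - 2 * x) / (2 * q) + (b + c + 2 * t) * (1 / (2 * q)) - (b + t) * (c + t) / (q * (x + t))
     = q / (x + t)"
  proof -
    have "(b + c - 2 * x) / (2 * q) + (b + c + 2 * t) * (1 / (2 * q)) - (b + t) * (c + t) / (q * (x + t))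
      = ((c - x) * (x - b)) / (q * (x + t))"
      using q(1) xt by (simp add: divide_simps) (simp add: algebra_simps)
    also have "\<dots> = q / (x + t)" unfolding q(2)[symmetric] using q(1) by (simp add: power2_eq_square)
    finally show ?thesis .
  qed
  ultimately show ?thesis unfolding q_def by simp
qed

lemma semicircle_primitive_limits:
  "(semicircle_primitive \<longlongrightarrow> 0) (at_right b)"
  "(semicircle_primitive \<longlongrightarrow> pi * ((b + c) / 2 + t - sqrt ((b + t) * (c + t)))) (at_left c)"
proof -
  have "isCont semicircle_primitive b"
    unfolding semicircle_primitive_def[abs_def] using bc by (intro continuous_intros) auto
  hence "(semicircle_primitive \<longlongrightarrow> semicircle_primitive b) (at_right b)"
    unfolding isCont_def by (rule filterlim_mono) (auto intro: at_le)
  thus "(semicircle_primitive \<longlongrightarrow> 0) (at_right b)" by (simp add: semicircle_primitive_def)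
  have ev: "eventually (\<lambda>x. x \<in> {b<..<c}) (at_left c)"
    using bc by (simp add: eventually_at_left_field) blast
  have "LIM x at_left c. (x - b) / (c - x) :> at_top"
  proof (rule LIM_at_top_divide)
    show "((\<lambda>x. x - b) \<longlongrightarrow> c - b) (at_left c)" by (intro tendsto_intros)
    show "((\<lambda>x. c - x) \<longlongrightarrow> 0) (at_left c)" by (auto intro!: tendsto_eq_intros)
    show "eventually (\<lambda>x. 0 < c - x) (at_left c)" using ev by eventually_elim auto
  qed (use bc in simp)
  hence w: "LIM x at_left c. sqrt ((x - b) / (c - x)) :> at_top"
    by (rule filterlim_compose[OF sqrt_at_top])
  have at1: "((\<lambda>x. arctan (sqrt ((x - b) / (c - x)))) \<longlongrightarrow> pi / 2) (at_left c)"
    by (rule filterlim_compose[OF tendsto_arctan_at_top w])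
  have at2: "((\<lambda>x. 2 * sqrt ((b + t) * (c + t)) * arctan (sqrt ((c + t) / (b + t)) * sqrt ((x - b) / (c - x))))
     \<longlongrightarrow> 2 * sqrt ((b + t) * (c + t)) * (pi / 2)) (at_left c)"
  proof (cases "b + t = 0")
    case False
    hence "0 < sqrt ((c + t) / (b + t))" using bt bc by simp
    hence "LIM x at_left c. sqrt ((c + t) / (b + t)) * sqrt ((x - b) / (c - x)) :> at_top"
      using w by (intro filterlim_tendsto_pos_mult_at_top[OF tendsto_const])
    thus ?thesis by (intro tendsto_mult tendsto_const filterlim_compose[OF tendsto_arctan_at_top])
  qed simp
  have "((\<lambda>x. sqrt ((c - x) * (x - b))) \<longlongrightarrow> sqrt ((c - c) * (c - b))) (at_left c)"
    by (intro tendsto_intros)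
  from tendsto_diff[OF tendsto_add[OF this tendsto_mult[OF tendsto_const[of "b + c + 2 * t"] at1]] at2]
  have "((\<lambda>x. sqrt ((c - x) * (x - b)) + (b + c + 2 * t) * arctan (sqrt ((x - b) / (c - x))) - 2 * sqrt ((b + t) * (c + t)) * arctan (sqrt ((c + t) / (b + t)) * sqrt ((x - b) / (c - x))))
     \<longlongrightarrow> sqrt ((c - c) * (c - b)) + (b + c + 2 * t) * (pi / 2) - 2 * sqrt ((b + t) * (c + t)) * (pi / 2)) (at_left c)" .
  moreover have "sqrt ((c - c) * (c - b)) + (b + c + 2 * t) * (pi / 2) - 2 * sqrt ((b + t) * (c + t)) * (pi / 2)
     = pi * ((b + c) / 2 + t - sqrt ((b + t) * (c + t)))" by (simp add: algebra_simps add_divide_distrib)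
  ultimately show "(semicircle_primitive \<longlongrightarrow> pi * ((b + c) / 2 + t - sqrt ((b + t) * (c + t)))) (at_left c)"
    unfolding semicircle_primitive_def[abs_def] by (simp only:)
qed

lemma semicircle_resolvent_integral:
  "set_integrable lborel {b..c} (\<lambda>x. sqrt ((c - x) * (x - b)) / (x + t))"
  "(LINT x:{b..c}|lborel. sqrt ((c - x) * (x - b)) / (x + t)) = pi * ((b + c) / 2 + t - sqrt ((b + t) * (c + t)))"
proof -
  let ?f = "\<lambda>x. sqrt ((c - x) * (x - b)) / (x + t)"
  have lt: "ereal b < ereal c" using bc by simp
  have "set_integrable lborel (einterval b c) ?f" "(LBINT x=ereal b..ereal c. ?f x) = pi * ((b + c) / 2 + t - sqrt ((b + t) * (c + t))) - 0"
  proof -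
    have A: "((semicircle_primitive \<circ> real_of_ereal) \<longlongrightarrow> 0) (at_right (ereal b))"
      using semicircle_primitive_limits(1) by (simp add: ereal_tendsto_simps)
    have B: "((semicircle_primitive \<circ> real_of_ereal) \<longlongrightarrow> pi * ((b + c) / 2 + t - sqrt ((b + t) * (c + t)))) (at_left (ereal c))"
      using semicircle_primitive_limits(2) by (simp add: ereal_tendsto_simps)
    have der: "(semicircle_primitive has_real_derivative ?f x) (at x)" if "ereal b < ereal x" "ereal x < ereal c" for x
      using semicircle_primitive_deriv that by simp
    have cont: "isCont ?f x" if "ereal b < ereal x" "ereal x < ereal c" for x
      using that bt by (intro continuous_intros) auto
    have nonneg: "AE x in lborel. ereal b < ereal x \<longrightarrow> ereal x < ereal c \<longrightarrow> 0 \<le> ?f x"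
      using bt by (intro always_eventually) auto
    show "set_integrable lborel (einterval b c) ?f" "(LBINT x=ereal b..ereal c. ?f x) = pi * ((b + c) / 2 + t - sqrt ((b + t) * (c + t))) - 0"
      using interval_integral_FTC_nonneg[OF lt der cont nonneg A B] by auto
  qed
  hence i: "set_integrable lborel {b<..<c} ?f" "(LINT x:{b<..<c}|lborel. ?f x) = pi * ((b + c) / 2 + t - sqrt ((b + t) * (c + t)))"
    using bc by (simp_all add: interval_lebesgue_integral_def)
  have ae: "AE x in lborel. indicator {b<..<c} x *\<^sub>R ?f x = indicator {b..c} x *\<^sub>R ?f x"
    using AE_lborel_singleton[of b] AE_lborel_singleton[of c]
    by eventually_elim (auto simp: indicator_def)
  show "set_integrable lborel {b..c} ?f"
    using i(1) unfolding set_integrable_def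
    by (subst integrable_cong_AE[symmetric, OF _ _ ae]) auto
  show "(LINT x:{b..c}|lborel. ?f x) = pi * ((b + c) / 2 + t - sqrt ((b + t) * (c + t)))"
    using i(2) unfolding set_lebesgue_integral_def
    by (subst integral_cong_AE[symmetric, OF _ _ ae]) auto
qed

end

text \<open>The weight at the origin is \<open>1 - 1 / y\<close> if \<open>y > 1\<close> and \<open>0\<close> otherwise.\<close>

definition mp_mean :: "real \<Rightarrow> (real \<Rightarrow> real) \<Rightarrow> real" where
  "mp_mean y h = (LINT x|lborel. mp_density y x * h x) + max 0 (1 - 1 / y) * h 0"

context
  fixes y :: real
  assumes y: "0 < y"
begin

definition edge_low :: real where "edge_low = (1 - sqrt y)\<^sup>2"
definition edge_high :: real where "edge_high = (1 + sqrt y)\<^sup>2"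

lemma edges: "0 \<le> edge_low" "edge_low < edge_high" "(edge_low + edge_high) / 2 = 1 + y"
  "(edge_low + t) * (edge_high + t) = (1 - y + t)\<^sup>2 + 4 * y * t"
proof -
  have s: "0 < sqrt y" "(sqrt y)\<^sup>2 = y" using y by simp_all
  show "0 \<le> edge_low" by (simp add: edge_low_def)
  have "edge_high - edge_low = 4 * sqrt y" by (simp add: edge_low_def edge_high_def power2_eq_square algebra_simps)
  thus "edge_low < edge_high" using s(1) by linarith
  have sum: "edge_low + edge_high = 2 * (1 + y)"
    using s(2) by (simp add: edge_low_def edge_high_def power2_eq_square algebra_simps)
  thus "(edge_low + edge_high) / 2 = 1 + y" by simp
  have "edge_low * edge_high = ((1 - sqrt y) * (1 + sqrt y))\<^sup>2"
    by (simp add: edge_low_def edge_high_def power_mult_distrib)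
  also have "(1 - sqrt y) * (1 + sqrt y) = 1 - y" using s(2) by (simp add: power2_eq_square algebra_simps)
  finally have prod: "edge_low * edge_high = (1 - y)\<^sup>2" .
  have mid: "(edge_low + t) * (edge_high + t) = edge_low * edge_high + (edge_low + edge_high) * t + t * t"
    by (simp add: algebra_simps)
  show "(edge_low + t) * (edge_high + t) = (1 - y + t)\<^sup>2 + 4 * y * t"
    unfolding mid prod sum by (simp add: power2_eq_square algebra_simps)
qed

definition semicircle :: "real \<Rightarrow> real" where
  "semicircle x = sqrt ((edge_high - x) * (x - edge_low))"

text \<open>The summand \<open>0\<close> in the denominator exhibits the density as the case \<open>t = 0\<close> of the semicircle integral.\<close>

lemma mp_density_semicircle:
  "mp_density y x = 1 / (2 * pi * y) * (indicat_real {edge_low..edge_high} x * (semicircle x / (x + 0)))"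
  by (simp add: mp_density_def Let_def edge_low_def edge_high_def semicircle_def mult_ac)

lemma semicircle_integral:
  assumes "0 \<le> t"
  shows "integrable lborel (\<lambda>x. indicat_real {edge_low..edge_high} x * (semicircle x / (x + t)))"
    "(LINT x|lborel. indicat_real {edge_low..edge_high} x * (semicircle x / (x + t))) = pi * (1 + y + t - sqrt ((1 - y + t)\<^sup>2 + 4 * y * t))"
proof -
  have bt: "0 \<le> edge_low + t" using edges(1) assms by simp
  from semicircle_resolvent_integral[OF edges(2) bt]
  show "integrable lborel (\<lambda>x. indicat_real {edge_low..edge_high} x * (semicircle x / (x + t)))"
    "(LINT x|lborel. indicat_real {edge_low..edge_high} x * (semicircle x / (x + t))) = pi * (1 + y + t - sqrt ((1 - y + t)\<^sup>2 + 4 * y * t))"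
    unfolding set_integrable_def set_lebesgue_integral_def semicircle_def edges(3) edges(4) by simp_all
qed

lemma mp_density_nonneg: "0 \<le> mp_density y x"
  using y edges(1) unfolding mp_density_semicircle by (auto simp: indicator_def semicircle_def intro!: mult_nonneg_nonneg)

lemma mp_density_zero: "x < 0 \<Longrightarrow> mp_density y x = 0"
  using edges(1) unfolding mp_density_semicircle by (auto simp: indicator_def)

lemma mp_density_integrable: "integrable lborel (mp_density y)"
  unfolding mp_density_semicircle[abs_def] by (intro integrable_mult_right semicircle_integral) simp

lemma mp_integrable:
  assumes "admissible h" shows "integrable lborel (\<lambda>x. mp_density y x * h x)"
proof -
  from assms obtain B where m: "h \<in> borel_measurable borel" and B: "\<And>x. 0 \<le> x \<Longrightarrow> \<bar>h x\<bar> \<le> B"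
    unfolding admissible_def by blast
  show ?thesis
  proof (rule Bochner_Integration.integrable_bound[of _ "\<lambda>x. B * mp_density y x"])
    show "integrable lborel (\<lambda>x. B * mp_density y x)" using mp_density_integrable by simp
    show "(\<lambda>x. mp_density y x * h x) \<in> borel_measurable lborel"
      using borel_measurable_integrable[OF mp_density_integrable] m by measurable
    have "\<bar>mp_density y x * h x\<bar> \<le> \<bar>B * mp_density y x\<bar>" for x
    proof (cases "x < 0")
      case False
      hence "\<bar>h x\<bar> \<le> \<bar>B\<bar>" using B[of x] by linarith
      thus ?thesis unfolding abs_mult using mult_left_mono[of "\<bar>h x\<bar>" "\<bar>B\<bar>" "\<bar>mp_density y x\<bar>"] by (simp add: mult.commute)
    qed (simp add: mp_density_zero)
    thus "AE x in lborel. norm (mp_density y x * h x) \<le> norm (B * mp_density y x)" by simp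
  qed
qed

lemma mp_mean_functional: "mean_functional (mp_mean y)"
  unfolding mean_functional_def
proof (intro conjI allI impI)
  fix f g :: "real \<Rightarrow> real" and c :: real assume f: "admissible f"
  show "mp_mean y (\<lambda>x. c * f x) = c * mp_mean y f"
    unfolding mp_mean_def using mp_integrable[OF f]
    by (simp add: mult.left_commute[of _ c] distrib_left)
  assume g: "admissible g"
  show "mp_mean y (\<lambda>x. f x + g x) = mp_mean y f + mp_mean y g"
    unfolding mp_mean_def using mp_integrable[OF f] mp_integrable[OF g]
    by (simp add: distrib_left)
  assume le: "\<forall>x\<ge>0. f x \<le> g x"
  have "mp_density y x * f x \<le> mp_density y x * g x" for x
    using le mp_density_nonneg[of x] mp_density_zero[of x] by (cases "x < 0") (auto intro!: mult_left_mono)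
  hence "(LINT x|lborel. mp_density y x * f x) \<le> (LINT x|lborel. mp_density y x * g x)"
    by (intro integral_mono mp_integrable f g)
  thus "mp_mean y f \<le> mp_mean y g"
    unfolding mp_mean_def using le by (intro add_mono mult_left_mono) auto
next
  have "(LINT x|lborel. mp_density y x) = 1 / (2 * pi * y) * (pi * (1 + y - sqrt ((1 - y)\<^sup>2)))"
    unfolding mp_density_semicircle[abs_def] integral_mult_right_zero using semicircle_integral(2)[of 0] by simp
  also have "\<dots> = (1 + y - \<bar>1 - y\<bar>) / (2 * y)" using y by (simp add: field_simps)
  also have "\<dots> = 1 - max 0 (1 - 1 / y)" using y by (cases "y \<le> 1") (auto simp: field_simps max_def)
  finally show "mp_mean y (\<lambda>_. 1) = 1" unfolding mp_mean_def by simp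
qed

lemma mp_mean_cdf: "mp_mean y (indicat_real {..t}) = mp_cdf y t"
proof -
  have "max 0 (1 - 1 / y) * indicat_real {..t} 0 = (if y > 1 \<and> 0 \<le> t then 1 - 1 / y else 0)"
    using y by (auto simp: indicator_def max_def field_simps)
  thus ?thesis unfolding mp_mean_def mp_cdf_def set_lebesgue_integral_def by (simp add: mult.commute)
qed

lemma mp_mean_tight: "mp_mean y (indicat_real {..edge_high}) = 1"
proof -
  have eq: "mp_density y x * indicat_real {..edge_high} x = mp_density y x * 1" for x
    unfolding mp_density_semicircle by (auto simp: indicator_def)
  have "0 \<le> edge_high" using edges(1,2) by linarith
  hence "mp_mean y (indicat_real {..edge_high}) = mp_mean y (\<lambda>_. 1)" unfolding mp_mean_def eq by simp
  thus ?thesis using mean_functionalD(4)[OF mp_mean_functional] by simp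
qed

text \<open>Partial fractions reduce the integral to the semicircle integrals with parameters \<open>0\<close> and \<open>t\<close>. The term
  \<open>|1 - y|\<close> that arises from the first one is compensated by the atom.\<close>

lemma mp_mean_resolvent:
  assumes t: "0 < t"
  shows "mp_mean y (\<lambda>x. 1 / (x + t)) = (sqrt ((1 - y + t)\<^sup>2 + 4 * y * t) - (1 - y + t)) / (2 * y * t)"
proof -
  let ?I = "indicat_real {edge_low..edge_high}" let ?D = "sqrt ((1 - y + t)\<^sup>2 + 4 * y * t)"
  have split: "mp_density y x * (1 / (x + t)) = 1 / (2 * pi * y * t) * (?I x * (semicircle x / (x + 0)) - ?I x * (semicircle x / (x + t)))" for x
  proof (cases "x \<in> {edge_low..edge_high}")
    case True
    hence x: "0 \<le> x" "x = 0 \<Longrightarrow> semicircle x = 0" using edges(1) by (auto simp: semicircle_def)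
    show ?thesis
    proof (cases "x = 0")
      case False
      hence "0 < x" using x by simp
      thus ?thesis using True t y unfolding mp_density_semicircle by (simp add: field_simps)
    qed (use x in \<open>simp add: mp_density_semicircle\<close>)
  qed (simp add: mp_density_semicircle)
  have "(LINT x|lborel. mp_density y x * (1 / (x + t)))
     = 1 / (2 * pi * y * t) * (pi * (1 + y - sqrt ((1 - y)\<^sup>2)) - pi * (1 + y + t - ?D))"
    unfolding split using semicircle_integral[of 0] semicircle_integral[of t] t by simp
  also have "\<dots> = (?D - t - \<bar>1 - y\<bar>) / (2 * y * t)" using y t by (simp add: field_simps)
  finally have I: "(LINT x|lborel. mp_density y x * (1 / (x + t))) = (?D - t - \<bar>1 - y\<bar>) / (2 * y * t)" .
  have "max 0 (1 - 1 / y) * (1 / (0 + t)) = (\<bar>1 - y\<bar> - (1 - y)) / (2 * y * t)"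
    using y t by (cases "y \<le> 1") (auto simp: field_simps max_def)
  thus ?thesis unfolding mp_mean_def I by (simp add: diff_divide_distrib add_divide_distrib)
qed

end

section \<open>Convergence of the empirical spectral distribution\<close>

text \<open>The positive root \<open>g\<close> of \<open>g (g + (1 - y) / r) + r g = y\<close>, which is the limiting self-consistent equation
  for the normalised trace of the upper block.\<close>

definition mp_root :: "real \<Rightarrow> real \<Rightarrow> real" where
  "mp_root r y = (sqrt ((1 - y + r\<^sup>2)\<^sup>2 + 4 * y * r\<^sup>2) - (1 - y + r\<^sup>2)) / (2 * r)"

lemma mp_root_eq:
  assumes r: "0 < r" and y: "0 < y"
  shows "0 < mp_root r y" "mp_root r y * (mp_root r y + (1 - y) / r + r) = y"
    "r \<le> mp_root r y + (1 - y) / r + r" "mp_root r y \<le> y / r"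
proof -
  let ?g = "mp_root r y" let ?e = "1 - y + r\<^sup>2" let ?D = "sqrt (?e\<^sup>2 + 4 * y * r\<^sup>2)"
  have yr: "0 < 4 * y * r\<^sup>2" using r y by simp
  have D2: "?D\<^sup>2 = ?e\<^sup>2 + 4 * y * r\<^sup>2" using yr by (simp add: add_nonneg_nonneg)
  have "\<bar>?e\<bar> < ?D" using yr by (intro real_less_rsqrt) simp
  thus pos: "0 < ?g" using r by (simp add: mp_root_def)
  have sum: "?g + (1 - y) / r + r = (?D + ?e) / (2 * r)"
    using r by (simp add: mp_root_def field_simps power2_eq_square)
  have "(?D - ?e) * (?D + ?e) = 4 * y * r\<^sup>2" using D2 by (simp add: power2_eq_square algebra_simps)
  thus prod: "?g * (?g + (1 - y) / r + r) = y"
    unfolding sum using r by (simp add: mp_root_def power2_eq_square field_simps)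
  have pos2: "0 < ?g + (1 - y) / r + r" unfolding sum using r \<open>\<bar>?e\<bar> < ?D\<close> by (intro divide_pos_pos) linarith+
  show rle: "r \<le> ?g + (1 - y) / r + r"
  proof (rule ccontr)
    assume nle: "\<not> ?thesis"
    hence less: "?g < (y - 1) / r" using r by (simp add: field_simps)
    have "?g * (?g + (1 - y) / r + r) \<le> ?g * r"
      using pos nle by (intro mult_left_mono) auto
    also have "\<dots> < y - 1" using less r by (simp add: field_simps)
    finally show False using prod by simp
  qed
  have "?g * r \<le> y" using prod mult_left_mono[OF rle, of ?g] pos by simp
  thus "?g \<le> y / r" using r by (simp add: field_simps)
qed

text \<open>The quadratic polynomial factors with second factor at least \<open>r\<close> for nonnegative \<open>g\<close>.\<close>

lemma mp_root_distance:
  assumes r: "0 < r" and y: "0 < y" and g: "0 \<le> g"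
  shows "r * \<bar>g - mp_root r y\<bar> \<le> \<bar>g * (g + (1 - y) / r) + r * g - y\<bar>"
proof -
  let ?m = "mp_root r y"
  have "g * (g + (1 - y) / r) + r * g - y = (g - ?m) * (g + (?m + (1 - y) / r + r))"
  proof -
    have "g * (g + e) + r * g - Y = (g - m) * (g + (m + e + r))" if "m * (m + e + r) = Y" for m e Y
      unfolding that[symmetric] by (simp add: algebra_simps)
    from this[OF mp_root_eq(2)[OF r y]] show ?thesis .
  qed
  hence "\<bar>g * (g + (1 - y) / r) + r * g - y\<bar> = \<bar>g - ?m\<bar> * (g + (?m + (1 - y) / r + r))"
    using g mp_root_eq(3)[OF r y] r by (simp add: abs_mult)
  moreover have "\<bar>g - ?m\<bar> * r \<le> \<bar>g - ?m\<bar> * (g + (?m + (1 - y) / r + r))"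
    using g mp_root_eq(3)[OF r y] by (intro mult_left_mono) auto
  ultimately show ?thesis by (simp add: mult.commute)
qed

lemma upper_trace_nonneg: assumes "0 < r" shows "0 \<le> upper_trace r p n x"
proof -
  have "0 \<le> block_resolvent r p n x i i" if "i < p + n" for i
    using shift_inverse_diag[OF skew_on_block assms that, of p n x] assms
    by (metis block_resolvent_def mult_nonneg_nonneg less_imp_le sum_nonneg zero_le_power2)
  thus ?thesis unfolding upper_trace_def by (intro divide_nonneg_nonneg sum_nonneg) auto
qed

text \<open>The value of \<open>norm_trace\<close> at the positive root, as \<open>g\<^sub>2 = g\<^sub>1 + (1 - p / n) / r\<close>. It uses the ratio
  \<open>p / n\<close> in place of its limit, which keeps the comparison exact for each \<open>n\<close>.\<close>

definition trace_target :: "real \<Rightarrow> nat \<Rightarrow> nat \<Rightarrow> real" where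
  "trace_target r p n = 2 * mp_root r (real p / real n) + (1 - real p / real n) / r"

lemma norm_trace_deviation:
  assumes "0 < r" "0 < n"
  shows "norm_trace r p n x - trace_target r p n = 2 * (upper_trace r p n x - mp_root r (real p / real n))"
  unfolding norm_trace_split lower_trace_eq[OF assms] trace_target_def by simp

lemma trace_deviation_le:
  assumes r: "0 < r" and n: "0 < n" and p: "0 < p"
  shows "(norm_trace r p n x - trace_target r p n)\<^sup>2 \<le> 4 / r\<^sup>2 * (self_consistency r p n x)\<^sup>2"
proof -
  let ?g = "upper_trace r p n x" and ?y = "real p / real n"
  have y: "0 < ?y" using n p by simp
  have "self_consistency r p n x = ?g * (?g + (1 - ?y) / r) + r * ?g - ?y"
    using trace_equations(1)[OF r n, of p x] by (simp add: self_consistency_def lower_trace_eq[OF r n])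
  hence "r * \<bar>?g - mp_root r ?y\<bar> \<le> \<bar>self_consistency r p n x\<bar>"
    using mp_root_distance[OF r y upper_trace_nonneg[OF r]] by simp
  hence "(r * \<bar>?g - mp_root r ?y\<bar>)\<^sup>2 \<le> (self_consistency r p n x)\<^sup>2"
    using r by (simp add: abs_le_square_iff[symmetric] abs_mult)
  hence "r\<^sup>2 * (?g - mp_root r ?y)\<^sup>2 \<le> (self_consistency r p n x)\<^sup>2" by (simp add: power_mult_distrib)
  hence "(?g - mp_root r ?y)\<^sup>2 \<le> (self_consistency r p n x)\<^sup>2 / r\<^sup>2"
    using r by (simp only: pos_le_divide_eq zero_less_power mult.commute)
  thus ?thesis unfolding norm_trace_deviation[OF r n] power_mult_distrib by simp
qed

definition spectral_mean :: "real multiset \<Rightarrow> (real \<Rightarrow> real) \<Rightarrow> real" where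
  "spectral_mean E h = (\<Sum>e\<in>#E. h e) / real (size E)"

lemma spectral_mean_functional:
  assumes "E \<noteq> {#}" "\<And>e. e \<in># E \<Longrightarrow> 0 \<le> e"
  shows "mean_functional (spectral_mean E)"
  unfolding mean_functional_def
proof (intro conjI allI impI)
  fix f g :: "real \<Rightarrow> real" and c :: real
  show "spectral_mean E (\<lambda>x. f x + g x) = spectral_mean E f + spectral_mean E g"
    by (simp add: spectral_mean_def sum_mset.distrib add_divide_distrib)
  show "spectral_mean E (\<lambda>x. c * f x) = c * spectral_mean E f"
  proof -
    have "(\<Sum>e\<in>#E. c * f e) = c * (\<Sum>e\<in>#E. f e)" by (induction E) (simp_all add: distrib_left)
    thus ?thesis by (simp add: spectral_mean_def)
  qed
  assume "\<forall>x\<ge>0. f x \<le> g x"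
  hence "(\<Sum>e\<in>#E. f e) \<le> (\<Sum>e\<in>#E. g e)" using assms(2) by (intro sum_mset_mono) auto
  thus "spectral_mean E f \<le> spectral_mean E g" by (simp add: spectral_mean_def divide_right_mono)
next
  show "spectral_mean E (\<lambda>_. 1) = 1" using assms(1) by (simp add: spectral_mean_def)
qed

theorem theorem12:
  fixes M :: "nat \<Rightarrow> 'a measure"
    and X :: "nat \<Rightarrow> int \<times> int \<Rightarrow> 'a \<Rightarrow> real"
    and p :: "nat \<Rightarrow> nat"
    and y :: real
  assumes prob: "\<And>n. prob_space (M n)"
    and y_pos: "0 < y"
    and ratio: "(\<lambda>n. real (p n) / real n) \<longlonglongrightarrow> y"
    and measurable: "\<And>n k. k \<in> entries (p n) n \<Longrightarrow> X n k \<in> borel_measurable (M n)"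
    and square_integrable:
      "\<And>n k. k \<in> entries (p n) n \<Longrightarrow> integrable (M n) (\<lambda>\<omega>. (X n k \<omega>)\<^sup>2)"
    and centered:
      "\<And>n k. k \<in> entries (p n) n \<Longrightarrow> prob_space.expectation (M n) (X n k) = 0"
    and unit_variance:
      "\<And>n k. k \<in> entries (p n) n \<Longrightarrow> prob_space.variance (M n) (X n k) = 1"
    and martingale_difference:
      "\<And>n k. k \<in> entries (p n) n \<Longrightarrow>
         AE \<omega> in M n.
           real_cond_exp (M n) (sigma_rv (M n) (X n) {u \<in> entries (p n) n. lex_less u k})
             (X n k) \<omega> = 0"
    and conditional_variance:
      "(\<lambda>a. limsup (\<lambda>n. ereal (1 / (real n)\<^sup>2 *
          (\<Sum>i = 1..int (p n). \<Sum>j = 1..int n.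
             prob_space.expectation (M n)
               (\<lambda>\<omega>. \<bar>real_cond_exp (M n)
                       (sigma_rv (M n) (X n) (entries (p n) n \<inter> far_past a (i, j)))
                       (\<lambda>\<omega>. (X n (i, j) \<omega>)\<^sup>2 - 1) \<omega>\<bar>)))))
       \<longlonglongrightarrow> 0"
    and lindeberg:
      "\<And>\<epsilon>::real. \<epsilon> > 0 \<Longrightarrow>
         (\<lambda>n. 1 / (real n)\<^sup>2 *
            (\<Sum>i = 1..int (p n). \<Sum>j = 1..int n.
               prob_space.expectation (M n)
                 (\<lambda>\<omega>. (X n (i, j) \<omega>)\<^sup>2
                    * of_bool (\<bar>X n (i, j) \<omega>\<bar> > \<epsilon> * sqrt (real n)))))
         \<longlonglongrightarrow> 0"
  shows "converges_in_prob M
           (\<lambda>n \<omega>. let A = data_matrix (p n) n (X n) \<omega>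
                   in esd ((1 / real n) \<cdot>\<^sub>m (A * transpose_mat A)))
           (mp_cdf y)"
proof -
  define z where "z n \<omega> = zero_outside (entries (p n) n) (\<lambda>u. X n u \<omega>)" for n \<omega>
  define dev where "dev r n \<omega> = (norm_trace r (p n) n (z n \<omega>) - trace_target r (p n) n)\<^sup>2" for r n \<omega>
  let ?Y = "y + 1"
  have Y_ev: "\<forall>\<^sub>F n in sequentially. real (p n) / real n \<le> ?Y"
    using order_tendstoD(2)[OF ratio, of ?Y] by (auto elim: eventually_mono)
  have half_ev: "\<forall>\<^sub>F n in sequentially. y / 2 < real (p n) / real n"
    using order_tendstoD(1)[OF ratio, of "y / 2"] y_pos by auto
  have second_moment: "(LINT \<omega>|M n. (X n k \<omega>)\<^sup>2) = 1" if "k \<in> entries (p n) n" for n k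
    using unit_variance[OF that] centered[OF that] by simp
  have dev_meas: "dev r n \<in> borel_measurable (M n)" if r: "0 < r" for r n
  proof -
    have m: "norm_trace r (p n) n \<in> borel_measurable vectors"
      unfolding norm_trace_def[abs_def]
      by (intro borel_measurable_divide borel_measurable_sum block_resolvent_measurable borel_measurable_const) auto
    have "z n \<in> measurable (M n) vectors"
      unfolding z_def[abs_def] by (rule measurable_zero_outside[OF measurable])
    from measurable_compose[OF this m] show ?thesis unfolding dev_def[abs_def] by measurable
  qed
  \<comment> \<open>The squared deviation is small in mean for random signs, and replacement transfers this to \<open>X\<close>.\<close>
  have dev_lim: "(\<lambda>n. LINT \<omega>|M n. dev r n \<omega>) \<longlonglongrightarrow> 0"
    and dev_int: "\<forall>\<^sub>F n in sequentially. integrable (M n) (dev r n)" if r: "0 < r" for r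
  proof -
    \<comment> \<open>Large enough for the bounds on \<open>norm_trace\<close> and also for \<open>trace_target\<close>.\<close>
    define c where "c = (3 * ?Y + 2) / r + 2 / r\<^sup>2 + 8 / r ^ 3 + 24 / r ^ 4"
    define F where "F n x = (norm_trace r (p n) n x - trace_target r (p n) n)\<^sup>2" for n x
    have smooth: "\<forall>\<^sub>F n in sequentially. entrywise_smooth (sqrt (real n)) (entries (p n) n) (8 * c\<^sup>2) (F n)"
      using Y_ev half_ev eventually_gt_at_top[of 0]
    proof eventually_elim
      case (elim n)
      have yn: "0 < real (p n) / real n" using elim(2) y_pos by linarith
      have "(real (p n) / real n + 1) / r \<le> (3 * ?Y + 2) / r"
        using elim(1) r y_pos by (intro divide_right_mono) auto
      hence nt: "entrywise_smooth (sqrt (real n)) (entries (p n) n) c (norm_trace r (p n) n)"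
        by (intro norm_trace_smooth r elim(3)) (simp add: c_def)
      have "\<bar>trace_target r (p n) n\<bar> \<le> c"
      proof -
        have "\<bar>trace_target r (p n) n\<bar> \<le> \<bar>2 * mp_root r (real (p n) / real n)\<bar> + \<bar>(1 - real (p n) / real n) / r\<bar>"
          unfolding trace_target_def by (rule abs_triangle_ineq)
        also have "\<bar>2 * mp_root r (real (p n) / real n)\<bar> \<le> 2 * (?Y / r)"
        proof -
          have "mp_root r (real (p n) / real n) \<le> real (p n) / real n / r" by (rule mp_root_eq(4)[OF r yn])
          also have "\<dots> \<le> ?Y / r" using elim(1) r by (intro divide_right_mono) auto
          finally have "2 * mp_root r (real (p n) / real n) \<le> 2 * (?Y / r)" by (rule mult_left_mono) simp
          thus ?thesis using mp_root_eq(1)[OF r yn] by (simp only: abs_of_pos mult_pos_pos zero_less_numeral)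
        qed
        also have "\<bar>(1 - real (p n) / real n) / r\<bar> \<le> (1 + ?Y) / r"
          unfolding abs_divide using elim(1) yn r by (simp add: divide_right_mono abs_le_iff)
        finally have "\<bar>trace_target r (p n) n\<bar> \<le> 2 * (?Y / r) + (1 + ?Y) / r" by simp
        also have "\<dots> \<le> (3 * ?Y + 2) / r" using r by (simp add: add_divide_distrib[symmetric] divide_right_mono)
        also have "\<dots> \<le> c" unfolding c_def using r by simp
        finally show ?thesis .
      qed
      thus ?case unfolding F_def[abs_def]
        using elim(3) by (intro entrywise_smooth_square nt) auto
    qed
    have dep: "depends_on (entries (p n) n) (F n)" for n
      using norm_trace_depends[of "p n" n r] unfolding depends_on_def F_def by metis
    have repl: "(\<lambda>n. (LINT \<omega>|M n. F n (z n \<omega>)) - foldr sign_avg (entry_list (p n) n) (F n) (\<lambda>_. 0)) \<longlonglongrightarrow> 0"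
      unfolding z_def
      by (rule lindeberg_replacement[where c = "8 * c\<^sup>2", OF prob ratio measurable square_integrable second_moment
            martingale_difference conditional_variance lindeberg _ smooth dep]) simp_all
    define q where "q = ?Y / r\<^sup>2 + 2 * ?Y"
    define l where "l = 2 / r\<^sup>2 * (1 / r + ?Y / r + r)"
    define C where "C = ?Y * (8 * (1 / r) ^ 3 * q + (1 / r)\<^sup>2 * l + 1 / r * l) + q * ?Y / r\<^sup>2"
    have upper: "\<forall>\<^sub>F n in sequentially. (LINT \<omega>|M n. dev r n \<omega>) \<le>
        ((LINT \<omega>|M n. F n (z n \<omega>)) - foldr sign_avg (entry_list (p n) n) (F n) (\<lambda>_. 0)) + 4 / r\<^sup>2 * (C / sqrt (real n))"
      using Y_ev half_ev eventually_gt_at_top[of 0]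
    proof eventually_elim
      case (elim n)
      have pn: "0 < p n" using elim(2) y_pos by (intro Nat.gr0I) auto
      have "mean_signs (entry_list (p n) n) (F n)
          \<le> mean_signs (entry_list (p n) n) (\<lambda>x. 4 / r\<^sup>2 * (self_consistency r (p n) n x)\<^sup>2)"
        unfolding F_def[abs_def] by (intro mean_signs_mono trace_deviation_le r elim(3) pn)
      also have "\<dots> = 4 / r\<^sup>2 * mean_signs (entry_list (p n) n) (\<lambda>x. (self_consistency r (p n) n x)\<^sup>2)"
        by (rule mean_signs_scale)
      also have "\<dots> \<le> 4 / r\<^sup>2 * (C / sqrt (real n))"
        unfolding C_def by (intro mult_left_mono mean_signs_self_consistency r elim(3,1) q_def l_def) simp
      finally show ?case unfolding mean_signs_def dev_def F_def by simp
    qed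
    have "(\<lambda>n. 4 / r\<^sup>2 * (C / sqrt (real n))) \<longlonglongrightarrow> 4 / r\<^sup>2 * 0"
      by (intro tendsto_mult tendsto_const tendsto_divide_0[OF tendsto_const]
        filterlim_at_top_imp_at_infinity filterlim_compose[OF sqrt_at_top filterlim_real_sequentially])
    from tendsto_add[OF repl this]
    have sum_lim: "(\<lambda>n. ((LINT \<omega>|M n. F n (z n \<omega>)) - foldr sign_avg (entry_list (p n) n) (F n) (\<lambda>_. 0))
        + 4 / r\<^sup>2 * (C / sqrt (real n))) \<longlonglongrightarrow> 0" by simp
    have "\<forall>\<^sub>F n in sequentially. 0 \<le> (LINT \<omega>|M n. dev r n \<omega>)"
      by (intro always_eventually allI Bochner_Integration.integral_nonneg) (simp add: dev_def)
    from tendsto_sandwich[OF this upper tendsto_const sum_lim]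
    show "(\<lambda>n. LINT \<omega>|M n. dev r n \<omega>) \<longlonglongrightarrow> 0" .
    show "\<forall>\<^sub>F n in sequentially. integrable (M n) (dev r n)"
      using smooth
    proof eventually_elim
      case (elim n)
      interpret prob_space "M n" by (rule prob)
      have "\<bar>dev r n \<omega>\<bar> \<le> 8 * c\<^sup>2" for \<omega>
        using elim unfolding entrywise_smooth_def dev_def F_def by blast
      thus ?case by (intro integrable_const_bound[of _ "8 * c\<^sup>2"] dev_meas r) auto
    qed
  qed
  define eig where "eig n \<omega> = proots (char_poly ((1 / real n) \<cdot>\<^sub>m (data_matrix (p n) n (X n) \<omega> * transpose_mat (data_matrix (p n) n (X n) \<omega>))))" for n \<omega>
  have target_lim: "(\<lambda>n. mp_root r (real (p n) / real n) / (r * (real (p n) / real n))) \<longlonglongrightarrow> mp_mean y (\<lambda>x. 1 / (x + r\<^sup>2))"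
    if r: "0 < r" for r
  proof -
    have "(\<lambda>n. mp_root r (real (p n) / real n) / (r * (real (p n) / real n))) \<longlonglongrightarrow> mp_root r y / (r * y)"
      unfolding mp_root_def using r y_pos by (intro tendsto_intros ratio) auto
    also have "mp_root r y / (r * y) = mp_mean y (\<lambda>x. 1 / (x + r\<^sup>2))"
      using r y_pos by (subst mp_mean_resolvent) (auto simp: mp_root_def power2_eq_square mult_ac)
    finally show ?thesis .
  qed
  \<comment> \<open>Undoing the normalisation: the average of \<open>1 / (e + r\<^sup>2)\<close> over the eigenvalues is \<open>g\<^sub>1 / (r p / n)\<close>.\<close>
  have close_if: "\<forall>\<^sub>F n in sequentially. \<forall>\<omega>. dev (sqrt t) n \<omega> < (sqrt t * y * \<delta> / 2)\<^sup>2 \<longrightarrow>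
      \<bar>spectral_mean (eig n \<omega>) (\<lambda>x. 1 / (x + t)) - mp_mean y (\<lambda>x. 1 / (x + t))\<bar> < \<delta>"
    if t: "0 < t" and \<delta>: "0 < \<delta>" for t \<delta>
  proof -
    define r where "r = sqrt t"
    have r: "0 < r" "r\<^sup>2 = t" using t by (simp_all add: r_def)
    have "\<forall>\<^sub>F n in sequentially. dist (mp_root r (real (p n) / real n) / (r * (real (p n) / real n))) (mp_mean y (\<lambda>x. 1 / (x + r\<^sup>2))) < \<delta> / 2"
      using tendstoD[OF target_lim[OF r(1)], of "\<delta> / 2"] \<delta> by simp
    thus ?thesis using half_ev eventually_gt_at_top[of 0]
    proof eventually_elim
      case (elim n)
      show ?case
      proof (intro allI impI)
        fix \<omega> assume small: "dev (sqrt t) n \<omega> < (sqrt t * y * \<delta> / 2)\<^sup>2"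
        let ?yn = "real (p n) / real n" let ?g = "upper_trace r (p n) n (z n \<omega>)"
        have yn: "y / 2 < ?yn" "0 < ?yn" using elim(2) y_pos by linarith+
        have "spectral_mean (eig n \<omega>) (\<lambda>x. 1 / (x + t)) = ?g / (r * ?yn)"
          unfolding spectral_mean_def eig_def gram_eigenvalues(1)[OF elim(3)] r(2)[symmetric]
            gram_eigenvalues(3)[OF elim(3) r(1)] z_def using elim(3) r by simp
        hence "spectral_mean (eig n \<omega>) (\<lambda>x. 1 / (x + t)) - mp_root r ?yn / (r * ?yn) = (?g - mp_root r ?yn) / (r * ?yn)"
          by (simp only: diff_divide_distrib)
        moreover have "\<bar>(?g - mp_root r ?yn) / (r * ?yn)\<bar> < \<delta> / 2"
        proof -
          have "(2 * (?g - mp_root r ?yn))\<^sup>2 < (r * y * \<delta> / 2)\<^sup>2"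
            using small unfolding dev_def r_def[symmetric] norm_trace_deviation[OF r(1) elim(3)] .
          hence "\<bar>2 * (?g - mp_root r ?yn)\<bar> < r * y * \<delta> / 2"
            using r y_pos \<delta> by (intro power2_less_imp_less[of "\<bar>_\<bar>"]) auto
          hence "2 * \<bar>?g - mp_root r ?yn\<bar> < r * y * \<delta> / 2" by (simp only: abs_mult abs_numeral)
          moreover have "A < B / 4" if "2 * A < B / 2" for A B :: real using that by simp
          ultimately have "\<bar>?g - mp_root r ?yn\<bar> < r * y * \<delta> / 4" by blast
          also have "\<dots> = \<delta> / 2 * (r * (y / 2))" by simp
          also have "\<dots> < \<delta> / 2 * (r * ?yn)" using yn(1) \<delta> r(1) by (intro mult_strict_left_mono) auto
          finally have lt: "\<bar>?g - mp_root r ?yn\<bar> < \<delta> / 2 * (r * ?yn)" .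
          have pos: "0 < r * ?yn" using r(1) yn(2) by (rule mult_pos_pos)
          show ?thesis unfolding abs_divide abs_of_pos[OF pos] pos_divide_less_eq[OF pos] by (rule lt)
        qed
        ultimately show "\<bar>spectral_mean (eig n \<omega>) (\<lambda>x. 1 / (x + t)) - mp_mean y (\<lambda>x. 1 / (x + t))\<bar> < \<delta>"
          using elim(1) unfolding dist_real_def r(2) by linarith
      qed
    qed
  qed
  show ?thesis
    unfolding converges_in_prob_def
  proof (intro allI impI)
    fix \<epsilon> :: real assume \<epsilon>: "0 < \<epsilon>"
    have tight: "\<exists>A. 1 - \<eta> \<le> mp_mean y (indicat_real {..A})" if "0 < \<eta>" for \<eta>
      using mp_mean_tight[OF y_pos] that by (intro exI[of _ "edge_high y"]) simp
    from stieltjes_levy_continuity[OF mp_mean_functional[OF y_pos] tight \<epsilon>]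
    obtain T \<delta> where T: "finite T" "T \<subseteq> {0<..}" "0 < \<delta>"
      and levy: "\<And>\<nu>. stieltjes_close \<nu> (mp_mean y) T \<delta> \<Longrightarrow>
         levy_dist (\<lambda>x. \<nu> (indicat_real {..x})) (\<lambda>x. mp_mean y (indicat_real {..x})) \<le> \<epsilon>"
      by blast
    \<comment> \<open>The threshold for the squared deviation that makes the resolvent averages \<open>\<delta>\<close>-close.\<close>
    define \<kappa> where "\<kappa> t = (sqrt t * y * \<delta> / 2)\<^sup>2" for t
    have \<kappa>: "0 < \<kappa> t" if "t \<in> T" for t
      using that T y_pos unfolding \<kappa>_def by (intro zero_less_power mult_pos_pos divide_pos_pos) auto
    define F where "F n \<omega> = (let A = data_matrix (p n) n (X n) \<omega> in esd ((1 / real n) \<cdot>\<^sub>m (A * transpose_mat A)))" for n \<omega>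
    have F_eq: "F n \<omega> = (\<lambda>x. spectral_mean (eig n \<omega>) (indicat_real {..x}))" if "0 < n" for n \<omega>
      unfolding F_def Let_def esd_def[abs_def] spectral_mean_def eig_def gram_eigenvalues(1)[OF that]
      by (simp add: data_matrix_def)
    have "\<forall>\<^sub>F n in sequentially. \<forall>t\<in>T. \<forall>\<omega>. dev (sqrt t) n \<omega> < \<kappa> t \<longrightarrow>
      \<bar>spectral_mean (eig n \<omega>) (\<lambda>x. 1 / (x + t)) - mp_mean y (\<lambda>x. 1 / (x + t))\<bar> < \<delta>"
      unfolding \<kappa>_def using T by (intro eventually_ball_finite ballI close_if) auto
    moreover have "\<forall>\<^sub>F n in sequentially. \<forall>t\<in>T. integrable (M n) (dev (sqrt t) n)"
      using T by (intro eventually_ball_finite ballI dev_int) auto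
    ultimately have bound: "\<forall>\<^sub>F n in sequentially.
        measure (M n) {\<omega> \<in> space (M n). levy_dist (F n \<omega>) (mp_cdf y) > \<epsilon>} \<le> (\<Sum>t\<in>T. (LINT \<omega>|M n. dev (sqrt t) n \<omega>) / \<kappa> t)"
      using half_ev eventually_gt_at_top[of 0]
    proof eventually_elim
      case (elim n)
      interpret prob_space "M n" by (rule prob)
      let ?B = "\<lambda>t. {\<omega> \<in> space (M n). \<kappa> t \<le> dev (sqrt t) n \<omega>}"
      let ?L = "{\<omega> \<in> space (M n). levy_dist (F n \<omega>) (mp_cdf y) > \<epsilon>}"
      have pn: "0 < p n" using elim(3) y_pos by (intro Nat.gr0I) auto
      have Bm: "?B t \<in> sets (M n)" if "t \<in> T" for t
      proof -
        have [measurable]: "dev (sqrt t) n \<in> borel_measurable (M n)" using T that by (intro dev_meas) auto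
        show ?thesis by measurable
      qed
      have sub: "?L \<subseteq> (\<Union>t\<in>T. ?B t)"
      proof (rule subsetI, rule ccontr)
        fix \<omega> assume L: "\<omega> \<in> ?L" and notin: "\<omega> \<notin> (\<Union>t\<in>T. ?B t)"
        hence small: "\<forall>t\<in>T. dev (sqrt t) n \<omega> < \<kappa> t" by force
        have "mean_functional (spectral_mean (eig n \<omega>))"
        proof (rule spectral_mean_functional)
          have "size (eig n \<omega>) = p n" unfolding eig_def by (rule gram_eigenvalues(1)[OF elim(4)])
          thus "eig n \<omega> \<noteq> {#}" using pn by auto
          show "0 \<le> e" if "e \<in># eig n \<omega>" for e
            using that unfolding eig_def by (rule gram_eigenvalues(2)[OF elim(4)])
        qed
        hence "stieltjes_close (spectral_mean (eig n \<omega>)) (mp_mean y) T \<delta>"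
          unfolding stieltjes_close_def using small elim(1) by blast
        from levy[OF this] have "levy_dist (F n \<omega>) (mp_cdf y) \<le> \<epsilon>"
          unfolding F_eq[OF elim(4)] mp_mean_cdf[OF y_pos] .
        thus False using L by simp
      qed
      have "measure (M n) ?L \<le> measure (M n) (\<Union>t\<in>T. ?B t)"
      \<comment> \<open>The exceptional event need not be measurable; its measure is then \<open>0\<close> by convention.\<close>
      proof (cases "?L \<in> sets (M n)")
        case True
        thus ?thesis using sub T(1) Bm by (intro finite_measure_mono) auto
      qed (simp add: measure_notin_sets)
      also have "\<dots> \<le> (\<Sum>t\<in>T. measure (M n) (?B t))"
        using T(1) Bm by (intro finite_measure_subadditive_finite) auto
      also have "\<dots> \<le> (\<Sum>t\<in>T. (LINT \<omega>|M n. dev (sqrt t) n \<omega>) / \<kappa> t)"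
      proof (rule sum_mono)
        fix t assume t: "t \<in> T"
        show "measure (M n) (?B t) \<le> (LINT \<omega>|M n. dev (sqrt t) n \<omega>) / \<kappa> t"
        proof (rule integral_Markov_inequality_measure[OF bspec[OF elim(2) t] sets.top _ \<kappa>[OF t]])
          show "AE \<omega> in M n. 0 \<le> dev (sqrt t) n \<omega>" by (simp add: dev_def)
        qed
      qed
      finally show ?case .
    qed
    have "(\<lambda>n. \<Sum>t\<in>T. (LINT \<omega>|M n. dev (sqrt t) n \<omega>) / \<kappa> t) \<longlonglongrightarrow> (\<Sum>t\<in>T. 0 / \<kappa> t)"
      using T \<kappa> by (intro tendsto_sum tendsto_divide tendsto_const dev_lim) (auto simp: less_imp_neq[symmetric])
    hence "(\<lambda>n. \<Sum>t\<in>T. (LINT \<omega>|M n. dev (sqrt t) n \<omega>) / \<kappa> t) \<longlonglongrightarrow> 0" by simp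
    from tendsto_sandwich[OF always_eventually bound tendsto_const this]
    have "(\<lambda>n. measure (M n) {\<omega> \<in> space (M n). levy_dist (F n \<omega>) (mp_cdf y) > \<epsilon>}) \<longlonglongrightarrow> 0" by simp
    thus "(\<lambda>n. measure (M n) {\<omega> \<in> space (M n). levy_dist
         (let A = data_matrix (p n) n (X n) \<omega> in esd ((1 / real n) \<cdot>\<^sub>m (A * transpose_mat A))) (mp_cdf y) > \<epsilon>}) \<longlonglongrightarrow> 0"
      unfolding F_def .
  qed
qed

end
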